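(* Let $g(z)=\dfrac{(z+2)(z-1)^2}{\frac32 z-1}$, a critically finite hyperbolic rational map of degree $3$ for which $\infty$ is a fixed simple critical point. Let $\Omega$ be the Fatou component of $g$ containing $\infty$; then $g(\Omega)=\Omega$ and $g|_{\Omega}$ is conformally conjugate to $z\mapsto z^2$ on the unit disc. There is a point $x\in\partial\Omega$ having three distinct preimages under $g$ in $\partial\Omega$, i.e. $|(g|_{\partial\Omega})^{-1}(x)|=3>2$. Moreover, there is no polynomial $p$ of degree at least $2$ such that $g|_{\partial\Omega}:\partial\Omega\to\partial\Omega$ is topologically conjugate to $p|_{J(p)}:J(p)\to J(p)$.
   Context: $J(p)$ denotes the Julia set of $p$. For a rational map $f:\widehat{\mathbb C}\to\widehat{\mathbb C}$ with critical set $C(f)$, the postcritical set is $P(f)=\overline{\bigcup_{n>0}f^n(C(f))}$; $f$ is critically finite if $P(f)$ is finite and hyperbolic if $P(f)\cap J(f)=\emptyset$. A Fatou component is a connected component of the complement of the Julia set. *)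

theory Defs
  imports "HOL-Complex_Analysis.Complex_Analysis" "HOL-Computational_Algebra.Computational_Algebra"
begin

section \<open>The Riemann sphere\<close>

datatype rsphere = Fin complex | Infty

text \<open>Stereographic projection onto the unit sphere of \<open>complex \<times> real\<close>; the metric below is the
  chordal metric.\<close>

fun stereo :: "rsphere \<Rightarrow> complex \<times> real" where
  "stereo (Fin z) = ((2 / (1 + (cmod z)\<^sup>2)) *\<^sub>R z, ((cmod z)\<^sup>2 - 1) / ((cmod z)\<^sup>2 + 1))"
| "stereo Infty = (0, 1)"

lemma stereo_snd_Fin: "snd (stereo (Fin z)) = 1 - 2 / (1 + (cmod z)\<^sup>2)"
proof -
  have "1 + (cmod z)\<^sup>2 > 0"
    by (simp add: add_pos_nonneg)
  then show ?thesis
    by (simp add: field_simps)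
qed

lemma inj_stereo: "inj stereo"
proof (rule injI)
  fix x y assume eq: "stereo x = stereo y"
  have pos: "1 + (cmod z)\<^sup>2 > 0" for z :: complex
    by (simp add: add_pos_nonneg)
  have ne: "snd (stereo (Fin z)) \<noteq> 1" for z
    unfolding stereo_snd_Fin using pos[of z] by simp
  show "x = y"
  proof (cases x)
    case (Fin z)
    note x = this
    show ?thesis
    proof (cases y)
      case (Fin w)
      have "2 / (1 + (cmod z)\<^sup>2) = 2 / (1 + (cmod w)\<^sup>2)"
        using arg_cong[OF eq, of snd] unfolding x Fin stereo_snd_Fin by simp
      moreover have "(2 / (1 + (cmod z)\<^sup>2)) *\<^sub>R z = (2 / (1 + (cmod w)\<^sup>2)) *\<^sub>R w"
        using eq unfolding x Fin by simp
      moreover have "2 / (1 + (cmod w)\<^sup>2) \<noteq> 0"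
        using pos[of w] by simp
      ultimately show ?thesis
        unfolding x Fin by (metis scaleR_cancel_left)
    next
      case Infty
      then show ?thesis using eq ne[of z] x by simp
    qed
  next
    case Infty
    note x = this
    show ?thesis
    proof (cases y)
      case (Fin w)
      then show ?thesis using eq ne[of w] x by simp
    qed (simp add: x)
  qed
qed

instantiation rsphere :: metric_space
begin

definition dist_rsphere :: "rsphere \<Rightarrow> rsphere \<Rightarrow> real" where
  "dist_rsphere x y = dist (stereo x) (stereo y)"

definition uniformity_rsphere :: "(rsphere \<times> rsphere) filter" where
  "uniformity_rsphere = (INF e\<in>{0<..}. principal {(x, y). dist x y < e})"

definition open_rsphere :: "rsphere set \<Rightarrow> bool" where
  "open_rsphere U \<longleftrightarrow> (\<forall>x\<in>U. eventually (\<lambda>(x', y). x' = x \<longrightarrow> y \<in> U) uniformity)"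

instance
proof
  fix x y z :: rsphere
  show "(dist x y = 0) = (x = y)"
    using inj_stereo by (simp add: dist_rsphere_def inj_eq)
  show "dist x y \<le> dist x z + dist y z"
    by (simp add: dist_rsphere_def dist_triangle2)
qed (fact uniformity_rsphere_def open_rsphere_def)+

end

text \<open>\<open>param a\<close> is a local parametrisation of the sphere with \<open>param a 0 = a\<close>, and \<open>coord b\<close>
  the corresponding local coordinate, which vanishes at \<open>b\<close>. The values \<open>coord (Fin b) Infty\<close>
  and \<open>coord Infty (Fin 0)\<close> are junk, which is why \<open>sphere_holomorphic_on\<close> demands continuity.\<close>

fun param :: "rsphere \<Rightarrow> complex \<Rightarrow> rsphere" where
  "param (Fin a) w = Fin (a + w)"
| "param Infty w = (if w = 0 then Infty else Fin (1 / w))"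

fun coord :: "rsphere \<Rightarrow> rsphere \<Rightarrow> complex" where
  "coord (Fin b) (Fin z) = z - b"
| "coord (Fin b) Infty = 0"
| "coord Infty (Fin z) = 1 / z"
| "coord Infty Infty = 0"

definition local_rep :: "(rsphere \<Rightarrow> rsphere) \<Rightarrow> rsphere \<Rightarrow> complex \<Rightarrow> complex" where
  "local_rep f x = (\<lambda>w. coord (f x) (f (param x w)))"

definition sphere_holomorphic_on :: "(rsphere \<Rightarrow> rsphere) \<Rightarrow> rsphere set \<Rightarrow> bool" where
  "sphere_holomorphic_on f U \<longleftrightarrow>
     open U \<and> continuous_on U f \<and> (\<forall>x\<in>U. local_rep f x analytic_on {0})"

definition conformal_iso ::
    "rsphere set \<Rightarrow> rsphere set \<Rightarrow> (rsphere \<Rightarrow> rsphere) \<Rightarrow> (rsphere \<Rightarrow> rsphere) \<Rightarrow> bool" where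
  "conformal_iso U V \<phi> \<psi> \<longleftrightarrow>
     sphere_holomorphic_on \<phi> U \<and> sphere_holomorphic_on \<psi> V \<and> \<phi> ` U = V \<and> \<psi> ` V = U \<and>
     (\<forall>x\<in>U. \<psi> (\<phi> x) = x) \<and> (\<forall>y\<in>V. \<phi> (\<psi> y) = y)"


section \<open>Rational maps\<close>

text \<open>The self-map of the sphere given by \<open>p / q\<close>; meaningful for coprime \<open>p\<close>, \<open>q\<close> with
  \<open>q \<noteq> 0\<close>.\<close>

fun rat_map :: "complex poly \<Rightarrow> complex poly \<Rightarrow> rsphere \<Rightarrow> rsphere" where
  "rat_map p q (Fin z) = (if poly q z = 0 then Infty else Fin (poly p z / poly q z))"
| "rat_map p q Infty =
     (if degree p > degree q then Infty else Fin (coeff p (degree q) / coeff q (degree q)))"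

definition poly_map :: "complex poly \<Rightarrow> rsphere \<Rightarrow> rsphere" where
  "poly_map p = rat_map p 1"

definition rational_map_of_degree :: "(rsphere \<Rightarrow> rsphere) \<Rightarrow> nat \<Rightarrow> bool" where
  "rational_map_of_degree f d \<longleftrightarrow>
     (\<exists>p q. q \<noteq> 0 \<and> coprime p q \<and> d = max (degree p) (degree q) \<and> f = rat_map p q)"

definition critical_set :: "(rsphere \<Rightarrow> rsphere) \<Rightarrow> rsphere set" where
  "critical_set f = {x. deriv (local_rep f x) 0 = 0}"

definition simple_critical_point :: "(rsphere \<Rightarrow> rsphere) \<Rightarrow> rsphere \<Rightarrow> bool" where
  "simple_critical_point f x \<longleftrightarrow>
     x \<in> critical_set f \<and> deriv (deriv (local_rep f x)) 0 \<noteq> 0"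

definition postcritical_set :: "(rsphere \<Rightarrow> rsphere) \<Rightarrow> rsphere set" where
  "postcritical_set f = closure (\<Union>n\<in>{0<..}. (f ^^ n) ` critical_set f)"


section \<open>Fatou and Julia sets\<close>

definition normal_family_on :: "(rsphere \<Rightarrow> rsphere) set \<Rightarrow> rsphere set \<Rightarrow> bool" where
  "normal_family_on \<F> U \<longleftrightarrow>
     (\<forall>s :: nat \<Rightarrow> rsphere \<Rightarrow> rsphere. (\<forall>n. s n \<in> \<F>) \<longrightarrow>
        (\<exists>r h. strict_mono (r :: nat \<Rightarrow> nat) \<and>
           (\<forall>K. compact K \<and> K \<subseteq> U \<longrightarrow> uniform_limit K (\<lambda>n. s (r n)) h sequentially)))"

definition fatou_set :: "(rsphere \<Rightarrow> rsphere) \<Rightarrow> rsphere set" where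
  "fatou_set f = {x. \<exists>U. open U \<and> x \<in> U \<and> normal_family_on (range (\<lambda>n. f ^^ n)) U}"

definition julia_set :: "(rsphere \<Rightarrow> rsphere) \<Rightarrow> rsphere set" where
  "julia_set f = - fatou_set f"

definition critically_finite :: "(rsphere \<Rightarrow> rsphere) \<Rightarrow> bool" where
  "critically_finite f \<longleftrightarrow> finite (postcritical_set f)"

definition hyperbolic :: "(rsphere \<Rightarrow> rsphere) \<Rightarrow> bool" where
  "hyperbolic f \<longleftrightarrow> postcritical_set f \<inter> julia_set f = {}"


section \<open>Conjugacy\<close>

text \<open>In both definitions the sets are meant to be forward invariant under the respective maps.\<close>

definition conformally_conjugate ::
    "(rsphere \<Rightarrow> rsphere) \<Rightarrow> rsphere set \<Rightarrow> (rsphere \<Rightarrow> rsphere) \<Rightarrow> rsphere set \<Rightarrow> bool" where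
  "conformally_conjugate f U g V \<longleftrightarrow>
     (\<exists>\<phi> \<psi>. conformal_iso U V \<phi> \<psi> \<and> (\<forall>x\<in>U. \<phi> (f x) = g (\<phi> x)))"

definition topologically_conjugate ::
    "('a::topological_space \<Rightarrow> 'a) \<Rightarrow> 'a set \<Rightarrow> ('b::topological_space \<Rightarrow> 'b) \<Rightarrow> 'b set \<Rightarrow> bool" where
  "topologically_conjugate f A g B \<longleftrightarrow>
     (\<exists>h k. homeomorphism A B h k \<and> (\<forall>x\<in>A. h (f x) = g (h x)))"

end

(*
  Omega is the component of the basin of infinity that contains infinity.  Let G be the map g in
  the plane and "filled" the compact set of points of the plane outside this basin.

  The preimage of the interval [-2, 0] contains the loop of a Maclaurin trisectrix.  The loop does
  not escape and encloses the pole 2/3 and the preimage sqrt 3 - 1 of 2, so the closure of Omega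
  lies outside it.  Since "filled" is connected (0 is the only preimage of -2), Omega is simply
  connected, and since the pole is not in Omega, the Riemann map turns G into a proper self-map of
  the disc whose only zero is a double one, i.e. into c z^2 with |c| = 1.

  The fixed point alpha = (-1 - sqrt 17) / 4 is accessible from Omega: conj o G has an inverse
  branch on the upper half plane that preserves Omega there and contracts towards alpha.  Points of
  Omega close to alpha have two preimages in Omega, hence one of the three preimages alpha, gamma,
  conj gamma of alpha other than alpha itself is in the boundary, and by symmetry all of them are.

  Finally, a conjugate polynomial would have degree at least 3 because of alpha.  But boundary
  points near 2 have a preimage near sqrt 3 - 1, off the boundary, hence at most two preimages in
  the boundary, whereas all but finitely many points of a polynomial Julia set have as many
  preimages as the degree, all of them in the Julia set.
*)
theory Submission
  imports Defs
begin

section \<open>Topology of the sphere\<close>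

text \<open>The critical orbits are 1 -> 0 -> -2 -> 0, with local degree 3 at 0 because G z + 2 =
  z^3 / (3/2 z - 1), and the fixed point infinity with local degree 2. The obstacle is that a point
  of Omega has only two preimages in Omega, so a limit argument from inside gives at most two
  boundary preimages of any point. The third one over alpha is supplied by reflection, which needs a
  real alpha with a nonreal pair in its fibre. The multiplier of G at alpha is -3 alpha / (3/2 alpha
  - 1), about -1.316. Being negative, it makes G exchange the half planes near alpha, whence the
  conjugation in conj o G; its modulus exceeds the rate 6/5 used for the contraction. The fixed
  point 2 is where to look for small fibres because the ray beyond it lies in Omega, so that
  boundary points occur at every small distance from it. Normality is always obtained from explicit
  uniform convergence of iterates, and its failure from a limit function that would be
  discontinuous; Omega is thus identified from the basin of infinity and its frontier alone.\<close>

lemma dist_stereo: "dist (stereo x) (stereo y) = dist x y"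
  by (simp add: dist_rsphere_def)

lemma continuous_on_stereo: "continuous_on S stereo"
  unfolding continuous_on_iff dist_stereo by blast

lemma one_plus_cmod2_pos: "1 + (cmod z)\<^sup>2 > 0"
  by (simp add: add_pos_nonneg)

lemma dist_Fin_Infty: "dist (Fin z) Infty = 2 / sqrt (1 + (cmod z)\<^sup>2)"
proof -
  define s where "s = 1 + (cmod z)\<^sup>2"
  have s: "s > 0"
    unfolding s_def by (rule one_plus_cmod2_pos)
  have "(dist (Fin z) Infty)\<^sup>2 = (cmod ((2 / s) *\<^sub>R z))\<^sup>2 + (((s - 2) / s) - 1)\<^sup>2"
    by (simp add: dist_rsphere_def dist_prod_def dist_norm s_def add.commute)
  also have "\<dots> = 4 / s"
  proof -
    have "(cmod ((2 / s) *\<^sub>R z))\<^sup>2 = 4 / s\<^sup>2 * (s - 1)"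
      using s by (simp add: s_def power_mult_distrib power_divide)
    moreover have "((s - 2) / s - 1)\<^sup>2 = 4 / s\<^sup>2"
      using s by (simp add: field_simps power2_eq_square)
    ultimately show ?thesis
      using s by (simp add: field_simps power2_eq_square)
  qed
  also have "\<dots> = (2 / sqrt s)\<^sup>2"
    using s by (simp add: power_divide)
  finally show ?thesis
    using s by (simp add: power2_eq_iff_nonneg s_def)
qed

lemma continuous_on_Fin: "continuous_on S Fin"
proof -
  have "continuous_on S (stereo \<circ> Fin)"
    unfolding o_def stereo.simps
    by (intro continuous_intros) (metis one_plus_cmod2_pos less_irrefl add.commute)+
  then show ?thesis
    by (simp add: continuous_on_iff dist_stereo del: stereo.simps)
qed

lemma open_vimage_Fin: "open U \<Longrightarrow> open (Fin -` U)"
  by (simp add: open_vimage continuous_on_Fin)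

lemma open_image_Fin:
  assumes "open V"
  shows "open (Fin ` V)"
proof -
  \<comment> \<open>Inverse stereographic projection, continuous off the north pole
    \<open>(0, 1)\<close>; the image of \<open>V\<close> under \<open>Fin\<close> becomes a preimage
    under \<open>p\<close>.\<close>
  define p where "p = (\<lambda>x. fst (stereo x) /\<^sub>R (1 - snd (stereo x)))"
  have p: "p (Fin z) = z" for z
  proof -
    have "1 - snd (stereo (Fin z)) = 2 / (1 + (cmod z)\<^sup>2)"
      by (simp only: stereo_snd_Fin)
    moreover have "fst (stereo (Fin z)) = (2 / (1 + (cmod z)\<^sup>2)) *\<^sub>R z"
      by simp
    moreover have "2 / (1 + (cmod z)\<^sup>2) \<noteq> 0"
      using one_plus_cmod2_pos[of z] by (simp add: less_imp_neq)
    ultimately show ?thesis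
      unfolding p_def by (smt (verit) scaleR_scaleR left_inverse scaleR_one)
  qed
  have "snd (stereo x) \<noteq> 1" if "x \<noteq> Infty" for x
  proof (cases x)
    case (Fin z)
    then show ?thesis
      using one_plus_cmod2_pos[of z] by (simp only: stereo_snd_Fin) (simp add: less_imp_neq)
  qed (use that in simp)
  then have "continuous_on (- {Infty}) p"
    unfolding p_def by (intro continuous_intros continuous_on_stereo) auto
  then have "open (- {Infty} \<inter> p -` V)"
    using assms by (intro continuous_open_preimage) auto
  moreover have "- {Infty} \<inter> p -` V = Fin ` V"
  proof safe
    fix x assume "p x \<in> V" "x \<notin> Fin ` V"
    then show "x = Infty"
      using p by (cases x) auto
  qed (auto simp: p)
  ultimately show ?thesis by simp
qed

lemma open_insert_Infty: "open (insert Infty (Fin ` {z. r < cmod z}))"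
proof -
  have "closed (Fin ` cball 0 r)"
    by (intro compact_imp_closed compact_continuous_image continuous_on_Fin compact_cball)
  moreover have "- Fin ` cball 0 r = insert Infty (Fin ` {z. r < cmod z})"
  proof (rule set_eqI)
    show "x \<in> - Fin ` cball 0 r \<longleftrightarrow> x \<in> insert Infty (Fin ` {z. r < cmod z})" for x
      by (cases x) (auto simp: image_iff)
  qed
  ultimately show ?thesis
    by (metis open_Compl)
qed

section \<open>Neighbourhood filters in local parameters\<close>

lemma nhds_Fin: "nhds (Fin z) = filtermap Fin (nhds z)"
proof (rule antisym)
  show "filtermap Fin (nhds z) \<le> nhds (Fin z)"
    using continuous_on_Fin[of UNIV] by (simp add: continuous_on_def filterlim_def flip: nhds_def)
       (metis UNIV_I continuous_on_Fin continuous_on_eq_continuous_at filterlim_def isContD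
         open_UNIV tendsto_at_iff_tendsto_nhds)
  show "nhds (Fin z) \<le> filtermap Fin (nhds z)"
  proof (rule filter_leI)
    fix P assume "eventually P (filtermap Fin (nhds z))"
    then obtain V where "open V" "z \<in> V" "\<forall>x\<in>V. P (Fin x)"
      by (auto simp: eventually_filtermap eventually_nhds)
    then show "eventually P (nhds (Fin z))"
      unfolding eventually_nhds by (intro exI[of _ "Fin ` V"]) (auto intro: open_image_Fin)
  qed
qed

lemma nhds_Infty: "nhds Infty = filtermap (param Infty) (nhds 0)"
proof (rule antisym)
  have "((\<lambda>w. dist (param Infty w) Infty) \<longlongrightarrow> 0) (nhds 0)"
  proof (rule tendsto_sandwich[of "\<lambda>_. 0" _ _ "\<lambda>w. 2 * cmod w"])
    have "dist (param Infty w) Infty \<le> 2 * cmod w" for w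
    proof (cases "w = 0")
      case False
      have "sqrt (1 + (cmod (1 / w))\<^sup>2) \<ge> sqrt ((cmod (1 / w))\<^sup>2)"
        by (subst real_sqrt_le_iff) simp
      then have "sqrt (1 + (cmod (1 / w))\<^sup>2) \<ge> 1 / cmod w"
        by (simp add: norm_divide)
      then have "2 / sqrt (1 + (cmod (1 / w))\<^sup>2) \<le> 2 / (1 / cmod w)"
        using False by (intro divide_left_mono) (auto intro!: mult_pos_pos simp: one_plus_cmod2_pos)
      then show ?thesis
        using False by (simp add: dist_Fin_Infty)
    qed simp
    then show "\<forall>\<^sub>F w in nhds 0. dist (param Infty w) Infty \<le> 2 * cmod w"
      by simp
    have "((\<lambda>w::complex. 2 * cmod w) \<longlongrightarrow> 2 * cmod 0) (nhds 0)"
      by (intro tendsto_intros filterlim_ident)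
    then show "((\<lambda>w::complex. 2 * cmod w) \<longlongrightarrow> 0) (nhds 0)"
      by simp
  qed auto
  then show "filtermap (param Infty) (nhds 0) \<le> nhds Infty"
    unfolding filterlim_def[symmetric] by (subst tendsto_dist_iff)
  show "nhds Infty \<le> filtermap (param Infty) (nhds 0)"
  proof (rule filter_leI)
    fix P assume "eventually P (filtermap (param Infty) (nhds 0))"
    then obtain e where e: "e > 0" "\<And>w. dist w 0 < e \<Longrightarrow> P (param Infty w)"
      by (auto simp: eventually_filtermap eventually_nhds_metric)
    have "P (Fin z)" if "1 / e < cmod z" for z
    proof -
      have "z \<noteq> 0"
        using that e(1) by (auto simp: divide_less_0_iff not_less)
      moreover have "1 / cmod z < e"
        using that e(1) \<open>z \<noteq> 0\<close> by (simp add: field_simps)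
      ultimately show ?thesis
        using e(2)[of "1 / z"] by (simp add: norm_divide)
    qed
    moreover have "P Infty"
      using e(1) e(2)[of 0] by simp
    ultimately show "eventually P (nhds Infty)"
      unfolding eventually_nhds
      by (intro exI[of _ "insert Infty (Fin ` {z. 1 / e < cmod z})"]) (auto intro: open_insert_Infty)
  qed
qed

text \<open>Turns continuity on the sphere into a limit at 0 in the same parameter that
  \<open>local_rep\<close> uses.\<close>

lemma nhds_eq_param: "nhds x = filtermap (param x) (nhds 0)"
proof (cases x)
  case (Fin a)
  have "nhds a = filtermap (\<lambda>w. a + w) (nhds 0)"
    using filtermap_nhds_shift[of "-a" 0] by (simp add: add.commute)
  then show ?thesis
    by (simp add: Fin nhds_Fin filtermap_filtermap) (simp add: filtermap_def)
qed (simp add: nhds_Infty)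

lemma isCont_sphere_iff: "isCont f x \<longleftrightarrow> ((\<lambda>w. f (param x w)) \<longlongrightarrow> f x) (nhds 0)"
  for f :: "rsphere \<Rightarrow> 'a::topological_space"
  by (simp add: continuous_at tendsto_at_iff_tendsto_nhds nhds_eq_param[of x] filterlim_filtermap)

lemma tendsto_param: "(f \<longlongrightarrow> 0) F \<Longrightarrow> ((\<lambda>w. param x (f w)) \<longlongrightarrow> x) F"
  by (rule filterlim_compose[of "param x" _ "nhds 0"]) (simp_all add: filterlim_def nhds_eq_param[of x])

lemma dist_Infty_less:
  assumes "e > 0"
  obtains r where "r > 0" "\<And>z. cmod z > r \<Longrightarrow> dist (Fin z) Infty < e"
proof -
  have "eventually (\<lambda>w. dist (param Infty w) Infty < e) (nhds 0)"
    using tendstoD[OF tendsto_param[OF filterlim_ident] assms] .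
  then obtain d where d: "d > 0" "\<And>w. cmod w < d \<Longrightarrow> dist (param Infty w) Infty < e"
    by (auto simp: eventually_nhds_metric)
  have "dist (Fin z) Infty < e" if "cmod z > 1 / d" for z
  proof -
    have "z \<noteq> 0"
      using that d(1) by (auto simp: divide_less_0_iff not_less)
    then show ?thesis
      using d(2)[of "1 / z"] that d(1) by (simp add: norm_divide field_simps)
  qed
  then show thesis
    using that[of "1 / d"] d(1) by simp
qed

lemma dist_Fin_less:
  assumes "e > 0"
  obtains d where "d > 0" "\<And>z. dist z a < d \<Longrightarrow> dist (Fin z) (Fin a) < e"
  using continuous_on_Fin[of UNIV] assms unfolding continuous_on_iff by (metis UNIV_I)

lemma closure_insert_Infty_subset:
  "closure (insert Infty (Fin ` C)) \<subseteq> insert Infty (Fin ` closure C)"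
proof
  fix x assume x: "x \<in> closure (insert Infty (Fin ` C))"
  show "x \<in> insert Infty (Fin ` closure C)"
  proof (cases x)
    case (Fin z)
    have "z \<in> closure C"
    proof (rule ccontr)
      assume "z \<notin> closure C"
      then have "x \<in> Fin ` (- closure C)"
        by (simp add: Fin)
      moreover have "open (Fin ` (- closure C))"
        by (rule open_image_Fin) (rule open_Compl, rule closed_closure)
      ultimately have "insert Infty (Fin ` C) \<inter> Fin ` (- closure C) \<noteq> {}"
        using x by (metis Int_commute open_Int_closure_eq_empty disjoint_iff)
      then show False
        using closure_subset[of C] by auto
    qed
    then show ?thesis
      by (simp add: Fin)
  qed simp
qed

lemma frontier_insert_Infty:
  assumes "open C" "{z. r < cmod z} \<subseteq> C"
  shows "open (insert Infty (Fin ` C))" "frontier (insert Infty (Fin ` C)) = Fin ` frontier C"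
proof -
  have eq: "insert Infty (Fin ` C) = insert Infty (Fin ` {z. r < cmod z}) \<union> Fin ` C"
    using assms(2) by auto
  show op: "open (insert Infty (Fin ` C))"
    unfolding eq by (intro open_Un open_insert_Infty open_image_Fin assms)
  have "Fin ` closure C \<subseteq> closure (insert Infty (Fin ` C))"
    by (rule image_closure_subset[OF continuous_on_Fin]) (use closure_subset[of "insert Infty (Fin ` C)"] in blast)+
  then have "closure (insert Infty (Fin ` C)) = insert Infty (Fin ` closure C)"
    using closure_insert_Infty_subset[of C] closure_subset[of "insert Infty (Fin ` C)"] by blast
  then show "frontier (insert Infty (Fin ` C)) = Fin ` frontier C"
    using op assms(1) by (auto simp: frontier_def interior_open)
qed

lemma connected_insert_Infty:
  assumes "connected C" "{z. r < cmod z} \<subseteq> C"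
  shows "connected (insert Infty (Fin ` C))"
proof (rule connected_intermediate_closure)
  show "connected (Fin ` C)"
    by (rule connected_continuous_image[OF continuous_on_Fin assms(1)])
  have "Infty \<in> closure (Fin ` C)"
  proof (rule ccontr)
    assume "Infty \<notin> closure (Fin ` C)"
    then have "eventually (\<lambda>x. x \<in> - closure (Fin ` C)) (nhds Infty)"
      by (intro eventually_nhds_in_open) auto
    then obtain e where e: "e > 0" "\<And>w. cmod w < e \<Longrightarrow> param Infty w \<notin> closure (Fin ` C)"
      unfolding nhds_Infty eventually_filtermap eventually_nhds_metric dist_norm by auto
    define t where "t = \<bar>r\<bar> + 1 + 1 / e"
    have "1 / e > 0"
      using e(1) by simp
    then have t: "t > 0" "r < t" "1 / e < t"
      unfolding t_def by linarith+
    have "cmod (1 / of_real t) = 1 / t"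
      using t(1) by (simp add: norm_divide)
    also have "1 / t < e"
      using t e(1) by (simp add: field_simps)
    finally have "param Infty (1 / of_real t) \<notin> closure (Fin ` C)"
      by (rule e(2))
    then have "Fin (of_real t) \<notin> closure (Fin ` C)"
      using t(1) by simp
    moreover have "of_real t \<in> C"
      using assms(2) t by auto
    ultimately show False
      using closure_subset[of "Fin ` C"] by blast
  qed
  then show "insert Infty (Fin ` C) \<subseteq> closure (Fin ` C)"
    using closure_subset[of "Fin ` C"] by simp
qed auto

section \<open>Normality criteria\<close>

text \<open>Normality concerns arbitrary sequences of iterates, repetitions included. The indices
  either take one value infinitely often, which gives a constant subsequence, or tend to infinity,
  which gives the limit \<open>h\<close> itself.\<close>

lemma subsequence_uniform_limit:
  fixes n :: "nat \<Rightarrow> nat"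
  assumes lim: "uniform_limit K f h sequentially"
  obtains r h' where "strict_mono (r :: nat \<Rightarrow> nat)" "uniform_limit K (\<lambda>i. f (n (r i))) h' sequentially"
proof (cases "\<exists>v. infinite {i. n i = v}")
  case True
  then obtain v where "infinite {i. n i = v}" by blast
  then obtain r :: "nat \<Rightarrow> nat" where "strict_mono r" "\<And>i. r i \<in> {i. n i = v}"
    using infinite_enumerate by blast
  then show thesis
    by (intro that[of r "f v"]) (auto simp: uniform_limit_iff)
next
  case False
  have "filterlim n at_top sequentially"
    unfolding filterlim_at_top
  proof
    fix Z
    have "finite (\<Union>v\<in>{..<Z}. {i. n i = v})"
      using False by blast
    moreover have "(\<Union>v\<in>{..<Z}. {i. n i = v}) = {i. \<not> Z \<le> n i}"
      by auto
    ultimately show "\<forall>\<^sub>F i in sequentially. Z \<le> n i"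
      by (simp flip: cofinite_eq_sequentially add: eventually_cofinite)
  qed
  then have "uniform_limit K (\<lambda>i. f (n i)) h sequentially"
    using lim unfolding uniform_limit_iff by (auto dest: eventually_compose_filterlim)
  then show thesis
    by (intro that[of id h]) (auto simp: strict_mono_id)
qed

text \<open>Near a two-cycle the even and the odd iterates have different limits. One parity occurs
  infinitely often in any sequence of iterates, and the indices of that parity are handled by
  \<open>subsequence_uniform_limit\<close>.\<close>

lemma normal_family_on_iterates:
  assumes "uniform_limit U (\<lambda>k. f ^^ (2 * k)) h0 sequentially"
    and "uniform_limit U (\<lambda>k. f ^^ (2 * k + 1)) h1 sequentially"
  shows "normal_family_on (range (\<lambda>n. f ^^ n)) U"
  unfolding normal_family_on_def
proof (intro allI impI)
  fix s :: "nat \<Rightarrow> rsphere \<Rightarrow> rsphere"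
  assume "\<forall>n. s n \<in> range (\<lambda>n. f ^^ n)"
  then have "\<forall>n. \<exists>m. s n = f ^^ m" by blast
  then obtain m where m: "\<And>n. s n = f ^^ (m n)" by metis
  have "infinite {i. even (m i)} \<or> infinite {i. odd (m i)}"
  proof -
    have "{i. even (m i)} \<union> {i. odd (m i)} = UNIV"
      by auto
    then show ?thesis
      using infinite_UNIV_nat by (metis finite_UnI)
  qed
  then obtain b h where b: "infinite {i. m i mod 2 = b}"
      "uniform_limit U (\<lambda>k. f ^^ (2 * k + b)) h sequentially"
  proof
    assume "infinite {i. even (m i)}"
    then show ?thesis
      using assms(1) by (intro that[of 0 h0]) (simp_all add: even_iff_mod_2_eq_zero)
  next
    assume "infinite {i. odd (m i)}"
    then show ?thesis
      using assms(2) by (intro that[of 1 h1]) (simp_all add: odd_iff_mod_2_eq_one)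
  qed
  obtain r0 :: "nat \<Rightarrow> nat" where r0: "strict_mono r0" "\<And>i. r0 i \<in> {i. m i mod 2 = b}"
    using b(1) infinite_enumerate by blast
  obtain r h' where r: "strict_mono (r :: nat \<Rightarrow> nat)"
      "uniform_limit U (\<lambda>i. f ^^ (2 * (m (r0 (r i)) div 2) + b)) h' sequentially"
    using subsequence_uniform_limit[OF b(2), of "\<lambda>i. m (r0 i) div 2"] by blast
  have "m (r0 i) mod 2 = b" for i
    using r0(2) by simp
  then have "2 * (m (r0 (r i)) div 2) + b = m (r0 (r i))" for i
    by (metis div_mult_mod_eq mult.commute)
  with r have "uniform_limit U (\<lambda>i. s ((r0 \<circ> r) i)) h' sequentially"
    by (simp add: m)
  moreover have "strict_mono (r0 \<circ> r)"
    using r0(1) r(1) by (rule strict_mono_o)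
  ultimately show "\<exists>r h. strict_mono (r :: nat \<Rightarrow> nat) \<and>
      (\<forall>K. compact K \<and> K \<subseteq> U \<longrightarrow> uniform_limit K (\<lambda>n. s (r n)) h sequentially)"
    by (meson uniform_limit_on_subset)
qed

lemma normal_family_on_iterates_const:
  assumes "uniform_limit U (\<lambda>n. f ^^ n) (\<lambda>_. a) sequentially"
  shows "normal_family_on (range (\<lambda>n. f ^^ n)) U"
proof (rule normal_family_on_iterates)
  have lim: "uniform_limit U (\<lambda>k. f ^^ p k) (\<lambda>_. a) sequentially"
    if "strict_mono p" for p :: "nat \<Rightarrow> nat"
    unfolding uniform_limit_iff
  proof (intro allI impI)
    fix e :: real assume "e > 0"
    then have "\<forall>\<^sub>F n in sequentially. \<forall>x\<in>U. dist ((f ^^ n) x) a < e"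
      using assms unfolding uniform_limit_iff by blast
    then show "\<forall>\<^sub>F n in sequentially. \<forall>x\<in>U. dist ((f ^^ p n) x) a < e"
      by (rule eventually_compose_filterlim) (rule filterlim_subseq[OF that])
  qed
  show "uniform_limit U (\<lambda>k. f ^^ (2 * k)) (\<lambda>_. a) sequentially"
       "uniform_limit U (\<lambda>k. f ^^ (2 * k + 1)) (\<lambda>_. a) sequentially"
    by (intro lim strict_monoI; simp)+
qed

text \<open>A locally uniform limit \<open>h\<close> of iterates near \<open>z\<close> would be
  continuous. It equals \<open>a\<close> on the points of \<open>A\<close>, which accumulate at
  \<open>z\<close>, but at \<open>z\<close> itself the orbit never enters \<open>B\<close>, so
  \<open>h\<close> takes a value in the closed complement of \<open>B\<close> there.\<close>

lemma frontier_escaping_set_subset_julia: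
  fixes f :: "rsphere \<Rightarrow> rsphere"
  assumes cont: "continuous_on UNIV f" and B: "open B" "a \<in> B"
    and A: "A = {x. \<exists>n. (f ^^ n) x \<in> B}" "open A"
    and lim: "\<And>x. x \<in> A \<Longrightarrow> (\<lambda>n. (f ^^ n) x) \<longlonglongrightarrow> a"
    and z: "Fin z \<in> frontier A"
  shows "Fin z \<in> julia_set f"
proof -
  have nA: "Fin z \<notin> A"
    using z A(2) by (simp add: frontier_def interior_open)
  have "Fin z \<notin> fatou_set f"
  proof
    assume "Fin z \<in> fatou_set f"
    then obtain U where U: "open U" "Fin z \<in> U" "normal_family_on (range (\<lambda>n. f ^^ n)) U"
      by (auto simp: fatou_set_def)
    from U(3)[unfolded normal_family_on_def, rule_format, of "\<lambda>n. f ^^ n"]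
    obtain r h where r: "strict_mono (r :: nat \<Rightarrow> nat)"
      and unif: "\<And>K. compact K \<and> K \<subseteq> U \<Longrightarrow> uniform_limit K (\<lambda>n. f ^^ (r n)) h sequentially"
      by blast
    obtain e where e: "e > 0" "cball z e \<subseteq> Fin -` U"
      using open_vimage_Fin[OF U(1)] U(2) unfolding open_contains_cball by blast
    define K where "K = Fin ` cball z e"
    have K: "uniform_limit K (\<lambda>n. f ^^ (r n)) h sequentially"
      using e unfolding K_def
      by (intro unif conjI compact_continuous_image continuous_on_Fin) auto
    have contn: "continuous_on UNIV (f ^^ n)" for n
      by (induction n) (auto simp: o_def intro: continuous_on_compose2[OF cont])
    have hK: "continuous_on K h"
      by (rule uniform_limit_theorem[OF always_eventually K])
        (auto intro: continuous_on_subset[OF contn])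
    have hlim: "(\<lambda>n. (f ^^ (r n)) x) \<longlonglongrightarrow> h x" if "x \<in> K" for x
      using tendsto_uniform_limitI[OF K that] .
    have hA: "h x = a" if "x \<in> K" "x \<in> A" for x
      using LIMSEQ_unique[OF LIMSEQ_subseq_LIMSEQ[OF lim[OF that(2)] r, unfolded o_def] hlim[OF that(1)]]
      by simp
    have "h (Fin z) \<in> - B"
    proof (rule Lim_in_closed_set[OF _ _ _ hlim])
      show "\<forall>\<^sub>F n in sequentially. (f ^^ (r n)) (Fin z) \<in> - B"
        using nA A(1) by auto
    qed (use B e in \<open>auto simp: K_def\<close>)
    then have "h (Fin z) \<noteq> a"
      using B by auto
    then have "\<exists>V. open V \<and> h (Fin z) \<in> V \<and> a \<notin> V"
      by (metis t1_space)
    then obtain V where V: "open V" "h (Fin z) \<in> V" "a \<notin> V" by blast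
    have "continuous_on (cball z e) (h \<circ> Fin)"
      by (rule continuous_on_compose[OF continuous_on_Fin]) (use hK in \<open>simp add: K_def\<close>)
    then have "continuous (at z within ball z e) (h \<circ> Fin)"
      using e(1) by (metis ball_subset_cball centre_in_cball continuous_on_eq_continuous_within
          continuous_within_subset less_imp_le)
    then have "isCont (h \<circ> Fin) z"
      using e(1) by (simp add: at_within_open[of z "ball z e"])
    then have "\<forall>\<^sub>F w in nhds z. (h \<circ> Fin) w \<in> V"
      unfolding continuous_at tendsto_at_iff_tendsto_nhds
      by (rule topological_tendstoD) (use V in auto)
    then have "\<forall>\<^sub>F w in nhds z. h (Fin w) \<in> V \<and> w \<in> ball z e"
      using e(1) by (intro eventually_conj eventually_nhds_in_open) auto
    then have "\<forall>\<^sub>F w in nhds z. Fin w \<notin> A"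
      by (rule eventually_mono) (use V(3) hA in \<open>auto simp: K_def\<close>)
    then have "\<forall>\<^sub>F x in nhds (Fin z). x \<notin> A"
      by (simp add: nhds_Fin eventually_filtermap)
    then obtain W where "open W" "Fin z \<in> W" "W \<inter> A = {}"
      by (auto simp: eventually_nhds)
    then show False
      using z by (metis Diff_iff disjoint_iff frontier_def Int_commute open_Int_closure_eq_empty)
  qed
  then show ?thesis
    by (simp add: julia_set_def)
qed

section \<open>The cubic rational map\<close>

text \<open>At the pole 2/3 division by zero gives the junk value 0, a point that does not escape;
  hence the recurring side condition \<open>z \<noteq> 2 / 3\<close>.\<close>

definition G :: "complex \<Rightarrow> complex" where
  "G z = (z ^ 3 - 3 * z + 2) / (3 / 2 * z - 1)"

text \<open>\<open>G\<close> in the coordinate 1/z. The factor \<open>w\<^sup>2\<close> shows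
  infinity as a critical fixed point, and the root 3/2 is the pole of \<open>G\<close>.\<close>

definition Ghat :: "complex \<Rightarrow> complex" where
  "Ghat w = w\<^sup>2 * (3 / 2 - w) / (1 - 3 * w\<^sup>2 + 2 * w ^ 3)"

definition gmap :: "rsphere \<Rightarrow> rsphere" where
  "gmap = rat_map ([:2, 1:] * [:-1, 1:]\<^sup>2) [:-1, 3/2:]"

lemma denom_eq_0_iff: "3 / 2 * z - 1 = 0 \<longleftrightarrow> z = (2 / 3 :: complex)"
  by (auto simp: field_simps)

lemma G_eq_iff: "z \<noteq> 2 / 3 \<Longrightarrow> G z = y \<longleftrightarrow> z ^ 3 - 3 * z + 2 = y * (3 / 2 * z - 1)"
  using denom_eq_0_iff[of z] by (simp only: G_def) (simp add: divide_eq_eq)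

lemma numer_eq: "[:2, 1:] * [:-1, 1:]\<^sup>2 = [:2, -3, 0, 1 :: complex:]"
  by (simp add: power2_eq_square)

lemma poly_numer: "poly ([:2, 1:] * [:-1, 1:]\<^sup>2) z = z ^ 3 - 3 * z + (2::complex)"
  unfolding numer_eq by (simp add: algebra_simps power2_eq_square power3_eq_cube)

lemma degree_numer: "degree ([:2, 1:] * [:-1, 1:]\<^sup>2 :: complex poly) = 3"
  unfolding numer_eq by simp

lemma gmap_Fin: "gmap (Fin z) = (if z = 2 / 3 then Infty else Fin (G z))"
proof -
  have "poly [:-1, 3/2:] z = 3 / 2 * z - 1"
    by (simp add: algebra_simps)
  then show ?thesis
    unfolding gmap_def rat_map.simps poly_numer G_def by (simp only: denom_eq_0_iff)
qed

lemma gmap_Infty: "gmap Infty = Infty"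
  unfolding gmap_def rat_map.simps degree_numer by simp

lemma Ghat_denom: "1 - 3 * w\<^sup>2 + 2 * w ^ 3 = (1 - w)\<^sup>2 * (1 + 2 * w)" for w :: complex
  by (simp add: algebra_simps power2_eq_square power3_eq_cube)

lemma inverse_G: "w \<noteq> 0 \<Longrightarrow> 1 / G (1 / w) = Ghat w"
proof -
  assume w: "w \<noteq> 0"
  have "(1 / w) ^ 3 - 3 * (1 / w) + 2 = (1 - 3 * w\<^sup>2 + 2 * w ^ 3) / w ^ 3"
    using w by (simp add: field_simps power2_eq_square power3_eq_cube)
  moreover have "3 / 2 * (1 / w) - 1 = w\<^sup>2 * (3 / 2 - w) / w ^ 3"
    using w by (simp add: field_simps power2_eq_square power3_eq_cube)
  ultimately show ?thesis
    unfolding G_def Ghat_def using w by simp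
qed

text \<open>The excluded \<open>w\<close> are 1 and -1/2, reciprocals of the zeros 1 and -2 of
  \<open>G\<close>: their image \<open>Fin 0\<close> is the one point that
  \<open>param Infty\<close> misses.\<close>

lemma gmap_param_Infty:
  assumes "1 - 3 * w\<^sup>2 + 2 * w ^ 3 \<noteq> 0"
  shows "gmap (param Infty w) = param Infty (Ghat w)"
proof (cases "w = 0")
  case False
  have eq: "1 / w = 2 / 3 \<longleftrightarrow> w = 3 / 2"
    using False by (auto simp: field_simps)
  have G: "G (1 / w) = 1 / Ghat w"
    using inverse_G[OF False] by (metis div_by_1 divide_divide_eq_right mult_1)
  have "Ghat w = 0 \<longleftrightarrow> w = 3 / 2"
    using assms False by (simp add: Ghat_def)
  then show ?thesis
    using False G eq by (simp add: gmap_Fin)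
qed (simp add: gmap_Infty Ghat_def)

lemma gmap_near_pole:
  assumes "N = (2 / 3 + w) ^ 3 - 3 * (2 / 3 + w) + 2" "N \<noteq> 0"
  shows "gmap (Fin (2 / 3 + w)) = param Infty (3 / 2 * w / N)"
proof (cases "w = 0")
  case False
  have "3 / 2 * (2 / 3 + w) - 1 = 3 / 2 * w"
    by (simp add: algebra_simps)
  then have "G (2 / 3 + w) = N / (3 / 2 * w)"
    by (simp only: G_def assms(1)[symmetric])
  then show ?thesis
    using False assms(2) by (simp add: gmap_Fin)
qed (simp add: gmap_Fin)

lemma G_holomorphic: "2 / 3 \<notin> S \<Longrightarrow> G holomorphic_on S"
  unfolding G_def by (intro holomorphic_intros) (simp only: denom_eq_0_iff, blast)

lemma isCont_G: "z \<noteq> 2 / 3 \<Longrightarrow> isCont G z"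
  by (rule continuous_on_interior[of "- {2 / 3}"])
    (auto simp: interior_open open_Compl intro!: holomorphic_on_imp_continuous_on G_holomorphic)

lemma continuous_on_G: "2 / 3 \<notin> S \<Longrightarrow> continuous_on S G"
  by (simp add: G_holomorphic holomorphic_on_imp_continuous_on)

lemma isCont_sphereI:
  assumes "(h \<longlongrightarrow> f x) (nhds 0)" "\<forall>\<^sub>F w in nhds 0. h w = f (param x w)"
  shows "isCont f x"
  unfolding isCont_sphere_iff using assms(1) tendsto_cong[OF assms(2)] by blast

lemma continuous_on_gmap: "continuous_on S gmap"
proof -
  have "isCont gmap x" for x
  proof (cases x)
    case (Fin a)
    show ?thesis
    proof (cases "a = 2 / 3")
      case False
      have "((\<lambda>w. Fin (G (a + w))) \<longlongrightarrow> Fin (G a)) (nhds 0)"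
      proof -
        have "isCont (\<lambda>w. G (a + w)) 0"
          using isCont_G[OF False] by (intro isCont_o2[of 0 "\<lambda>w. a + w" G]) auto
        then have "((\<lambda>w. G (a + w)) \<longlongrightarrow> G a) (nhds 0)"
          using tendsto_at_iff_tendsto_nhds[of "\<lambda>w. G (a + w)" 0] by (simp add: continuous_at)
        then show ?thesis
          by (rule filterlim_compose[of Fin, rotated]) (simp add: filterlim_def nhds_Fin)
      qed
      moreover have "\<forall>\<^sub>F w in nhds 0. Fin (G (a + w)) = gmap (param x w)"
      proof -
        have "((\<lambda>w. a + w) \<longlongrightarrow> a + 0) (nhds 0)"
          by (intro tendsto_intros filterlim_ident)
        then have "\<forall>\<^sub>F w in nhds 0. a + w \<noteq> 2 / 3"
          using False by (intro tendsto_imp_eventually_ne) auto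
        then show ?thesis
          by (rule eventually_mono) (simp add: Fin gmap_Fin)
      qed
      ultimately show ?thesis
        using False by (intro isCont_sphereI) (simp_all add: Fin gmap_Fin)
    next
      case True
      define Q where "Q = (\<lambda>w::complex. (2 / 3 + w) ^ 3 - 3 * (2 / 3 + w) + 2)"
      have Q: "(Q \<longlongrightarrow> 8 / 27) (nhds 0)"
      proof -
        have "(Q \<longlongrightarrow> (2 / 3 + 0) ^ 3 - 3 * (2 / 3 + 0) + 2) (nhds 0)"
          unfolding Q_def by (intro tendsto_intros filterlim_ident)
        then show ?thesis
          by (simp add: power3_eq_cube)
      qed
      then have "((\<lambda>w. 3 / 2 * w / Q w) \<longlongrightarrow> 3 / 2 * 0 / (8 / 27)) (nhds 0)"
        by (intro tendsto_intros filterlim_ident) auto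
      then have "((\<lambda>w. param Infty (3 / 2 * w / Q w)) \<longlongrightarrow> Infty) (nhds 0)"
        by (intro tendsto_param) simp
      moreover have "\<forall>\<^sub>F w in nhds 0. param Infty (3 / 2 * w / Q w) = gmap (param x w)"
      proof -
        have "\<forall>\<^sub>F w in nhds 0. Q w \<noteq> 0"
          using Q by (intro tendsto_imp_eventually_ne) auto
        then show ?thesis
          by (rule eventually_mono)
            (simp only: Fin True param.simps(1), rule gmap_near_pole[symmetric, OF Q_def[THEN fun_cong]])
      qed
      moreover have "gmap x = Infty"
        by (simp add: Fin True gmap_Fin)
      ultimately show ?thesis
        by (intro isCont_sphereI[of "\<lambda>w. param Infty (3 / 2 * w / Q w)"]) (simp_all only:)
    qed
  next
    case Infty
    have D: "((\<lambda>w::complex. 1 - 3 * w\<^sup>2 + 2 * w ^ 3) \<longlongrightarrow> 1 - 3 * 0\<^sup>2 + 2 * 0 ^ 3) (nhds 0)"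
      by (intro tendsto_intros filterlim_ident)
    then have "(Ghat \<longlongrightarrow> 0\<^sup>2 * (3 / 2 - 0) / (1 - 3 * 0\<^sup>2 + 2 * 0 ^ 3)) (nhds 0)"
      unfolding Ghat_def by (intro tendsto_intros filterlim_ident) auto
    then have "((\<lambda>w. param Infty (Ghat w)) \<longlongrightarrow> Infty) (nhds 0)"
      by (intro tendsto_param) simp
    moreover have "\<forall>\<^sub>F w in nhds 0. param Infty (Ghat w) = gmap (param x w)"
    proof -
      have "\<forall>\<^sub>F w in nhds 0. 1 - 3 * w\<^sup>2 + 2 * w ^ 3 \<noteq> (0::complex)"
        using D by (intro tendsto_imp_eventually_ne) auto
      then show ?thesis
        by (rule eventually_mono) (simp add: Infty gmap_param_Infty del: param.simps(2))
    qed
    moreover have "gmap x = Infty"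
      by (simp add: Infty gmap_Infty)
    ultimately show ?thesis
      by (intro isCont_sphereI[of "\<lambda>w. param Infty (Ghat w)"]) (simp_all only:)
  qed
  then show ?thesis
    by (simp add: continuous_at_imp_continuous_on)
qed

section \<open>The basin of infinity and the two-cycle\<close>

text \<open>The radius 6 is large enough for the crude estimate in \<open>G_expands\<close> to yield
  expansion by 3/2.\<close>

definition escape_region :: "rsphere set" where
  "escape_region = insert Infty (Fin ` {z. 6 < cmod z})"

definition basin :: "rsphere set" where
  "basin = {x. \<exists>n. (gmap ^^ n) x \<in> escape_region}"

lemma cmod_pole: "cmod (2 / 3) = 2 / 3"
  by (simp add: norm_divide)

lemma large_ne_pole: "6 < cmod z \<Longrightarrow> z \<noteq> 2 / 3"
  by (rule notI) (simp only: cmod_pole)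

lemma G_expands:
  assumes "6 < cmod z"
  shows "3 / 2 * cmod z \<le> cmod (G z)"
proof -
  define r where "r = cmod z"
  have r: "6 < r" using assms by (simp add: r_def)
  have num: "z ^ 3 - 3 * z + 2 = (z + 2) * (z - 1)\<^sup>2"
    by (simp add: algebra_simps power2_eq_square power3_eq_cube)
  have "r - 2 \<le> cmod (z + 2)"
    using norm_diff_ineq[of z 2] by (simp add: r_def)
  moreover have "r - 1 \<le> cmod (z - 1)"
    using norm_triangle_ineq2[of z 1] by (simp add: r_def)
  ultimately have n: "(r - 2) * (r - 1)\<^sup>2 \<le> cmod (z ^ 3 - 3 * z + 2)"
    unfolding num norm_mult norm_power using r by (intro mult_mono power_mono) auto
  have d: "cmod (3 / 2 * z - 1) \<le> 3 / 2 * r + 1"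
    using norm_triangle_ineq4[of "3 / 2 * z" 1] by (simp add: r_def norm_mult)
  have "z \<noteq> 2 / 3"
    using assms by (rule large_ne_pole)
  then have d0: "cmod (3 / 2 * z - 1) > 0"
    using denom_eq_0_iff[of z] by simp
  \<comment> \<open>Division of the cubic by \<open>r - 6\<close>: the remainder 10 and the quotient
    are positive beyond 6.\<close>
  have "(r - 2) * (r - 1)\<^sup>2 - 3 / 2 * r * (3 / 2 * r + 1) = (r - 6) * (r * (r - 1 / 4) + 2) + 10"
    by (simp add: field_simps power2_eq_square)
  moreover have "0 \<le> (r - 6) * (r * (r - 1 / 4) + 2)"
    using r by (intro mult_nonneg_nonneg add_nonneg_nonneg) auto
  ultimately have "3 / 2 * r * (3 / 2 * r + 1) \<le> (r - 2) * (r - 1)\<^sup>2"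
    by linarith
  then have "3 / 2 * r * cmod (3 / 2 * z - 1) \<le> cmod (z ^ 3 - 3 * z + 2)"
    using n mult_left_mono[OF d, of "3 / 2 * r"] r by linarith
  then show ?thesis
    unfolding G_def norm_divide r_def[symmetric] using d0 by (simp only: pos_le_divide_eq)
qed

lemma funpow_escape_region:
  assumes "x \<in> escape_region"
  shows "(gmap ^^ n) x \<in> insert Infty (Fin ` {z. 6 * (3 / 2) ^ n < cmod z})"
proof (induction n)
  case 0
  then show ?case using assms by (simp add: escape_region_def)
next
  case (Suc n)
  show ?case
  proof (cases "(gmap ^^ n) x")
    case (Fin z)
    then have z: "6 * (3 / 2) ^ n < cmod z"
      using Suc by auto
    moreover have "6 * 1 \<le> 6 * (3 / 2 :: real) ^ n"
      by (intro mult_left_mono one_le_power) auto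
    ultimately have z6: "6 < cmod z" by linarith
    then have "6 * (3 / 2) ^ Suc n < cmod (G z)"
      using G_expands[OF z6] z by simp
    then show ?thesis
      using large_ne_pole[OF z6] by (simp add: Fin gmap_Fin)
  qed (simp add: gmap_Infty)
qed

lemma gmap_escape_region: "x \<in> escape_region \<Longrightarrow> gmap x \<in> escape_region"
  using funpow_escape_region[of x 1] by (auto simp: escape_region_def)

lemma uniform_limit_escape_region: "uniform_limit escape_region (\<lambda>n. gmap ^^ n) (\<lambda>_. Infty) sequentially"
  unfolding uniform_limit_iff
proof (intro allI impI)
  fix e :: real assume "e > 0"
  then obtain r where r: "r > 0" "\<And>z. cmod z > r \<Longrightarrow> dist (Fin z) Infty < e"
    using dist_Infty_less by blast
  obtain N where N: "r < (3 / 2) ^ N"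
    using real_arch_pow[of "3 / 2" r] by auto
  have "r < 6 * (3 / 2) ^ n" if "n \<ge> N" for n
  proof -
    have "(3 / 2 :: real) ^ N \<le> (3 / 2) ^ n"
      by (rule power_increasing[OF that]) simp
    then show ?thesis
      using N r(1) by linarith
  qed
  then have "\<forall>\<^sub>F n in sequentially. r < 6 * (3 / 2 :: real) ^ n"
    unfolding eventually_sequentially by blast
  then show "\<forall>\<^sub>F n in sequentially. \<forall>x\<in>escape_region. dist ((gmap ^^ n) x) Infty < e"
  proof (rule eventually_mono, intro ballI)
    fix n x assume n: "r < 6 * (3 / 2 :: real) ^ n" and "x \<in> escape_region"
    from funpow_escape_region[OF this(2), of n] show "dist ((gmap ^^ n) x) Infty < e"
    proof
      assume "(gmap ^^ n) x \<in> Fin ` {z. 6 * (3 / 2) ^ n < cmod z}"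
      then show ?thesis
        using n by (auto intro!: r(2))
    qed (use \<open>e > 0\<close> in simp)
  qed
qed

lemma continuous_on_funpow_gmap: "continuous_on S (gmap ^^ n)"
  by (induction n) (auto simp: o_def intro: continuous_on_compose2[OF continuous_on_gmap[of UNIV]])

lemma open_preimage_escape_region: "open ((gmap ^^ n) -` escape_region)"
  unfolding escape_region_def
  by (intro open_vimage open_insert_Infty continuous_on_funpow_gmap)

lemma basin_eq: "basin = (\<Union>n. (gmap ^^ n) -` escape_region)"
  by (auto simp: basin_def)

lemma open_basin: "open basin"
  unfolding basin_eq by (intro open_UN ballI open_preimage_escape_region)

lemma uniform_limit_preimage_escape_region:
  "uniform_limit ((gmap ^^ m) -` escape_region) (\<lambda>n. gmap ^^ n) (\<lambda>_. Infty) sequentially"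
  unfolding uniform_limit_iff
proof (intro allI impI)
  fix e :: real assume "e > 0"
  then have "\<forall>\<^sub>F n in sequentially. \<forall>x\<in>escape_region. dist ((gmap ^^ n) x) Infty < e"
    using uniform_limit_escape_region unfolding uniform_limit_iff by blast
  then obtain N where N: "\<And>n x. n \<ge> N \<Longrightarrow> x \<in> escape_region \<Longrightarrow> dist ((gmap ^^ n) x) Infty < e"
    by (auto simp: eventually_sequentially)
  have "dist ((gmap ^^ n) x) Infty < e"
    if "n \<ge> N + m" "x \<in> (gmap ^^ m) -` escape_region" for n x
  proof -
    have "(gmap ^^ n) x = (gmap ^^ (n - m)) ((gmap ^^ m) x)"
      using that(1) by (simp flip: funpow_add[unfolded fun_eq_iff o_def, rule_format])
    then show ?thesis
      using N[of "n - m" "(gmap ^^ m) x"] that by simp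
  qed
  then show "\<forall>\<^sub>F n in sequentially. \<forall>x\<in>(gmap ^^ m) -` escape_region. dist ((gmap ^^ n) x) Infty < e"
    unfolding eventually_sequentially by blast
qed

lemma basin_subset_fatou: "basin \<subseteq> fatou_set gmap"
proof
  fix x assume "x \<in> basin"
  then obtain m where "x \<in> (gmap ^^ m) -` escape_region"
    by (auto simp: basin_eq)
  then show "x \<in> fatou_set gmap"
    unfolding fatou_set_def
    using open_preimage_escape_region normal_family_on_iterates_const[OF uniform_limit_preimage_escape_region]
    by blast
qed

lemma escape_region_subset_basin: "escape_region \<subseteq> basin"
proof
  fix x assume "x \<in> escape_region"
  then have "(gmap ^^ 0) x \<in> escape_region" by simp
  then show "x \<in> basin"
    unfolding basin_def by (intro CollectI exI)
qed

lemma Infty_in_basin: "Infty \<in> basin"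
  using escape_region_subset_basin by (auto simp: escape_region_def)

lemma frontier_basin_subset_julia: "Fin z \<in> frontier basin \<Longrightarrow> Fin z \<in> julia_set gmap"
proof (rule frontier_escaping_set_subset_julia[OF continuous_on_gmap _ _ basin_def open_basin, of Infty])
  show "open escape_region" "Infty \<in> escape_region"
    by (simp_all add: escape_region_def open_insert_Infty)
  fix x assume "x \<in> basin"
  then obtain m where "x \<in> (gmap ^^ m) -` escape_region"
    by (auto simp: basin_eq)
  from tendsto_uniform_limitI[OF uniform_limit_preimage_escape_region this]
  show "(\<lambda>n. (gmap ^^ n) x) \<longlonglongrightarrow> Infty" .
qed

text \<open>The second iterate contracts the disc about \<open>a\<close> with rate \<open>q\<close>,
  so even iterates converge uniformly to \<open>a\<close>; one more step, controlled by
  \<open>L\<close>, sends the odd ones to \<open>b\<close>.\<close>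

lemma two_cycle_in_fatou:
  assumes q: "0 \<le> q" "q < 1" and r: "r > 0"
    and G: "\<And>z. cmod (z - a) \<le> r \<Longrightarrow> z \<noteq> 2 / 3 \<and> G z \<noteq> 2 / 3 \<and>
      cmod (G z - b) \<le> L * cmod (z - a) \<and> cmod (G (G z) - a) \<le> q * cmod (z - a)"
  shows "Fin a \<in> fatou_set gmap"
proof -
  define U where "U = Fin ` ball a r"
  have it: "\<exists>w. (gmap ^^ (2 * k)) (Fin z) = Fin w \<and> cmod (w - a) \<le> r * q ^ k" if "z \<in> ball a r" for z k
  proof (induction k)
    case 0
    then show ?case using that by (simp add: dist_norm norm_minus_commute)
  next
    case (Suc k)
    then obtain w where w: "(gmap ^^ (2 * k)) (Fin z) = Fin w" "cmod (w - a) \<le> r * q ^ k"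
      by blast
    have "r * q ^ k \<le> r * 1"
      using q r by (intro mult_left_mono power_le_one) auto
    then have "cmod (w - a) \<le> r"
      using w(2) by linarith
    note Gw = G[OF this]
    have "(gmap ^^ (2 * Suc k)) (Fin z) = Fin (G (G w))"
      using Gw by (simp add: w(1) gmap_Fin)
    moreover have "cmod (G (G w) - a) \<le> r * q ^ Suc k"
      using Gw mult_left_mono[OF w(2) q(1)] by (simp add: algebra_simps)
    ultimately show ?case by blast
  qed
  have q0: "(\<lambda>k. r * q ^ k) \<longlonglongrightarrow> 0" "(\<lambda>k. L * (r * q ^ k)) \<longlonglongrightarrow> 0"
    using q by (auto intro!: tendsto_mult_right_zero LIMSEQ_realpow_zero)
  have "uniform_limit U (\<lambda>k. gmap ^^ (2 * k)) (\<lambda>_. Fin a) sequentially"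
    unfolding uniform_limit_iff
  proof (intro allI impI)
    fix e :: real assume "e > 0"
    then obtain d where d: "d > 0" "\<And>z. dist z a < d \<Longrightarrow> dist (Fin z) (Fin a) < e"
      using dist_Fin_less by blast
    have "\<forall>\<^sub>F k in sequentially. r * q ^ k < d"
      using order_tendstoD(2)[OF q0(1) d(1)] .
    then show "\<forall>\<^sub>F k in sequentially. \<forall>x\<in>U. dist ((gmap ^^ (2 * k)) x) (Fin a) < e"
    proof (rule eventually_mono, intro ballI)
      fix k x assume k: "r * q ^ k < d" and "x \<in> U"
      then obtain z where z: "x = Fin z" "z \<in> ball a r"
        by (auto simp: U_def)
      obtain w where w: "(gmap ^^ (2 * k)) (Fin z) = Fin w" "cmod (w - a) \<le> r * q ^ k"
        using it[OF z(2)] by blast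
      then show "dist ((gmap ^^ (2 * k)) x) (Fin a) < e"
        using d(2)[of w] k z(1) by (simp add: dist_norm)
    qed
  qed
  moreover have "uniform_limit U (\<lambda>k. gmap ^^ (2 * k + 1)) (\<lambda>_. Fin b) sequentially"
    unfolding uniform_limit_iff
  proof (intro allI impI)
    fix e :: real assume "e > 0"
    then obtain d where d: "d > 0" "\<And>z. dist z b < d \<Longrightarrow> dist (Fin z) (Fin b) < e"
      using dist_Fin_less by blast
    have "\<forall>\<^sub>F k in sequentially. \<bar>L\<bar> * (r * q ^ k) < d"
      using q d(1) by (intro order_tendstoD(2)[of _ 0] tendsto_mult_right_zero LIMSEQ_realpow_zero) auto
    then show "\<forall>\<^sub>F k in sequentially. \<forall>x\<in>U. dist ((gmap ^^ (2 * k + 1)) x) (Fin b) < e"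
    proof (rule eventually_mono, intro ballI)
      fix k x assume k: "\<bar>L\<bar> * (r * q ^ k) < d" and "x \<in> U"
      then obtain z where z: "x = Fin z" "z \<in> ball a r"
        by (auto simp: U_def)
      obtain w where w: "(gmap ^^ (2 * k)) (Fin z) = Fin w" "cmod (w - a) \<le> r * q ^ k"
        using it[OF z(2)] by blast
      have "r * q ^ k \<le> r * 1"
        using q r by (intro mult_left_mono power_le_one) auto
      then have "cmod (w - a) \<le> r"
        using w(2) by linarith
      note Gw = G[OF this]
      have "cmod (G w - b) \<le> L * cmod (w - a)"
        using Gw by blast
      also have "\<dots> \<le> \<bar>L\<bar> * (r * q ^ k)"
        using w(2) by (intro mult_mono) auto
      finally have "dist (Fin (G w)) (Fin b) < e"
        using k by (intro d(2)) (simp add: dist_norm)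
      then show "dist ((gmap ^^ (2 * k + 1)) x) (Fin b) < e"
        using Gw by (simp add: z(1) w(1) gmap_Fin)
    qed
  qed
  ultimately have "normal_family_on (range (\<lambda>n. gmap ^^ n)) U"
    by (rule normal_family_on_iterates)
  moreover have "open U" "Fin a \<in> U"
    using r by (auto simp: U_def open_image_Fin)
  ultimately show ?thesis
    by (auto simp: fatou_set_def)
qed

text \<open>Rests on G z + 2 = z^3 / (3/2 z - 1): the point 0 is a triple preimage of -2. On this
  disc the denominator has modulus at least 1/2.\<close>

lemma G_near_0:
  assumes "cmod z \<le> 1 / 3"
  shows "z \<noteq> 2 / 3" "cmod (G z + 2) \<le> 2 * cmod z ^ 3"
proof -
  show z: "z \<noteq> 2 / 3"
    using assms by (intro notI) (simp only: cmod_pole)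
  then have "3 / 2 * z - 1 \<noteq> 0"
    using denom_eq_0_iff by blast
  then have "G z + 2 = z ^ 3 / (3 / 2 * z - 1)"
    unfolding G_def by (simp add: field_simps)
  moreover have "1 / 2 \<le> cmod (3 / 2 * z - 1)"
    using norm_triangle_ineq2[of 1 "3 / 2 * z"] assms by (simp add: norm_mult norm_minus_commute)
  ultimately have "cmod (G z + 2) \<le> cmod z ^ 3 / (1 / 2)"
    by (simp only: norm_divide norm_power) (intro frac_le; simp)
  then show "cmod (G z + 2) \<le> 2 * cmod z ^ 3"
    by simp
qed

text \<open>The radius 2/27 = 2 (1/3)^3 is what \<open>G_near_0\<close> gives for the image of the
  disc of radius 1/3. The factor 26/10 lies a little above 9/4, the modulus of the derivative of
  \<open>G\<close> at -2.\<close>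

lemma G_near_m2:
  assumes "cmod (z + 2) \<le> 2 / 27"
  shows "z \<noteq> 2 / 3" "cmod (G z) \<le> 26 / 10 * cmod (z + 2)"
proof -
  define u where "u = z + 2"
  have z: "z = u - 2" and u: "cmod u \<le> 2 / 27"
    using assms by (simp_all add: u_def)
  have d: "3 \<le> cmod (3 / 2 * z - 1) \<and> 38 / 10 \<le> cmod (3 / 2 * z - 1)"
  proof -
    have "3 / 2 * z - 1 = - (4 - 3 / 2 * u)"
      by (simp add: z field_simps)
    then have "cmod (3 / 2 * z - 1) = cmod (4 - 3 / 2 * u)"
      by (metis norm_minus_cancel)
    moreover have "4 - 3 / 2 * cmod u \<le> cmod (4 - 3 / 2 * u)"
      using norm_triangle_ineq2[of 4 "3 / 2 * u"] by (simp add: norm_mult)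
    ultimately show ?thesis using u by linarith
  qed
  then show "z \<noteq> 2 / 3"
    by (intro notI) (simp only: denom_eq_0_iff[THEN iffD2], simp)
  have num: "z ^ 3 - 3 * z + 2 = u * (u - 3)\<^sup>2"
    by (simp add: z algebra_simps power2_eq_square power3_eq_cube)
  have "cmod (u - 3) \<le> 31 / 10"
    using norm_triangle_ineq4[of u 3] u by simp
  then have "cmod (z ^ 3 - 3 * z + 2) \<le> cmod u * (31 / 10)\<^sup>2"
    unfolding num norm_mult norm_power by (intro mult_left_mono power_mono) auto
  then have "cmod (G z) \<le> cmod u * (31 / 10)\<^sup>2 / (38 / 10)"
    unfolding G_def norm_divide using d by (intro frac_le) auto
  also have "\<dots> \<le> 26 / 10 * cmod u"
    by (simp add: power2_eq_square)
  finally show "cmod (G z) \<le> 26 / 10 * cmod (z + 2)"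
    by (simp add: u_def)
qed

lemma cube_le:
  fixes x :: real
  assumes "0 \<le> x" "x \<le> c"
  shows "x ^ 3 \<le> c\<^sup>2 * x"
  using mult_right_mono[OF power_mono[OF assms(2,1), of 2] assms(1)]
  by (simp add: power3_eq_cube power2_eq_square)

lemma zero_in_fatou: "Fin 0 \<in> fatou_set gmap"
proof (rule two_cycle_in_fatou[of "6 / 10" "1 / 3" 0 "-2" 1])
  fix z :: complex assume "cmod (z - 0) \<le> 1 / 3"
  then have z: "cmod z \<le> 1 / 3" by simp
  note G_near_0[OF z]
  moreover have "cmod z ^ 3 \<le> cmod z / 9"
    using cube_le[OF norm_ge_zero z] by (simp add: power2_eq_square)
  \<comment> \<open>Followed by the factor 26/10 near -2, this gives 26/10 * 2/9 < 6/10, the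
    contraction rate claimed for two steps.\<close>
  ultimately have Gz: "cmod (G z + 2) \<le> 2 / 9 * cmod z"
    by linarith
  then have "cmod (G z + 2) \<le> 2 / 27"
    using z by linarith
  from G_near_m2[OF this]
  show "z \<noteq> 2 / 3 \<and> G z \<noteq> 2 / 3 \<and> cmod (G z - - 2) \<le> 1 * cmod (z - 0) \<and>
      cmod (G (G z) - 0) \<le> 6 / 10 * cmod (z - 0)"
    using G_near_0(1)[OF z] Gz norm_ge_zero[of z] by (auto simp only: diff_0_right diff_minus_eq_add)
qed auto

lemma minus_2_in_fatou: "Fin (-2) \<in> fatou_set gmap"
proof (rule two_cycle_in_fatou[of "1 / 2" "2 / 27" "-2" 0 "26 / 10"])
  fix z :: complex assume "cmod (z - - 2) \<le> 2 / 27"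
  then have z: "cmod (z + 2) \<le> 2 / 27" by simp
  note G_near_m2[OF z]
  then have "cmod (G z) \<le> 1 / 3"
    using z by linarith
  note G_near_0[OF this]
  moreover have "cmod (G z) ^ 3 \<le> (2 / 10)\<^sup>2 * cmod (G z)"
    using G_near_m2[OF z] z by (intro cube_le) auto
  ultimately show "z \<noteq> 2 / 3 \<and> G z \<noteq> 2 / 3 \<and> cmod (G z - 0) \<le> 26 / 10 * cmod (z - - 2) \<and>
      cmod (G (G z) - - 2) \<le> 1 / 2 * cmod (z - - 2)"
    using G_near_m2[OF z] norm_ge_zero[of "z + 2"]
    by (auto simp only: diff_0_right diff_minus_eq_add power2_eq_square)
qed auto

section \<open>The complement of the basin in the plane\<close>

definition filled :: "complex set" where
  "filled = {z. Fin z \<notin> basin}"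

lemma basin_iff: "x \<in> basin \<longleftrightarrow> gmap x \<in> basin"
proof
  assume "x \<in> basin"
  then obtain n where "(gmap ^^ n) x \<in> escape_region"
    by (auto simp: basin_def)
  then have "(gmap ^^ n) (gmap x) \<in> escape_region"
    by (simp add: funpow_swap1[symmetric] gmap_escape_region)
  then show "gmap x \<in> basin"
    by (auto simp: basin_def)
next
  assume "gmap x \<in> basin"
  then obtain n where "(gmap ^^ n) (gmap x) \<in> escape_region"
    by (auto simp: basin_def)
  then have "(gmap ^^ Suc n) x \<in> escape_region"
    by (simp add: funpow_swap1)
  then show "x \<in> basin"
    unfolding basin_def by (intro CollectI exI)
qed

lemma filled_iff: "z \<in> filled \<longleftrightarrow> z \<noteq> 2 / 3 \<and> G z \<in> filled"
  unfolding filled_def mem_Collect_eq by (subst basin_iff) (simp add: gmap_Fin Infty_in_basin)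

lemma filled_bounded: "z \<in> filled \<Longrightarrow> cmod z \<le> 6"
  using escape_region_subset_basin by (force simp: filled_def escape_region_def)

lemma closed_filled: "closed filled"
proof -
  have "filled = - (Fin -` basin)"
    by (auto simp: filled_def)
  then show ?thesis
    using open_vimage_Fin[OF open_basin] by (metis closed_Compl)
qed

text \<open>The source of every explicit point or set in \<open>filled\<close>: an orbit trapped in
  \<open>X\<close> can neither hit the pole nor pass the radius 6.\<close>

lemma invariant_subset_filled:
  assumes "\<And>z. z \<in> X \<Longrightarrow> cmod z \<le> 6 \<and> z \<noteq> 2 / 3 \<and> G z \<in> X"
  shows "X \<subseteq> filled"
proof
  fix z assume z: "z \<in> X"
  have "(gmap ^^ n) (Fin z) \<in> Fin ` X" for n
    by (induction n) (use z assms in \<open>auto simp: gmap_Fin\<close>)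
  moreover have "Fin ` X \<inter> escape_region = {}"
    using assms by (force simp: escape_region_def)
  ultimately show "z \<in> filled"
    unfolding filled_def basin_def by blast
qed

lemma open_image_G:
  assumes "open U" "2 / 3 \<notin> U"
  shows "open (G ` U)"
proof (rule open_mapping_thm[of G "- {2 / 3}"])
  show "connected (- {2 / 3 :: complex})"
    by (rule connected_punctured_universe) simp
  show "\<not> G constant_on - {2 / 3}"
  proof
    assume "G constant_on - {2 / 3}"
    then obtain c where "\<And>z. z \<noteq> 2 / 3 \<Longrightarrow> G z = c"
      by (auto simp: constant_on_def)
    from this[of 0] this[of 1] show False
      by (simp add: G_def)
  qed
qed (use assms in \<open>auto intro: G_holomorphic open_Compl\<close>)

section \<open>Connectedness of the non-escaping set\<close>

lemma G_eq_minus_2: "z \<noteq> 2 / 3 \<Longrightarrow> G z = - 2 \<longleftrightarrow> z = 0"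
  by (subst G_eq_iff) (auto simp: algebra_simps)

text \<open>Points not yet escaped after \<open>n\<close> steps: a decreasing sequence of compact
  sets, so connectedness passes to the intersection \<open>filled\<close>.\<close>

definition filled_approx :: "nat \<Rightarrow> complex set" where
  "filled_approx n = {z. (gmap ^^ n) (Fin z) \<notin> escape_region}"

lemma closed_filled_approx: "closed (filled_approx n)"
proof -
  have "filled_approx n = - (Fin -` ((gmap ^^ n) -` escape_region))"
    by (auto simp: filled_approx_def)
  then show ?thesis
    using open_vimage_Fin[OF open_preimage_escape_region[of n]] by (metis closed_Compl)
qed

lemma filled_approx_mono: "m \<le> n \<Longrightarrow> filled_approx n \<subseteq> filled_approx m"
  by (rule lift_Suc_antimono_le[of filled_approx]) (auto simp: filled_approx_def intro: gmap_escape_region)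

lemma filled_approx_0: "filled_approx 0 = cball 0 6"
  by (auto simp: filled_approx_def escape_region_def)

lemma compact_filled_approx: "compact (filled_approx n)"
proof -
  have "bounded (filled_approx n)"
    using filled_approx_mono[of 0 n] bounded_subset[OF bounded_cball] by (simp add: filled_approx_0)
  then show ?thesis
    using closed_filled_approx by (simp add: compact_eq_bounded_closed)
qed

lemma filled_eq_Inter: "filled = \<Inter> (range filled_approx)"
  by (auto simp: filled_def basin_def filled_approx_def)

lemma filled_approx_Suc: "filled_approx (Suc n) = {z. z \<noteq> 2 / 3 \<and> G z \<in> filled_approx n}"
proof -
  have "(gmap ^^ Suc n) (Fin (2 / 3)) = Infty"
    by (induction n) (simp_all add: gmap_Fin gmap_Infty)
  then show ?thesis
    by (auto simp: filled_approx_def funpow_Suc_right gmap_Fin escape_region_def simp del: funpow.simps)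
qed

lemma critical_cycle_in_filled: "0 \<in> filled" "-2 \<in> filled" "1 \<in> filled"
proof -
  have "{0, -2, 1} \<subseteq> filled"
    by (rule invariant_subset_filled) (auto simp: G_def)
  then show "0 \<in> filled" "-2 \<in> filled" "1 \<in> filled"
    by auto
qed

text \<open>Every relatively clopen part of \<open>filled_approx (Suc n)\<close> is mapped onto \<open>filled_approx n\<close>,
  so it contains a preimage of \<open>-2\<close>; but \<open>0\<close> is the only one.\<close>

lemma connected_filled_approx: "connected (filled_approx n)"
proof (induction n)
  case 0
  then show ?case by (simp add: filled_approx_0)
next
  case (Suc n)
  define S where "S = filled_approx (Suc n)"
  have S: "S = {z. z \<noteq> 2 / 3 \<and> G z \<in> filled_approx n}"
    by (simp add: S_def filled_approx_Suc)
  have zero: "0 \<in> A"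
    if A: "closed A" and B: "closed B" and AB: "S \<subseteq> A \<union> B" "A \<inter> B \<inter> S = {}" "A \<inter> S \<noteq> {}" for A B
  proof -
    define T where "T = G ` (A \<inter> S)"
    have pole: "2 / 3 \<notin> S"
      by (simp add: S)
    have "compact (A \<inter> S)"
      using A compact_filled_approx[of "Suc n"] by (simp add: S_def closed_Int_compact)
    then have "compact T"
      unfolding T_def using pole by (intro compact_continuous_image continuous_on_G) auto
    then have "closed T"
      by (rule compact_imp_closed)
    have "open (G ` (- B - {2 / 3}))"
      using B by (intro open_image_G open_Diff open_Compl) auto
    \<comment> \<open>As \<open>A\<close> and \<open>B\<close> cover \<open>S\<close>, a point of
      \<open>S\<close> outside \<open>B\<close> lies in \<open>A\<close>. This exhibits the compact
      set \<open>T\<close> as relatively open, too.\<close>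
    moreover have "T = filled_approx n \<inter> G ` (- B - {2 / 3})"
    proof (intro equalityI subsetI)
      fix y assume "y \<in> T"
      then obtain z where "z \<in> A" "z \<in> S" "y = G z" by (auto simp: T_def)
      then show "y \<in> filled_approx n \<inter> G ` (- B - {2 / 3})"
        using AB(2) by (auto simp: S)
    next
      fix y assume "y \<in> filled_approx n \<inter> G ` (- B - {2 / 3})"
      then obtain z where "y = G z" "G z \<in> filled_approx n" "z \<notin> B" "z \<noteq> 2 / 3"
        by blast
      moreover from this have "z \<in> A \<inter> S" using AB(1) by (auto simp: S)
      ultimately show "y \<in> T" by (simp add: T_def)
    qed
    ultimately have "openin (top_of_set (filled_approx n)) T"
      by (simp add: openin_open_Int)
    moreover have "closedin (top_of_set (filled_approx n)) T"
      using \<open>closed T\<close> by (intro closed_subset) (auto simp: T_def S)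
    moreover have "T \<noteq> {}"
      using AB(3) by (auto simp: T_def)
    ultimately have "T = filled_approx n"
      using Suc.IH by (auto simp: connected_clopen)
    moreover have "-2 \<in> filled_approx n"
      using critical_cycle_in_filled(2) by (auto simp: filled_eq_Inter)
    ultimately have "-2 \<in> G ` (A \<inter> S)"
      unfolding T_def by blast
    then obtain z where z: "z \<in> A" "z \<in> S" "-2 = G z"
      by blast
    then have "z = 0"
      using G_eq_minus_2[of z] by (auto simp: S)
    then show "0 \<in> A"
      using z(1) by simp
  qed
  \<comment> \<open>Both sides of a separation of \<open>S\<close> would contain 0, which itself
    belongs to \<open>S\<close>.\<close>
  have "0 \<in> S"
    using critical_cycle_in_filled(1) by (auto simp: filled_eq_Inter S_def)
  then have "connected S"
    unfolding connected_closed using zero by (metis (no_types, lifting) Un_commute IntI Int_commute empty_iff)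
  then show ?case
    by (simp add: S_def)
qed

lemma connected_filled: "connected filled"
  unfolding filled_eq_Inter
  by (rule connected_nest[OF compact_filled_approx connected_filled_approx filled_approx_mono])

section \<open>The unbounded component\<close>

text \<open>The base point 7 serves as a representative of the points of modulus above 6, all of
  which lie in this component.\<close>

definition outer :: "complex set" where
  "outer = connected_component_set (- filled) 7"

lemma open_compl_filled: "open (- filled)"
  using closed_filled by (rule open_Compl)

lemma open_outer: "open outer"
  unfolding outer_def by (intro open_connected_component open_compl_filled)

lemma connected_outer: "connected outer"
  unfolding outer_def by (rule connected_connected_component)

lemma outer_subset: "outer \<subseteq> - filled"
  unfolding outer_def by (rule connected_component_subset)

lemma connected_subset_outer:
  assumes "connected X" "X \<subseteq> - filled" "z \<in> X" "z \<in> outer"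
  shows "X \<subseteq> outer"
proof -
  have "connected_component_set (- filled) z = outer"
    using assms(4) unfolding outer_def by (metis connected_component_eq)
  then show ?thesis
    using connected_component_maximal[OF assms(3,1,2)] by simp
qed

lemma large_subset_outer: "{z. 6 < cmod z} \<subseteq> outer"
proof -
  have "{z. 6 < cmod z} = - cball 0 6"
    by auto
  moreover have "connected (- cball 0 6 :: complex set)"
    by (rule connected_complement_bounded_convex) auto
  ultimately have "connected {z. 6 < cmod z}" by simp
  moreover have "{z. 6 < cmod z} \<subseteq> - filled"
    using filled_bounded by force
  ultimately show ?thesis
    unfolding outer_def by (intro connected_component_maximal) auto
qed

text \<open>The component of \<open>u\<close> is an open neighbourhood of \<open>u\<close>, so it
  meets the other component and coincides with it.\<close>

lemma closure_component_Int:
  fixes P :: "'a::real_normed_vector set"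
  assumes "open P" "u \<in> P" "u \<in> closure (connected_component_set P a)"
  shows "u \<in> connected_component_set P a"
proof -
  define D where "D = connected_component_set P u"
  have "open D" "u \<in> D"
    using assms by (auto simp: D_def open_connected_component)
  then have "D \<inter> connected_component_set P a \<noteq> {}"
    using assms(3) by (metis disjoint_iff open_Int_closure_eq_empty)
  then have "D = connected_component_set P a"
    unfolding D_def using connected_component_disjoint by (metis Int_commute connected_component_eq disjoint_iff)
  then show ?thesis
    using \<open>u \<in> D\<close> by simp
qed

lemma frontier_outer_subset: "frontier outer \<subseteq> filled"
proof
  fix z assume z: "z \<in> frontier outer"
  then have "z \<in> closure outer" "z \<notin> outer"
    using open_outer by (auto simp: frontier_def interior_open)
  then show "z \<in> filled"
    using closure_component_Int[OF open_compl_filled, of z 7] by (auto simp: outer_def)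
qed

text \<open>The complement of a component of the complement of a connected set is connected;
  \<open>connected_filled\<close> enters here, in view of simple connectedness.\<close>

lemma connected_compl_outer: "connected (- outer)"
proof -
  have "(7::complex) \<in> - filled"
    using filled_bounded[of 7] by auto
  then have "outer \<in> components (- filled)"
    unfolding outer_def components_def by blast
  then show ?thesis
    by (rule component_complement_connected[OF connected_filled])
qed

text \<open>The Fatou component cannot cross the frontier of the basin, which lies in the Julia set.
  Inside the basin, \<open>outer\<close> with infinity and the union of the remaining plane
  components are disjoint open sets, so a connected set containing infinity stays in the
  first.\<close>

lemma fatou_component_eq: "connected_component_set (- julia_set gmap) Infty = insert Infty (Fin ` outer)"
proof
  let ?\<Omega> = "connected_component_set (- julia_set gmap) Infty"
  have conn: "connected ?\<Omega>" and sub: "?\<Omega> \<subseteq> - julia_set gmap"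
    by (rule connected_connected_component, rule connected_component_subset)
  have Inf: "Infty \<in> ?\<Omega>"
    using basin_subset_fatou Infty_in_basin by (auto simp: julia_set_def)
  have "?\<Omega> \<subseteq> basin"
  proof (rule ccontr)
    assume "\<not> ?\<Omega> \<subseteq> basin"
    then have "?\<Omega> \<inter> frontier basin \<noteq> {}"
      using Inf Infty_in_basin by (intro connected_Int_frontier[OF conn]) blast+
    then obtain x where x: "x \<in> ?\<Omega>" "x \<in> frontier basin" by blast
    then have "x \<noteq> Infty"
      using Infty_in_basin open_basin by (auto simp: frontier_def interior_open)
    then obtain z where "x = Fin z"
      by (cases x) auto
    then show False
      using x sub frontier_basin_subset_julia by blast
  qed
  have op: "open (insert Infty (Fin ` outer))"
    using open_outer large_subset_outer by (rule frontier_insert_Infty)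
  have "Fin ` (- filled - outer) \<inter> insert Infty (Fin ` outer) = {}"
    by auto
  moreover have "open (Fin ` (- filled - outer))"
  proof (rule open_image_Fin, subst open_subopen, intro ballI)
    fix z assume z: "z \<in> - filled - outer"
    let ?D = "connected_component_set (- filled) z"
    have "open ?D" "z \<in> ?D" "?D \<subseteq> - filled"
      using z by (auto intro: open_connected_component open_compl_filled dest: connected_component_in)
    moreover have "?D \<inter> outer = {}"
      using connected_subset_outer[OF connected_connected_component connected_component_subset] z
        \<open>z \<in> ?D\<close> by blast
    ultimately show "\<exists>T. open T \<and> z \<in> T \<and> T \<subseteq> - filled - outer"
      by blast
  qed
  moreover have "?\<Omega> \<subseteq> insert Infty (Fin ` outer) \<union> Fin ` (- filled - outer)"
  proof
    fix x assume "x \<in> ?\<Omega>"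
    then have "x \<in> basin" using \<open>?\<Omega> \<subseteq> basin\<close> by blast
    then show "x \<in> insert Infty (Fin ` outer) \<union> Fin ` (- filled - outer)"
      by (cases x) (auto simp: filled_def)
  qed
  ultimately have "Fin ` (- filled - outer) \<inter> ?\<Omega> = {}"
    using connectedD[OF conn op] Inf by blast
  then show "?\<Omega> \<subseteq> insert Infty (Fin ` outer)"
    using \<open>?\<Omega> \<subseteq> insert Infty (Fin ` outer) \<union> Fin ` (- filled - outer)\<close> by blast
  have "Fin ` outer \<subseteq> basin"
    using outer_subset by (auto simp: filled_def)
  then show "insert Infty (Fin ` outer) \<subseteq> ?\<Omega>"
    using basin_subset_fatou Infty_in_basin connected_insert_Infty[OF connected_outer large_subset_outer]
    by (intro connected_component_maximal) (auto simp: julia_set_def)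
qed

section \<open>A loop separating the outer component from the pole\<close>

text \<open>The curve \<open>y\<^sup>2 (3 x + 1) = 3 x\<^sup>2 (1 - x)\<close> (a Maclaurin trisectrix) is the non-real part of
  \<open>G -` \<real>\<close>; its loop over \<open>0 \<le> x \<le> 1\<close> is mapped into the interval \<open>[-2, 0]\<close>, which does
  not escape.\<close>

definition trisectrix :: "complex \<Rightarrow> real" where
  "trisectrix z = (Im z)\<^sup>2 * (3 * Re z + 1) - 3 * (Re z)\<^sup>2 * (1 - Re z)"

definition loop_inside :: "complex set" where
  "loop_inside = {z. 0 < Re z \<and> Re z < 1 \<and> trisectrix z < 0}"

lemma continuous_on_trisectrix: "continuous_on S trisectrix"
  unfolding trisectrix_def by (intro continuous_intros)

text \<open>For nonreal z = x + iy, comparing imaginary parts in z^3 - 3z + 2 = t (3/2 z - 1) forces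
  t = 2/3 (3x^2 - y^2 - 3). Eliminating y^2 by the curve equation gives the stated value; the proof
  multiplies through by \<open>D\<close> to do this without division.\<close>

lemma G_on_loop:
  assumes "0 \<le> Re z" "Re z \<le> 1" "trisectrix z = 0"
  shows "z \<noteq> 2 / 3" "G z = of_real (- 2 + 8 * Re z ^ 3 / (3 * Re z + 1))"
proof -
  show z: "z \<noteq> 2 / 3"
  proof
    assume "z = 2 / 3"
    moreover have "Re (2 / 3) = 2 / 3" "Im (2 / 3) = 0" by simp_all
    ultimately have "Re z = 2 / 3" "Im z = 0" by blast+
    with assms(3) show False by (simp add: trisectrix_def)
  qed
  define x y where "x = Re z" and "y = Im z"
  define D where "D = 3 * x + 1"
  define t where "t = - 2 + 8 * x ^ 3 / D"
  have D: "D > 0" using assms(1) by (simp add: D_def x_def)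
  have tD: "t * D = - 2 * D + 8 * x ^ 3"
    using D by (simp add: t_def field_simps)
  have yD: "y\<^sup>2 * D = 3 * x\<^sup>2 * (1 - x)"
    using assms(3) by (simp add: trisectrix_def x_def y_def D_def)
  have "D * (x ^ 3 - 3 * x * y\<^sup>2 - 3 * x + 2) = x ^ 3 * D - 3 * x * (y\<^sup>2 * D) - 3 * x * D + 2 * D"
    by (simp add: algebra_simps)
  also have "\<dots> = (t * D) * (3 / 2 * x - 1)"
    unfolding yD tD by (simp add: D_def algebra_simps power2_eq_square power3_eq_cube)
  finally have "D * (x ^ 3 - 3 * x * y\<^sup>2 - 3 * x + 2) = D * (t * (3 / 2 * x - 1))"
    by (simp only: mult_ac)
  then have re: "x ^ 3 - 3 * x * y\<^sup>2 - 3 * x + 2 = t * (3 / 2 * x - 1)"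
    using D by simp
  have "D * (3 * x\<^sup>2 - y\<^sup>2 - 3) = 3 * x\<^sup>2 * D - y\<^sup>2 * D - 3 * D"
    by (simp add: algebra_simps)
  also have "\<dots> = 3 / 2 * (t * D)"
    unfolding yD tD by (simp add: D_def algebra_simps power2_eq_square power3_eq_cube)
  finally have "D * (3 * x\<^sup>2 - y\<^sup>2 - 3) = D * (3 / 2 * t)"
    by (simp only: mult_ac)
  then have im: "3 * x\<^sup>2 - y\<^sup>2 - 3 = 3 / 2 * t"
    using D by simp
  have "z ^ 3 - 3 * z + 2 = of_real t * (3 / 2 * z - 1)"
  proof (rule complex_eqI)
    have "Re (z ^ 3 - 3 * z + 2) = x ^ 3 - 3 * x * y\<^sup>2 - 3 * x + 2"
      unfolding x_def y_def by (simp add: power3_eq_cube power2_eq_square algebra_simps)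
    moreover have "Re (of_real t * (3 / 2 * z - 1)) = t * (3 / 2 * x - 1)"
      by (simp add: x_def)
    ultimately show "Re (z ^ 3 - 3 * z + 2) = Re (of_real t * (3 / 2 * z - 1))"
      by (simp only: re)
    have "Im (z ^ 3 - 3 * z + 2) = y * (3 * x\<^sup>2 - y\<^sup>2 - 3)"
      unfolding x_def y_def by (simp add: power3_eq_cube power2_eq_square algebra_simps)
    moreover have "Im (of_real t * (3 / 2 * z - 1)) = y * (3 / 2 * t)"
      by (simp add: y_def)
    ultimately show "Im (z ^ 3 - 3 * z + 2) = Im (of_real t * (3 / 2 * z - 1))"
      by (simp only: im)
  qed
  then show "G z = of_real (- 2 + 8 * Re z ^ 3 / (3 * Re z + 1))"
    using G_eq_iff[OF z] by (simp add: t_def D_def x_def)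
qed

text \<open>\<open>G\<close> maps [-2, 0] into itself: the factorised numerator bounds the value
  above by 0, and s^3 / (3/2 s - 1), a quotient of nonpositive numbers, bounds it below by
  -2.\<close>

lemma interval_subset_filled: "complex_of_real ` {-2..0} \<subseteq> filled"
proof (rule invariant_subset_filled)
  fix z assume "z \<in> complex_of_real ` {-2..0}"
  then obtain s where s: "z = of_real s" "-2 \<le> s" "s \<le> 0" by auto
  have d: "3 / 2 * s - 1 < 0" using s by simp
  define t where "t = (s ^ 3 - 3 * s + 2) / (3 / 2 * s - 1)"
  have "s ^ 3 - 3 * s + 2 = (s + 2) * (s - 1)\<^sup>2"
    by (simp add: algebra_simps power2_eq_square power3_eq_cube)
  then have "t \<le> 0"
    unfolding t_def using s d by (intro divide_nonneg_neg) auto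
  have "t + 2 = s ^ 3 / (3 / 2 * s - 1)"
    using d by (simp add: t_def field_simps)
  moreover have "s ^ 3 \<le> 0"
    using s by (simp add: power_le_zero_eq)
  ultimately have "0 \<le> t + 2"
    using d by (simp add: divide_nonpos_neg)
  have "Re z \<noteq> Re (2 / 3)"
    using s by simp
  then have "z \<noteq> 2 / 3"
    by blast
  moreover have "G z = of_real t"
    by (simp add: G_def t_def s(1))
  ultimately show "cmod z \<le> 6 \<and> z \<noteq> 2 / 3 \<and> G z \<in> complex_of_real ` {-2..0}"
    using s \<open>t \<le> 0\<close> \<open>0 \<le> t + 2\<close> by auto
qed

lemma loop_subset_filled:
  assumes "0 \<le> Re z" "Re z \<le> 1" "trisectrix z = 0"
  shows "z \<in> filled"
proof -
  have "4 * Re z ^ 3 \<le> 3 * Re z + 1"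
  proof -
    \<comment> \<open>Shows that the values of \<open>G\<close> on the loop do not exceed 0, the
      value at the tip z = 1.\<close>
    have "3 * Re z + 1 - 4 * Re z ^ 3 = (1 - Re z) * (2 * Re z + 1)\<^sup>2"
      by (simp add: algebra_simps power2_eq_square power3_eq_cube)
    moreover have "0 \<le> (1 - Re z) * (2 * Re z + 1)\<^sup>2"
      using assms by simp
    ultimately show ?thesis by linarith
  qed
  then have "8 * Re z ^ 3 / (3 * Re z + 1) \<le> 2" "0 \<le> 8 * Re z ^ 3 / (3 * Re z + 1)"
    using assms by (simp_all add: divide_le_eq)
  then have "G z \<in> complex_of_real ` {-2..0}"
    unfolding G_on_loop(2)[OF assms] by (intro imageI) simp
  then show ?thesis
    using interval_subset_filled G_on_loop(1)[OF assms] by (subst filled_iff) blast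
qed

lemma open_loop_inside: "open loop_inside"
proof -
  have "open {z. trisectrix z < 0}"
    by (intro open_Collect_less continuous_on_trisectrix continuous_on_const)
  moreover have "loop_inside = {z. 0 < Re z} \<inter> {z. Re z < 1} \<inter> {z. trisectrix z < 0}"
    by (auto simp: loop_inside_def)
  ultimately show ?thesis
    by (metis open_Int open_halfspace_Re_gt open_halfspace_Re_lt)
qed

lemma frontier_loop_inside: "frontier loop_inside \<subseteq> filled"
proof
  fix z assume z: "z \<in> frontier loop_inside"
  have cl: "closed ({z. 0 \<le> Re z} \<inter> {z. Re z \<le> 1} \<inter> {z. trisectrix z \<le> 0})"
    by (intro closed_Int closed_Collect_le continuous_on_trisectrix continuous_intros)
  have "loop_inside \<subseteq> {z. 0 \<le> Re z} \<inter> {z. Re z \<le> 1} \<inter> {z. trisectrix z \<le> 0}"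
    by (auto simp: loop_inside_def)
  then have "z \<in> {z. 0 \<le> Re z} \<inter> {z. Re z \<le> 1} \<inter> {z. trisectrix z \<le> 0}"
    using closure_minimal[OF _ cl] z by (auto simp: frontier_def)
  then have le: "0 \<le> Re z" "Re z \<le> 1" "trisectrix z \<le> 0"
    by auto
  have "z \<notin> loop_inside"
    using z open_loop_inside by (simp add: frontier_def interior_open)
  then have "Re z = 0 \<or> Re z = 1 \<or> trisectrix z = 0"
    using le by (auto simp: loop_inside_def)
  \<comment> \<open>On the lines Re z = 0 and Re z = 1 the polynomial is y^2 and 4 y^2, so being
    nonpositive it vanishes there.\<close>
  then have "trisectrix z = 0"
    using le(3) by (auto simp: trisectrix_def)
  then show "z \<in> filled"
    using loop_subset_filled le by blast
qed

lemma closure_outer_loop_inside: "closure outer \<inter> loop_inside = {}"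
proof -
  have "outer \<inter> loop_inside = {}"
  proof (rule ccontr)
    assume ne: "outer \<inter> loop_inside \<noteq> {}"
    have "(7::complex) \<in> outer - loop_inside"
      using large_subset_outer by (auto simp: loop_inside_def)
    then have "outer \<inter> frontier loop_inside \<noteq> {}"
      using ne by (intro connected_Int_frontier[OF connected_outer]) auto
    then show False
      using frontier_loop_inside outer_subset by blast
  qed
  then show ?thesis
    using open_loop_inside by (metis Int_commute open_Int_closure_eq_empty)
qed

lemma pole_in_loop_inside: "2 / 3 \<in> loop_inside"
  by (simp add: loop_inside_def trisectrix_def power2_eq_square)

lemma pole_notin_outer: "2 / 3 \<notin> outer"
  using closure_outer_loop_inside pole_in_loop_inside closure_subset[of outer] by blast

lemma G_outer: "z \<in> outer \<Longrightarrow> G z \<in> outer"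
proof -
  have "G ` outer \<subseteq> outer"
  proof (rule connected_subset_outer)
    show "connected (G ` outer)"
      using pole_notin_outer by (intro connected_continuous_image continuous_on_G connected_outer)
    show "G ` outer \<subseteq> - filled"
    proof safe
      fix z assume z: "z \<in> outer" "G z \<in> filled"
      then have "z \<in> filled"
        using pole_notin_outer by (subst filled_iff) blast
      then show False
        using z(1) outer_subset by blast
    qed
    have "(7::complex) \<in> outer"
      using large_subset_outer by auto
    then show "G 7 \<in> G ` outer"
      by blast
    have "6 < cmod (G 7)"
      using G_expands[of 7] by simp
    then show "G 7 \<in> outer"
      using large_subset_outer by blast
  qed
  then show "z \<in> outer \<Longrightarrow> G z \<in> outer" by blast
qed

lemma frontier_outer_iff: "z \<in> frontier outer \<longleftrightarrow> z \<in> closure outer \<and> z \<in> filled"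
  using frontier_outer_subset outer_subset open_outer by (auto simp: frontier_def interior_open)

lemma G_closure_outer:
  assumes "z \<in> closure outer" "z \<noteq> 2 / 3"
  shows "G z \<in> closure outer"
proof -
  obtain f where f: "\<And>n. f n \<in> outer" "f \<longlonglongrightarrow> z"
    using assms(1) by (auto simp: closure_sequential)
  then have "(\<lambda>n. G (f n)) \<longlonglongrightarrow> G z"
    using isCont_tendsto_compose[OF isCont_G[OF assms(2)]] by blast
  then show ?thesis
    unfolding closure_sequential using f(1) G_outer by (intro exI[of _ "\<lambda>n. G (f n)"]) auto
qed

lemma G_frontier_outer:
  assumes "z \<in> frontier outer"
  shows "z \<noteq> 2 / 3" "G z \<in> frontier outer"
proof -
  have z: "z \<in> closure outer" "z \<in> filled"
    using assms frontier_outer_iff by blast+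
  have "z \<noteq> 2 / 3 \<and> G z \<in> filled"
    using z(2) by (rule filled_iff[THEN iffD1])
  then show "z \<noteq> 2 / 3" "G z \<in> frontier outer"
    using G_closure_outer[OF z(1)] frontier_outer_iff[of "G z"] by blast+
qed

section \<open>Symmetry about the real axis\<close>

lemma G_cnj: "G (cnj z) = cnj (G z)"
  by (simp add: G_def)

lemma cnj_filled: "z \<in> filled \<Longrightarrow> cnj z \<in> filled"
proof -
  have "cnj ` filled \<subseteq> filled"
  proof (rule invariant_subset_filled)
    fix z assume "z \<in> cnj ` filled"
    then obtain w where w: "z = cnj w" "w \<in> filled" by blast
    then have "w \<noteq> 2 / 3" "G w \<in> filled"
      using filled_iff[THEN iffD1, OF w(2)] by blast+
    have "z \<noteq> 2 / 3"
      using \<open>w \<noteq> 2 / 3\<close> w(1) by (metis complex_cnj_cnj complex_cnj_divide complex_cnj_numeral)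
    then show "cmod z \<le> 6 \<and> z \<noteq> 2 / 3 \<and> G z \<in> cnj ` filled"
      using w \<open>G w \<in> filled\<close> filled_bounded[OF w(2)] by (simp add: G_cnj)
  qed
  then show "z \<in> filled \<Longrightarrow> cnj z \<in> filled" by blast
qed

lemma cnj_outer: "z \<in> outer \<Longrightarrow> cnj z \<in> outer"
proof -
  have "cnj ` outer \<subseteq> outer"
  proof (rule connected_subset_outer)
    show "connected (cnj ` outer)"
      by (intro connected_continuous_image continuous_intros connected_outer)
    show "cnj ` outer \<subseteq> - filled"
    proof safe
      fix z assume "z \<in> outer" "cnj z \<in> filled"
      then show False
        using cnj_filled[of "cnj z"] outer_subset by auto
    qed
    show "(7::complex) \<in> outer"
      using large_subset_outer by auto
    then show "7 \<in> cnj ` outer"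
      by (metis complex_cnj_numeral image_eqI)
  qed
  then show "z \<in> outer \<Longrightarrow> cnj z \<in> outer" by blast
qed

lemma cnj_closure_outer: "z \<in> closure outer \<Longrightarrow> cnj z \<in> closure outer"
proof -
  assume "z \<in> closure outer"
  then obtain f where "\<And>n. f n \<in> outer" "f \<longlonglongrightarrow> z"
    by (auto simp: closure_sequential)
  then show "cnj z \<in> closure outer"
    unfolding closure_sequential
    by (intro exI[of _ "\<lambda>n. cnj (f n)"]) (auto intro: cnj_outer tendsto_cnj)
qed

section \<open>The fixed point in the boundary of the outer component\<close>

definition alpha :: real where
  "alpha = (- 1 - sqrt 17) / 4"

lemma alpha_sq: "alpha\<^sup>2 = 1 - alpha / 2"
  by (simp add: alpha_def power2_eq_square field_simps)

lemma alpha_bounds: "- 1281 / 1000 \<le> alpha" "alpha \<le> - 128 / 100"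
proof -
  have "412 / 100 \<le> sqrt 17"
    by (rule real_le_rsqrt) (simp add: power2_eq_square)
  moreover have "sqrt 17 \<le> 4124 / 1000"
    by (rule real_le_lsqrt) (simp_all add: power2_eq_square)
  ultimately show "- 1281 / 1000 \<le> alpha" "alpha \<le> - 128 / 100"
    by (simp_all add: alpha_def)
qed

text \<open>The quotient of z^3 - 3z + 2 - alpha (3/2 z - 1) by z - alpha; its roots are the other
  two preimages of alpha.\<close>

definition cofactor :: "complex \<Rightarrow> complex" where
  "cofactor z = z\<^sup>2 - 2 + of_real alpha * (z - 2)"

lemma G_minus_alpha:
  assumes "z \<noteq> 2 / 3"
  shows "G z - of_real alpha = (z - of_real alpha) * cofactor z / (3 / 2 * z - 1)"
proof -
  define a where "a = complex_of_real alpha"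
  have a: "a\<^sup>2 = 1 - a / 2"
    unfolding a_def using arg_cong[OF alpha_sq, of complex_of_real] by simp
  have "z ^ 3 - 3 * z + 2 - a * (3 / 2 * z - 1) - (z - a) * (z\<^sup>2 - 2 + a * (z - 2))
      = (a\<^sup>2 - (1 - a / 2)) * (z - 2)"
    by (simp add: field_simps power2_eq_square power3_eq_cube)
  then have eq: "(z - a) * (z\<^sup>2 - 2 + a * (z - 2)) = z ^ 3 - 3 * z + 2 - a * (3 / 2 * z - 1)"
    by (simp add: a)
  have "3 / 2 * z - 1 \<noteq> 0"
    using assms denom_eq_0_iff by blast
  then show ?thesis
    unfolding cofactor_def a_def[symmetric] eq G_def
    by (simp only: diff_divide_distrib nonzero_mult_div_cancel_right not_False_eq_True)
qed

lemma alpha_ne_pole: "complex_of_real alpha \<noteq> 2 / 3"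
proof
  assume "complex_of_real alpha = 2 / 3"
  then have "Re (complex_of_real alpha) = Re (2 / 3)" by (rule arg_cong)
  then show False using alpha_bounds by simp
qed

lemma G_alpha: "G (of_real alpha) = of_real alpha"
  using G_minus_alpha[OF alpha_ne_pole] by simp

lemma alpha_in_filled: "of_real alpha \<in> filled"
proof -
  have "{of_real alpha} \<subseteq> filled"
    using alpha_ne_pole alpha_bounds by (intro invariant_subset_filled) (simp add: G_alpha)
  then show ?thesis by simp
qed

text \<open>The quantitative form of expansion at alpha: there the ratio of the right side to
  \<open>- trisectrix z\<close> is the modulus of the multiplier, about 1.316. Both sides are
  polynomials in x and y^2, and the inequality is checked separately for the part free of y and for
  the multiple of y^2.\<close>

lemma cofactor_bound:
  assumes "Re z < 0"
  shows "- 6 / 5 * trisectrix z \<le> (cmod (cofactor z))\<^sup>2"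
proof -
  define x y where "x = Re z" and "y = Im z"
  define B where "B = x\<^sup>2 + alpha * x - 2 - 2 * alpha"
  have x: "x < 0" using assms by (simp add: x_def)
  have "(cmod (cofactor z))\<^sup>2 = (B - y\<^sup>2)\<^sup>2 + (y * (2 * x + alpha))\<^sup>2"
    unfolding cmod_power2 by (simp add: cofactor_def B_def x_def y_def power2_eq_square algebra_simps)
  also have "\<dots> = B\<^sup>2 + y\<^sup>2 * (y\<^sup>2 + ((2 * x + alpha)\<^sup>2 - 2 * B))"
    by (simp add: power2_eq_square algebra_simps)
  finally have cof: "(cmod (cofactor z))\<^sup>2 = B\<^sup>2 + y\<^sup>2 * (y\<^sup>2 + ((2 * x + alpha)\<^sup>2 - 2 * B))" .
  have "x * (alpha + 128 / 100) \<ge> 0"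
    using x alpha_bounds(2) by (intro mult_nonpos_nonpos) auto
  then have ax: "alpha * x \<ge> - 128 / 100 * x"
    by (simp add: algebra_simps)
  have "x\<^sup>2 - 128 / 100 * x + 56 / 100 \<le> B"
    unfolding B_def using ax alpha_bounds by linarith
  moreover have "0 \<le> x\<^sup>2 - 128 / 100 * x + 56 / 100"
    using x zero_le_power2[of x] by linarith
  ultimately have "(x\<^sup>2 - 128 / 100 * x + 56 / 100)\<^sup>2 \<le> B\<^sup>2"
    by (intro power_mono)
  \<comment> \<open>With -x > 0 every summand on the right is visibly nonnegative. This settles the
    part free of y.\<close>
  moreover have "(x\<^sup>2 - 128 / 100 * x + 56 / 100)\<^sup>2 - 18 / 5 * x\<^sup>2 * (1 - x) =
      (- x) * ((- x - 98 / 100)\<^sup>2 * (- x + 92 / 100) + 12 / 10000 * (- x) + 550032 / 1000000) + 3136 / 10000"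
    by (simp add: power2_eq_square field_simps)
  moreover have "0 \<le> (- x) * ((- x - 98 / 100)\<^sup>2 * (- x + 92 / 100) + 12 / 10000 * (- x) + 550032 / 1000000)"
    using x by (intro mult_nonneg_nonneg add_nonneg_nonneg) auto
  ultimately have 1: "18 / 5 * x\<^sup>2 * (1 - x) \<le> B\<^sup>2"
    by linarith
  \<comment> \<open>The coefficient of y^2; completing the square in x shows that it is
    nonnegative.\<close>
  have "(2 * x + alpha)\<^sup>2 - 2 * B + 6 / 5 * (3 * x + 1) = 2 * x\<^sup>2 + 2 * (alpha * x) + 36 / 10 * x + 62 / 10 + 7 / 2 * alpha"
    using alpha_sq by (simp add: B_def power2_eq_square field_simps)
  also have "\<dots> \<ge> 2 * x\<^sup>2 + 104 / 100 * x + 17 / 10"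
    using ax alpha_bounds by linarith
  also have "2 * x\<^sup>2 + 104 / 100 * x + 17 / 10 = 2 * (x + 26 / 100)\<^sup>2 + 15648 / 10000"
    by (simp add: power2_eq_square field_simps)
  finally have "0 \<le> (2 * x + alpha)\<^sup>2 - 2 * B + 6 / 5 * (3 * x + 1)"
    using zero_le_power2[of "x + 26 / 100"] by linarith
  then have "0 \<le> y\<^sup>2 * (y\<^sup>2 + ((2 * x + alpha)\<^sup>2 - 2 * B + 6 / 5 * (3 * x + 1)))"
    using zero_le_power2[of y] by (intro mult_nonneg_nonneg) linarith+
  moreover have "- 6 / 5 * trisectrix z = 18 / 5 * x\<^sup>2 * (1 - x) - y\<^sup>2 * (6 / 5 * (3 * x + 1))"
    by (simp add: trisectrix_def x_def y_def algebra_simps)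
  ultimately show ?thesis
    unfolding cof using 1 by (simp only: distrib_left)
qed

lemma Im_G:
  assumes "z \<noteq> 2 / 3"
  shows "Im (G z) = Im z * trisectrix z / (cmod (3 / 2 * z - 1))\<^sup>2"
proof -
  have "Im (G z) = Im ((z ^ 3 - 3 * z + 2) * cnj (3 / 2 * z - 1)) / (cmod (3 / 2 * z - 1))\<^sup>2"
    unfolding G_def by (subst complex_div_cnj) (simp only: Im_divide_of_real of_real_power[symmetric])
  also have "Im ((z ^ 3 - 3 * z + 2) * cnj (3 / 2 * z - 1)) = Im z * trisectrix z"
    by (simp add: trisectrix_def power2_eq_square power3_eq_cube field_simps)
  finally show ?thesis .
qed

text \<open>On the upper half plane, \<open>cnj \<circ> G\<close> restricted to \<open>left_region\<close> is a proper map onto the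
  upper half plane. Its inverse branch is a self-map of the half plane fixing the boundary point
  \<open>alpha\<close> with multiplier less than 1, so by Julia's lemma it contracts the horodisc function
  \<open>horo\<close>.\<close>

definition left_region :: "complex set" where
  "left_region = {z. Re z < 0 \<and> 0 < Im z \<and> trisectrix z < 0}"

definition horo :: "complex \<Rightarrow> real" where
  "horo z = (cmod (z - of_real alpha))\<^sup>2 / Im z"

lemma Re_nonpos_ne_pole:
  assumes "Re z \<le> 0"
  shows "z \<noteq> 2 / 3"
proof
  assume "z = 2 / 3"
  then have "Re z = Re (2 / 3)" by (rule arg_cong)
  with assms show False by simp
qed

text \<open>The factor of |z - alpha|^2 is |cofactor|^2 / d and that of the height is - trisectrix /
  d. In the quotient \<open>d\<close> cancels, leaving exactly the ratio estimated in
  \<open>cofactor_bound\<close>.\<close>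

lemma horo_left_region:
  assumes "z \<in> left_region"
  shows "6 / 5 * horo z \<le> horo (cnj (G z))"
proof -
  have z: "Re z < 0" "0 < Im z" "trisectrix z < 0"
    using assms by (auto simp: left_region_def)
  have np: "z \<noteq> 2 / 3"
    using z by (intro Re_nonpos_ne_pole) simp
  define d where "d = (cmod (3 / 2 * z - 1))\<^sup>2"
  have d: "d > 0"
    using np denom_eq_0_iff by (simp add: d_def)
  have "cmod (cnj (G z) - of_real alpha) = cmod (G z - of_real alpha)"
    by (metis complex_cnj_complex_of_real complex_cnj_diff complex_mod_cnj)
  then have "(cmod (cnj (G z) - of_real alpha))\<^sup>2 = (cmod (z - of_real alpha))\<^sup>2 * (cmod (cofactor z))\<^sup>2 / d"
    by (simp only: G_minus_alpha[OF np] norm_mult norm_divide power_mult_distrib power_divide d_def)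
  then have "horo (cnj (G z)) =
      ((cmod (z - of_real alpha))\<^sup>2 * (cmod (cofactor z))\<^sup>2 / d) / (Im z * (- trisectrix z) / d)"
    unfolding horo_def by (simp add: Im_G[OF np] d_def)
  also have "\<dots> = horo z * ((cmod (cofactor z))\<^sup>2 / (- trisectrix z))"
    unfolding horo_def using d z by (simp add: field_simps)
  also have "\<dots> \<ge> horo z * (6 / 5)"
  proof (rule mult_left_mono)
    show "6 / 5 \<le> (cmod (cofactor z))\<^sup>2 / (- trisectrix z)"
      using cofactor_bound[OF z(1)] z(3) by (subst pos_le_divide_eq) auto
    show "0 \<le> horo z"
      using z by (simp add: horo_def)
  qed
  finally show ?thesis by (simp add: mult.commute)
qed

text \<open>The base point lies also in \<open>left_region\<close>, and conj o G sends it to height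
  62000 / 481, above 10 and hence into this component again; the preimage argument starts from
  it.\<close>

definition upper_outer :: "complex set" where
  "upper_outer = connected_component_set (- filled \<inter> {z. 0 < Im z}) (Complex (- 10) 10)"

lemma open_upper: "open (- filled \<inter> {z. 0 < Im z})"
  by (intro open_Int open_compl_filled open_halfspace_Im_gt)

lemma high_subset_upper_outer: "{z. 10 \<le> Im z} \<subseteq> upper_outer"
  unfolding upper_outer_def
proof (rule connected_component_maximal)
  show "connected {z. 10 \<le> Im z}"
    using convex_halfspace_Im_ge[of 10] by (simp add: convex_connected)
  show "{z. 10 \<le> Im z} \<subseteq> - filled \<inter> {z. 0 < Im z}"
  proof
    fix z assume z: "z \<in> {z. 10 \<le> Im z}"
    then have "6 < cmod z"
      using abs_Im_le_cmod[of z] by auto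
    then show "z \<in> - filled \<inter> {z. 0 < Im z}"
      using filled_bounded[of z] z by auto
  qed
qed simp

lemma upper_outer_subset: "upper_outer \<subseteq> outer"
proof (rule connected_subset_outer)
  show "connected upper_outer"
    unfolding upper_outer_def by (rule connected_connected_component)
  show "upper_outer \<subseteq> - filled"
    unfolding upper_outer_def using connected_component_subset by blast
  show "Complex 0 10 \<in> upper_outer"
    using high_subset_upper_outer by auto
  have "6 < cmod (Complex 0 10)"
    by (simp add: complex_norm)
  then show "Complex 0 10 \<in> outer"
    using large_subset_outer by blast
qed

lemma open_left_region: "open left_region"
proof -
  have "left_region = {z. Re z < 0} \<inter> {z. 0 < Im z} \<inter> {z. trisectrix z < 0}"
    by (auto simp: left_region_def)
  moreover have "open {z. trisectrix z < 0}"
    by (intro open_Collect_less continuous_on_trisectrix continuous_on_const)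
  ultimately show ?thesis
    by (metis open_Int open_halfspace_Re_lt open_halfspace_Im_gt)
qed

text \<open>The image \<open>T\<close> of the component \<open>P1\<close> is open by the open
  mapping theorem. It is relatively closed because preimages of a convergent sequence stay bounded,
  and a limit \<open>l\<close> whose image has positive height satisfies the strict inequalities of
  \<open>left_region\<close>: the sign of Im (G l) excludes Im l = 0 and trisectrix l = 0, and the
  latter sign excludes Re l = 0. The component \<open>P1\<close> replaces \<open>P\<close> so that
  the preimage found lies in \<open>upper_outer\<close>.\<close>

lemma upper_outer_preimage:
  assumes "v \<in> upper_outer"
  obtains z where "z \<in> upper_outer" "z \<in> left_region" "cnj (G z) = v"
proof -
  define w where "w = Complex (- 10) 10"
  define P where "P = left_region \<inter> (\<lambda>z. cnj (G z)) -` upper_outer"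
  define P1 where "P1 = connected_component_set P w"
  define T where "T = (\<lambda>z. cnj (G z)) ` P1"
  have pole: "2 / 3 \<notin> left_region"
    using Re_nonpos_ne_pole by (force simp: left_region_def)
  have cont: "continuous_on left_region (\<lambda>z. cnj (G z))"
    using pole by (intro continuous_intros continuous_on_G)
  have "open upper_outer"
    unfolding upper_outer_def by (intro open_connected_component open_upper)
  then have "open P"
    unfolding P_def using cont open_left_region by (intro continuous_open_preimage)
  then have "open P1"
    unfolding P1_def by (rule open_connected_component)
  have P1P: "P1 \<subseteq> P"
    unfolding P1_def by (rule connected_component_subset)
  have TU: "T \<subseteq> upper_outer"
    using P1P by (auto simp: T_def P_def)
  have wL: "w \<in> left_region"
    by (simp add: left_region_def w_def trisectrix_def power2_eq_square)
  have "Im (G w) = 10 * (- 6200) / 481"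
  proof -
    have "(cmod (3 / 2 * w - 1))\<^sup>2 = 481"
      unfolding cmod_power2 by (simp add: w_def power2_eq_square)
    moreover have "trisectrix w = - 6200"
      by (simp add: w_def trisectrix_def power2_eq_square)
    moreover have "w \<noteq> 2 / 3"
      using pole wL by blast
    ultimately show ?thesis
      by (simp add: Im_G) (simp add: w_def)
  qed
  then have "cnj (G w) \<in> upper_outer"
    using high_subset_upper_outer by auto
  then have "w \<in> P"
    using wL by (simp add: P_def)
  then have wP1: "w \<in> P1"
    by (simp add: P1_def)
  have "open T"
  proof -
    have "open (G ` P1)"
      using \<open>open P1\<close> P1P pole by (intro open_image_G) (auto simp: P_def)
    moreover have "T = cnj -` (G ` P1)"
    proof (rule set_eqI)
      show "x \<in> T \<longleftrightarrow> x \<in> cnj -` (G ` P1)" for x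
        unfolding T_def image_iff vimage_eq by (metis complex_cnj_cnj)
    qed
    moreover have "continuous_on UNIV cnj"
      by (intro continuous_intros)
    ultimately show ?thesis
      by (metis open_vimage)
  qed
  moreover have "v' \<in> T" if v': "v' \<in> upper_outer" "v' \<in> closure T" for v'
  proof -
    obtain f where "\<And>n. f n \<in> T" and f: "f \<longlonglongrightarrow> v'"
      using v'(2) by (auto simp: closure_sequential)
    then have "\<forall>n. \<exists>u. u \<in> P1 \<and> f n = cnj (G u)"
      by (auto simp: T_def)
    then obtain u where u: "\<And>n. u n \<in> P1" "\<And>n. f n = cnj (G (u n))"
      by metis
    obtain M where M: "\<And>n. cmod (f n) \<le> M"
      using convergent_imp_Bseq[OF convergentI[OF f]] by (auto simp: Bseq_def)
    have "cmod (u n) \<le> max 6 M" for n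
    proof (cases "6 < cmod (u n)")
      case True
      then have "3 / 2 * cmod (u n) \<le> M"
        using G_expands[OF True] M[of n] by (simp add: u(2))
      then show ?thesis
        using norm_ge_zero[of "u n"] by linarith
    qed simp
    then have "bounded (range u)"
      unfolding bounded_iff by blast
    then obtain l r where l: "strict_mono (r :: nat \<Rightarrow> nat)" "(u \<circ> r) \<longlonglongrightarrow> l"
      using bounded_imp_convergent_subsequence by blast
    have lc: "l \<in> closure P1"
      unfolding closure_sequential using u(1) l(2) by (intro exI[of _ "u \<circ> r"]) auto
    have "closed ({z. Re z \<le> 0} \<inter> {z. 0 \<le> Im z} \<inter> {z. trisectrix z \<le> 0})"
      by (intro closed_Int closed_Collect_le continuous_on_trisectrix continuous_intros)
    moreover have "P1 \<subseteq> {z. Re z \<le> 0} \<inter> {z. 0 \<le> Im z} \<inter> {z. trisectrix z \<le> 0}"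
      using P1P by (auto simp: P_def left_region_def)
    ultimately have le: "Re l \<le> 0" "0 \<le> Im l" "trisectrix l \<le> 0"
      using closure_minimal lc by blast+
    have np: "l \<noteq> 2 / 3"
      using le(1) by (rule Re_nonpos_ne_pole)
    have "(\<lambda>n. cnj (G ((u \<circ> r) n))) \<longlonglongrightarrow> cnj (G l)"
      by (intro tendsto_cnj isCont_tendsto_compose[OF isCont_G[OF np] l(2)])
    moreover have "(\<lambda>n. cnj (G ((u \<circ> r) n))) \<longlonglongrightarrow> v'"
      using LIMSEQ_subseq_LIMSEQ[OF f l(1)] by (simp add: o_def u(2))
    ultimately have lv: "cnj (G l) = v'"
      by (rule LIMSEQ_unique)
    have "0 < Im v'"
      using v'(1) connected_component_subset unfolding upper_outer_def by blast
    then have "Im (G l) < 0"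
      using lv by auto
    then have neg: "Im l * trisectrix l < 0"
      unfolding Im_G[OF np] by (simp add: divide_less_0_iff)
    have "0 < Im l" "trisectrix l < 0"
      using neg le by (auto simp: mult_less_0_iff)
    moreover have "Re l \<noteq> 0"
      using \<open>trisectrix l < 0\<close> by (auto simp: trisectrix_def)
    ultimately have "l \<in> left_region"
      using le by (auto simp: left_region_def)
    then have "l \<in> P"
      using lv v'(1) by (simp add: P_def)
    then have "l \<in> P1"
      using closure_component_Int[OF \<open>open P\<close>] lc unfolding P1_def by blast
    then show ?thesis
      using lv by (auto simp: T_def)
  qed
  then have "T = upper_outer \<inter> closure T"
    using TU closure_subset[of T] by blast
  moreover have "T \<noteq> {}"
    using wP1 by (auto simp: T_def)
  moreover have "connected upper_outer"
    unfolding upper_outer_def by (rule connected_connected_component)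
  ultimately have "T = upper_outer"
    using TU unfolding connected_clopen
    by (metis closed_closure closedin_closed_Int openin_open_Int inf.absorb2)
  then have "v \<in> T"
    using assms by simp
  then obtain z where z: "z \<in> P1" "cnj (G z) = v"
    by (auto simp: T_def)
  have "P1 \<subseteq> upper_outer"
    unfolding upper_outer_def
  proof (rule connected_component_maximal)
    show "Complex (- 10) 10 \<in> P1"
      using wP1 by (simp add: w_def)
    show "connected P1"
      unfolding P1_def by (rule connected_connected_component)
    show "P1 \<subseteq> - filled \<inter> {z. 0 < Im z}"
    proof
      fix p assume "p \<in> P1"
      then have p: "p \<in> left_region" "cnj (G p) \<in> upper_outer"
        using P1P by (auto simp: P_def)
      have "cnj (G p) \<notin> filled"
        using p(2) upper_outer_subset outer_subset by blast
      then have "G p \<notin> filled"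
        using cnj_filled by blast
      then have "p \<notin> filled"
        using filled_iff[of p] by blast
      then show "p \<in> - filled \<inter> {z. 0 < Im z}"
        using p(1) by (simp add: left_region_def)
    qed
  qed
  then show thesis
    using that z P1P by (auto simp: P_def)
qed

text \<open>A backward orbit of 10i under conj o G stays in \<open>upper_outer\<close>, and
  \<open>horo\<close> decays along it like (5/6)^n. As the height of a point is at most its distance
  to alpha, \<open>horo\<close> dominates that distance.\<close>

lemma alpha_in_frontier: "of_real alpha \<in> frontier outer"
proof -
  define w where "w = Complex 0 10"
  have w: "w \<in> upper_outer"
    using high_subset_upper_outer by (auto simp: w_def)
  have "\<exists>z \<in> upper_outer. horo z \<le> horo w * (5 / 6) ^ n" for n
  proof (induction n)
    case 0
    then show ?case using w by auto
  next
    case (Suc n)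
    then obtain v where v: "v \<in> upper_outer" "horo v \<le> horo w * (5 / 6) ^ n"
      by blast
    then obtain z where "z \<in> upper_outer" "z \<in> left_region" "cnj (G z) = v"
      using upper_outer_preimage by blast
    moreover from this have "6 / 5 * horo z \<le> horo v"
      using horo_left_region by blast
    ultimately show ?case
      using v(2) by (intro bexI[of _ z]) auto
  qed
  then obtain z where z: "\<And>n. z n \<in> upper_outer" "\<And>n. horo (z n) \<le> horo w * (5 / 6) ^ n"
    by metis
  have "cmod (z n - of_real alpha) \<le> horo w * (5 / 6) ^ n" for n
  proof -
    define r where "r = cmod (z n - of_real alpha)"
    have im: "0 < Im (z n)"
      using z(1)[of n] connected_component_subset unfolding upper_outer_def by blast
    have "Im (z n) \<le> r"
      using abs_Im_le_cmod[of "z n - of_real alpha"] by (simp add: r_def)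
    then have "r * Im (z n) \<le> r\<^sup>2"
      unfolding power2_eq_square by (intro mult_left_mono) (simp_all add: r_def)
    then have "r \<le> horo (z n)"
      using im by (simp add: horo_def r_def[symmetric] pos_le_divide_eq)
    then show ?thesis
      using z(2)[of n] by (simp add: r_def)
  qed
  then have "\<forall>\<^sub>F n in sequentially. cmod (z n - of_real alpha) \<le> horo w * (5 / 6) ^ n"
    by (intro always_eventually allI)
  moreover have "(\<lambda>n. horo w * (5 / 6) ^ n) \<longlonglongrightarrow> 0"
    by (intro tendsto_mult_right_zero LIMSEQ_realpow_zero) auto
  ultimately have "(\<lambda>n. z n - of_real alpha) \<longlonglongrightarrow> 0"
    by (rule Lim_null_comparison)
  then have "z \<longlonglongrightarrow> of_real alpha"
    by (simp add: LIM_zero_iff)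
  then have "of_real alpha \<in> closure outer"
    unfolding closure_sequential using z(1) upper_outer_subset by (intro exI[of _ z]) auto
  then show ?thesis
    using alpha_in_filled frontier_outer_iff by blast
qed

section \<open>Holomorphic maps in the chart at infinity\<close>

lemma coord_param_Infty: "coord Infty (param Infty w) = w"
  by simp

lemma param_coord_Infty: "x \<noteq> Fin 0 \<Longrightarrow> param Infty (coord Infty x) = x"
  by (cases x) auto

lemma tendsto_param_Infty: "(param Infty \<longlongrightarrow> param Infty b) (nhds b)"
proof (cases "b = 0")
  case True
  moreover have "param Infty 0 = Infty"
    by simp
  ultimately show ?thesis
    using tendsto_param[OF filterlim_ident, of Infty] by (simp only:)
next
  case False
  have "((\<lambda>w. 1 / w) \<longlongrightarrow> 1 / b) (nhds b)"
    using False by (intro tendsto_intros filterlim_ident)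
  then have "((\<lambda>w. Fin (1 / w)) \<longlongrightarrow> Fin (1 / b)) (nhds b)"
    by (rule filterlim_compose[of Fin, rotated]) (simp add: filterlim_def nhds_Fin)
  moreover have "\<forall>\<^sub>F w in nhds b. Fin (1 / w) = param Infty w"
    using t1_space_nhds[OF False] by eventually_elim simp
  ultimately have "(param Infty \<longlongrightarrow> Fin (1 / b)) (nhds b)"
    by (rule Lim_transform_eventually)
  then show ?thesis
    using False by (simp only: param.simps(2)[of b] if_False)
qed

lemma analytic_at_imp_tendsto_nhds: "f analytic_on {z} \<Longrightarrow> (f \<longlongrightarrow> f z) (nhds z)"
  using analytic_at_imp_isCont by (metis continuous_at tendsto_at_iff_tendsto_nhds)

lemma sphere_holomorphic_on_from_chart:
  assumes "open U" "Fin 0 \<notin> U" "open S" "F holomorphic_on S" "coord Infty ` U \<subseteq> S"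
  shows "sphere_holomorphic_on (\<lambda>x. Fin (F (coord Infty x))) U"
proof -
  have an: "(\<lambda>w. F (coord Infty (param x w))) analytic_on {0}" if x: "x \<in> U" for x
  proof -
    have F: "F analytic_on S"
      using assms by (simp add: analytic_on_open)
    have "(\<lambda>w. coord Infty (param x w)) analytic_on {0}"
    proof (cases x)
      case (Fin a)
      then have "a \<noteq> 0" using x assms(2) by auto
      then have "(\<lambda>w. 1 / (a + w)) analytic_on {0}"
        by (intro analytic_intros) auto
      then show ?thesis by (simp add: Fin)
    next
      case Infty
      then show ?thesis
        by (simp only: coord_param_Infty analytic_on_ident)
    qed
    moreover have "coord Infty (param x 0) \<in> S"
      using x assms(5) by (cases x) force+
    ultimately show ?thesis
      using analytic_on_compose_gen[OF _ F] by (force simp: o_def)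
  qed
  have param0: "param x 0 = x" for x
    by (cases x) auto
  have "isCont (\<lambda>x. Fin (F (coord Infty x))) x" if x: "x \<in> U" for x
  proof -
    have "((\<lambda>w. F (coord Infty (param x w))) \<longlongrightarrow> F (coord Infty x)) (nhds 0)"
      using analytic_at_imp_tendsto_nhds[OF an[OF x]] by (simp add: param0)
    then show ?thesis
      unfolding isCont_sphere_iff
      by (rule filterlim_compose[of Fin, rotated]) (simp add: filterlim_def nhds_Fin)
  qed
  moreover have "local_rep (\<lambda>x. Fin (F (coord Infty x))) x analytic_on {0}" if x: "x \<in> U" for x
    unfolding local_rep_def using an[OF x] by (auto intro!: analytic_intros)
  ultimately show ?thesis
    unfolding sphere_holomorphic_on_def using assms(1) by (simp add: continuous_at_imp_continuous_on)
qed

lemma sphere_holomorphic_on_into_chart: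
  assumes "open D" "K holomorphic_on D" and \<psi>: "\<And>u. \<psi> (Fin u) = param Infty (K u)"
  shows "sphere_holomorphic_on \<psi> (Fin ` D)"
proof -
  have an: "(\<lambda>w. K (u + w)) analytic_on {0}" if "u \<in> D" for u
  proof -
    have K: "K analytic_on D"
      using assms by (simp add: analytic_on_open)
    have "(\<lambda>w. u + w) analytic_on {0}"
      by (intro analytic_intros)
    then have "K \<circ> (\<lambda>w. u + w) analytic_on {0}"
      by (rule analytic_on_compose_gen[OF _ K]) (use that in auto)
    then show ?thesis by (simp add: o_def)
  qed
  have lim: "((\<lambda>w. K (u + w)) \<longlongrightarrow> K u) (nhds 0)" if "u \<in> D" for u
    using analytic_at_imp_tendsto_nhds[OF an[OF that]] by simp
  have "isCont \<psi> (Fin u)" if u: "u \<in> D" for u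
    unfolding isCont_sphere_iff using filterlim_compose[OF tendsto_param_Infty lim[OF u]]
    by (simp only: \<psi> param.simps(1))
  moreover have "local_rep \<psi> (Fin u) analytic_on {0}" if u: "u \<in> D" for u
  proof (cases "K u = 0")
    case True
    then have "local_rep \<psi> (Fin u) = (\<lambda>w. K (u + w))"
      unfolding local_rep_def by (simp add: \<psi> fun_eq_iff)
    then show ?thesis
      using an[OF u] by simp
  next
    case False
    have "\<forall>\<^sub>F w in nhds 0. K (u + w) \<noteq> 0"
      using lim[OF u] False by (rule tendsto_imp_eventually_ne)
    then have ev: "\<forall>\<^sub>F w in nhds 0. local_rep \<psi> (Fin u) w = 1 / K (u + w) - 1 / K u"
      by eventually_elim (use False in \<open>simp add: local_rep_def \<psi>\<close>)
    moreover have "(\<lambda>w. 1 / K (u + w) - 1 / K u) analytic_on {0}"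
      using False by (intro analytic_intros an[OF u]) auto
    ultimately show ?thesis
      using analytic_at_cong[OF ev refl] by blast
  qed
  ultimately show ?thesis
    unfolding sphere_holomorphic_on_def
    using assms(1) by (auto simp: open_image_Fin intro!: continuous_at_imp_continuous_on)
qed

section \<open>Proper self-maps of the disc with a single zero\<close>

text \<open>Stands for letting r tend to 1 in the maximum modulus estimates below.\<close>

lemma le_1_from_le_inverse:
  fixes a x :: real
  assumes "a < 1" "\<And>r. a < r \<Longrightarrow> 0 < r \<Longrightarrow> r < 1 \<Longrightarrow> x \<le> 1 / r"
  shows "x \<le> 1"
proof (rule ccontr)
  assume "\<not> x \<le> 1"
  then have x: "1 / x < 1" "x > 1" by auto
  then obtain r where r: "max (max a 0) (1 / x) < r" "r < 1"
    using dense[of "max (max a 0) (1 / x)" 1] assms(1) by auto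
  then have "x \<le> 1 / r" using assms(2) by auto
  then have "x * r \<le> 1" using r by (simp add: field_simps)
  moreover have "1 < x * r" using r x by (simp add: field_simps)
  ultimately show False by simp
qed

text \<open>A Schwarz lemma used in both directions. The maximum principle for \<open>q\<close> on
  circles of radius sqrt r gives |q| at most 1. Properness keeps |u^2 q u| above \<open>r\<close>
  near the unit circle, so the maximum principle for 1/q gives |q| at least 1. A holomorphic
  function of constant modulus is constant.\<close>

lemma proper_disc_map_unimodular_factor:
  assumes hol: "q holomorphic_on ball 0 1"
    and nz: "\<And>u. u \<in> ball 0 1 \<Longrightarrow> q u \<noteq> 0"
    and lt: "\<And>u. u \<in> ball 0 1 \<Longrightarrow> cmod (u\<^sup>2 * q u) < 1"
    and proper: "\<And>r. r < 1 \<Longrightarrow> \<exists>s<1. \<forall>u\<in>ball 0 1. cmod (u\<^sup>2 * q u) \<le> r \<longrightarrow> cmod u \<le> s"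
  obtains c where "cmod c = 1" "\<And>u. u \<in> ball 0 1 \<Longrightarrow> q u = c"
proof -
  have bound: "cmod (p u) \<le> B"
    if "p holomorphic_on ball 0 1" "cmod u < \<rho>" "\<rho> < 1" "\<And>v. cmod v = \<rho> \<Longrightarrow> cmod (p v) \<le> B" for p u \<rho> B
  proof (rule maximum_modulus_frontier[of p "ball 0 \<rho>"])
    have "0 < \<rho>" using that(2) norm_ge_zero[of u] by linarith
    have "cball 0 \<rho> \<subseteq> ball (0::complex) 1" using that(3) by auto
    then show "continuous_on (closure (ball 0 \<rho>)) p"
      using holomorphic_on_imp_continuous_on[OF that(1)] \<open>0 < \<rho>\<close> by (auto intro: continuous_on_subset)
    show "p holomorphic_on interior (ball 0 \<rho>)"
      unfolding interior_open[OF open_ball] using that(3)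
      by (intro holomorphic_on_subset[OF that(1)]) auto
    show "cmod (p z) \<le> B" if "z \<in> frontier (ball 0 \<rho>)" for z
      using that \<open>0 < \<rho>\<close> \<open>\<And>v. cmod v = \<rho> \<Longrightarrow> cmod (p v) \<le> B\<close> by simp
  qed (use that in auto)
  have le1: "cmod (q u) \<le> 1" if u: "u \<in> ball 0 1" for u
  proof (rule le_1_from_le_inverse[of "(cmod u)\<^sup>2"])
    show "(cmod u)\<^sup>2 < 1" using u by (simp add: power_less_one_iff abs_square_less_1)
    fix r :: real assume r: "(cmod u)\<^sup>2 < r" "0 < r" "r < 1"
    show "cmod (q u) \<le> 1 / r"
    proof (rule bound[OF hol, of u "sqrt r"])
      show "cmod u < sqrt r" using r by (simp add: real_less_rsqrt)
      show "sqrt r < 1" using r by simp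
      fix v assume v: "cmod v = sqrt r"
      then have "v \<in> ball 0 1" using r by simp
      from lt[OF this] show "cmod (q v) \<le> 1 / r"
        using v r by (simp add: norm_mult norm_power field_simps)
    qed
  qed
  have ge1: "1 \<le> cmod (q u)" if u: "u \<in> ball 0 1" for u
  proof -
    have "cmod (1 / q u) \<le> 1"
    proof (rule le_1_from_le_inverse[of 0])
      fix r :: real assume r: "0 < r" "r < 1"
      obtain s where s: "s < 1" "\<And>v. v \<in> ball 0 1 \<Longrightarrow> cmod (v\<^sup>2 * q v) \<le> r \<Longrightarrow> cmod v \<le> s"
        using proper[OF r(2)] by blast
      obtain \<rho> where \<rho>: "max s (cmod u) < \<rho>" "\<rho> < 1"
        using dense[of "max s (cmod u)" 1] s(1) u by auto
      show "cmod (1 / q u) \<le> 1 / r"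
      proof (rule bound[of "\<lambda>u. 1 / q u" u \<rho>])
        show "(\<lambda>u. 1 / q u) holomorphic_on ball 0 1"
          using nz by (intro holomorphic_intros hol)
        fix v assume v: "cmod v = \<rho>"
        then have "v \<in> ball 0 1" "\<not> cmod v \<le> s" using \<rho> by auto
        then have "r < cmod (v\<^sup>2 * q v)"
          using s(2) by force
        also have "\<dots> \<le> 1 * cmod (q v)"
          unfolding norm_mult norm_power using v \<rho> norm_ge_zero[of u]
          by (intro mult_right_mono power_le_one) auto
        finally show "cmod (1 / q v) \<le> 1 / r"
          using r by (simp add: norm_divide frac_le)
      qed (use \<rho> in auto)
    qed simp
    then show ?thesis
      using nz[OF u] by (simp add: norm_divide)
  qed
  have "q constant_on ball 0 1"
  proof (rule maximum_modulus_principle[OF hol, of "ball 0 1" 0])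
    show "cmod (q z) \<le> cmod (q 0)" if "z \<in> ball 0 1" for z
      using le1[OF that] ge1[of 0] by simp
  qed auto
  then obtain c where c: "\<And>u. u \<in> ball 0 1 \<Longrightarrow> q u = c"
    by (auto simp: constant_on_def)
  then have "cmod c = 1"
    using le1[of 0] ge1[of 0] by simp
  then show thesis
    using c that by blast
qed

section \<open>The Riemann map of the outer component\<close>

text \<open>Omega in the coordinate 1/z, a bounded plane domain because \<open>filled\<close>
  contains a disc about 0. The point at infinity needs the clause \<open>w = 0\<close>, as 1 / 0
  evaluates to 0.\<close>

definition outer_chart :: "complex set" where
  "outer_chart = {w. w = 0 \<or> 1 / w \<in> outer}"

text \<open>\<open>G\<close> maps the discs of radius 1/3 about 0 and 2/27 about -2 into each
  other.\<close>

lemma cball_subset_filled: "cball 0 (1 / 3) \<subseteq> filled"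
proof -
  have "cball 0 (1 / 3) \<union> cball (-2) (2 / 27) \<subseteq> filled"
  proof (rule invariant_subset_filled)
    fix z :: complex assume "z \<in> cball 0 (1 / 3) \<union> cball (-2) (2 / 27)"
    then consider "cmod z \<le> 1 / 3" | "cmod (z + 2) \<le> 2 / 27"
      by (auto simp: dist_norm norm_minus_commute)
    then show "cmod z \<le> 6 \<and> z \<noteq> 2 / 3 \<and> G z \<in> cball 0 (1 / 3) \<union> cball (-2) (2 / 27)"
    proof cases
      case 1
      have "cmod z ^ 3 \<le> (1 / 3) ^ 3"
        using 1 by (intro power_mono) auto
      then have "cmod (G z + 2) \<le> 2 / 27"
        using G_near_0(2)[OF 1] by (simp add: power3_eq_cube)
      moreover have "dist (- 2) (G z) = cmod (G z + 2)"
        by (simp add: dist_norm norm_minus_commute)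
      ultimately show ?thesis
        using 1 G_near_0(1)[OF 1] by (intro conjI) (auto simp only: mem_cball Un_iff)
    next
      case 2
      have "cmod (G z) \<le> 1 / 3"
        using G_near_m2(2)[OF 2] 2 by linarith
      moreover have "cmod z \<le> 6"
        using norm_triangle_ineq4[of "z + 2" 2] 2 by simp
      ultimately show ?thesis
        using G_near_m2(1)[OF 2] by (intro conjI) (auto simp only: mem_cball_0 Un_iff)
    qed
  qed
  then show ?thesis by blast
qed

lemma zero_notin_outer: "0 \<notin> outer"
  using critical_cycle_in_filled(1) outer_subset by blast

lemma outer_chart_bounded: "w \<in> outer_chart \<Longrightarrow> cmod w \<le> 3"
proof -
  assume w: "w \<in> outer_chart"
  show "cmod w \<le> 3"
  proof (cases "w = 0")
    case False
    then have "1 / w \<notin> filled"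
      using w outer_subset by (auto simp: outer_chart_def)
    then have "\<not> cmod (1 / w) \<le> 1 / 3"
      using cball_subset_filled by auto
    then show ?thesis
      using False by (simp add: norm_divide field_simps)
  qed simp
qed

lemma ball_subset_outer_chart: "ball 0 (1 / 6) \<subseteq> outer_chart"
proof
  fix w :: complex assume w: "w \<in> ball 0 (1 / 6)"
  show "w \<in> outer_chart"
  proof (cases "w = 0")
    case False
    then have "6 < cmod (1 / w)"
      using w by (simp add: norm_divide field_simps)
    then show ?thesis
      using large_subset_outer by (auto simp: outer_chart_def)
  qed (simp add: outer_chart_def)
qed

lemma outer_chart_eq: "outer_chart = ball 0 (1 / 6) \<union> (\<lambda>z. 1 / z) ` outer"
proof (intro equalityI subsetI)
  fix w assume "w \<in> outer_chart"
  then show "w \<in> ball 0 (1 / 6) \<union> (\<lambda>z. 1 / z) ` outer"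
    by (cases "w = 0") (auto simp: outer_chart_def image_iff intro!: bexI[of _ "1 / w"])
next
  fix w assume "w \<in> ball 0 (1 / 6) \<union> (\<lambda>z. 1 / z) ` outer"
  then show "w \<in> outer_chart"
    using ball_subset_outer_chart by (auto simp: outer_chart_def)
qed

lemma open_outer_chart: "open outer_chart"
proof -
  have "open (- {0} \<inter> (\<lambda>w. 1 / w) -` outer)"
    by (intro continuous_open_preimage continuous_intros open_outer) auto
  moreover have "outer_chart = ball 0 (1 / 6) \<union> (- {0} \<inter> (\<lambda>w. 1 / w) -` outer)"
    using ball_subset_outer_chart zero_notin_outer by (auto simp: outer_chart_def)
  ultimately show ?thesis
    by (metis open_Un open_ball)
qed

lemma connected_outer_chart: "connected outer_chart"
  unfolding outer_chart_eq
proof (rule connected_Un)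
  show "connected ((\<lambda>z. 1 / z) ` outer)"
    using zero_notin_outer by (intro connected_continuous_image connected_outer continuous_intros) auto
  have "(7::complex) \<in> outer"
    using large_subset_outer by auto
  then have "1 / 7 \<in> (\<lambda>z. 1 / z) ` outer" "(1 / 7 :: complex) \<in> ball 0 (1 / 6)"
    by (blast, simp add: norm_divide)
  then show "ball 0 (1 / 6) \<inter> (\<lambda>z. 1 / z) ` outer \<noteq> {}"
    by blast
qed simp

text \<open>Inversion carries the complement of \<open>outer\<close> without 0 onto this set.
  Deleting 0 does no harm since a disc about it lies in the complement: remove a smaller ball, then
  add a punctured disc that overlaps what is left.\<close>

lemma connected_compl_outer_chart: "connected (- outer_chart)"
proof -
  have cb: "z \<notin> outer" if "cmod z \<le> 1 / 3" for z
    using cball_subset_filled outer_subset that by auto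
  have "connected ((- outer - ball 0 (1 / 6)) \<union> (ball 0 (1 / 3) - {0}))"
  proof (rule connected_Un)
    have "cball 0 (1 / 6) \<subseteq> - outer"
      using cb by force
    then show "connected (- outer - ball 0 (1 / 6))"
      by (intro connected_diff_ball connected_compl_outer) auto
    show "connected (ball 0 (1 / 3) - {0 :: complex})"
      by (intro connected_open_delete) auto
    have "1 / 5 \<in> (- outer - ball 0 (1 / 6)) \<inter> (ball 0 (1 / 3) - {0 :: complex})"
      using cb[of "1 / 5"] by (simp add: norm_divide)
    then show "(- outer - ball 0 (1 / 6)) \<inter> (ball 0 (1 / 3) - {0 :: complex}) \<noteq> {}"
      by blast
  qed
  moreover have "(- outer - ball 0 (1 / 6)) \<union> (ball 0 (1 / 3) - {0}) = - outer - {0}"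
  proof (rule set_eqI)
    fix z
    show "z \<in> (- outer - ball 0 (1 / 6)) \<union> (ball 0 (1 / 3) - {0}) \<longleftrightarrow> z \<in> - outer - {0}"
      using cb[of z] by (cases "z = 0") auto
  qed
  ultimately have "connected (- outer - {0})" by simp
  then have "connected ((\<lambda>z. 1 / z) ` (- outer - {0}))"
    by (intro connected_continuous_image continuous_intros) auto
  moreover have "(\<lambda>z. 1 / z) ` (- outer - {0}) = - outer_chart"
  proof (intro equalityI subsetI)
    fix w assume "w \<in> - outer_chart"
    then have "w = 1 / (1 / w)" "1 / w \<in> - outer - {0}"
      by (auto simp: outer_chart_def)
    then show "w \<in> (\<lambda>z. 1 / z) ` (- outer - {0})" by blast
  qed (auto simp: outer_chart_def)
  ultimately show ?thesis by simp
qed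

lemma simply_connected_outer_chart: "simply_connected outer_chart"
proof -
  have "bounded outer_chart"
    unfolding bounded_iff using outer_chart_bounded by blast
  then show ?thesis
    using simply_connected_iff_simple[OF open_outer_chart] connected_outer_chart connected_compl_outer_chart
    by blast
qed

lemma zero_in_outer_chart: "0 \<in> outer_chart"
  by (simp add: outer_chart_def)

lemma Riemann_map_outer_chart:
  obtains f k where "f holomorphic_on outer_chart" "k holomorphic_on ball 0 1"
    "\<And>w. w \<in> outer_chart \<Longrightarrow> f w \<in> ball 0 1 \<and> k (f w) = w"
    "\<And>u. u \<in> ball 0 1 \<Longrightarrow> k u \<in> outer_chart \<and> f (k u) = u" "f 0 = 0"
proof -
  have "outer_chart \<noteq> UNIV"
    using outer_chart_bounded[of 4] by auto
  then obtain f0 k0 where f0: "f0 holomorphic_on outer_chart" "k0 holomorphic_on ball 0 1"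
      "\<And>w. w \<in> outer_chart \<Longrightarrow> f0 w \<in> ball 0 1 \<and> k0 (f0 w) = w"
      "\<And>u. u \<in> ball 0 1 \<Longrightarrow> k0 u \<in> outer_chart \<and> f0 (k0 u) = u"
    using Riemann_mapping_theorem[of outer_chart] open_outer_chart simply_connected_outer_chart
      zero_in_outer_chart by (metis empty_iff)
  \<comment> \<open>A disc automorphism moves the image of 0 to 0, so that the double zero of the
    conjugated map sits at the centre.\<close>
  obtain m n where m: "m (f0 0) = 0" "m holomorphic_on ball 0 1" "m ` ball 0 1 \<subseteq> ball 0 1"
      "n holomorphic_on ball 0 1" "n ` ball 0 1 \<subseteq> ball 0 1"
      "\<And>z. z \<in> ball 0 1 \<Longrightarrow> m (n z) = z" "\<And>z. z \<in> ball 0 1 \<Longrightarrow> n (m z) = z"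
    using ball_biholomorphism_exists f0(3)[OF zero_in_outer_chart] by blast
  show thesis
  proof (rule that[of "m \<circ> f0" "k0 \<circ> n"])
    show "m \<circ> f0 holomorphic_on outer_chart"
      using f0 by (intro holomorphic_on_compose_gen[OF f0(1) m(2)]) blast
    show "k0 \<circ> n holomorphic_on ball 0 1"
      using m by (intro holomorphic_on_compose_gen[OF m(4) f0(2)]) blast
    show "(m \<circ> f0) w \<in> ball 0 1 \<and> (k0 \<circ> n) ((m \<circ> f0) w) = w" if "w \<in> outer_chart" for w
    proof -
      have "f0 w \<in> ball 0 1" "k0 (f0 w) = w" using f0(3)[OF that] by auto
      moreover from this have "m (f0 w) \<in> ball 0 1" using m(3) by blast
      ultimately show ?thesis using m(7) by simp
    qed
    show "(k0 \<circ> n) u \<in> outer_chart \<and> (m \<circ> f0) ((k0 \<circ> n) u) = u" if "u \<in> ball 0 1" for u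
    proof -
      have "n u \<in> ball 0 1" using m(5) that by blast
      then show ?thesis using f0(4)[of "n u"] m(6)[OF that] by auto
    qed
  qed (simp add: m(1))
qed

text \<open>The poles 1 and -1/2 of \<open>Ghat\<close> correspond to the non-escaping points 1 and
  -2, and its zero 3/2 to the pole of \<open>G\<close>, which lies inside the loop. Only the double
  zero at 0 remains in the chart.\<close>

lemma Ghat_outer_chart:
  assumes "w \<in> outer_chart"
  shows "1 - 3 * w\<^sup>2 + 2 * w ^ 3 \<noteq> 0" "3 / 2 - w \<noteq> 0" "Ghat w \<in> outer_chart"
proof -
  have out: "1 / w \<in> outer" if "w \<noteq> 0"
    using assms that by (simp add: outer_chart_def)
  have "w \<noteq> 1"
    using out critical_cycle_in_filled(3) outer_subset by auto
  moreover have "1 + 2 * w \<noteq> 0"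
  proof
    assume "1 + 2 * w = 0"
    then have "w = - 1 / 2"
      by (simp add: add_eq_0_iff field_simps)
    then show False
      using out critical_cycle_in_filled(2) outer_subset by auto
  qed
  ultimately show "1 - 3 * w\<^sup>2 + 2 * w ^ 3 \<noteq> 0"
    by (simp add: Ghat_denom)
  show "3 / 2 - w \<noteq> 0"
  proof
    assume "3 / 2 - w = 0"
    then have "w = 3 / 2" by simp
    moreover have "1 / (3 / 2) = (2 / 3 :: complex)" "(3 / 2 :: complex) \<noteq> 0" by simp_all
    ultimately show False
      using out pole_notin_outer by metis
  qed
  show "Ghat w \<in> outer_chart"
  proof (cases "w = 0")
    case False
    have "1 / Ghat w = G (1 / w)"
      using inverse_G[OF False] by (metis div_by_1 divide_divide_eq_right mult_1)
    then show ?thesis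
      using G_outer[OF out[OF False]] by (simp add: outer_chart_def)
  qed (simp add: Ghat_def outer_chart_def)
qed

lemma Ghat_holomorphic: "Ghat holomorphic_on outer_chart"
  unfolding Ghat_def using Ghat_outer_chart(1) by (intro holomorphic_intros)

text \<open>Properness: \<open>G\<close> maps the frontier of \<open>outer\<close> into itself, so
  images of points tending to that frontier cannot stay in a compact part of the domain.\<close>

lemma compact_Ghat_preimage:
  assumes L: "compact L" "L \<subseteq> outer_chart"
  shows "compact {w \<in> outer_chart. Ghat w \<in> L}"
proof -
  have "closed {w \<in> outer_chart. Ghat w \<in> L}"
    unfolding closed_sequential_limits
  proof (intro allI impI, elim conjE)
    fix x l assume x: "\<forall>n. x n \<in> {w \<in> outer_chart. Ghat w \<in> L}" and lim: "x \<longlonglongrightarrow> l"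
    have "l \<in> outer_chart"
    proof (rule ccontr)
      assume l: "l \<notin> outer_chart"
      then have l0: "l \<noteq> 0" by (auto simp: outer_chart_def)
      have xl: "(\<lambda>n. 1 / x n) \<longlonglongrightarrow> 1 / l"
        using lim l0 by (intro tendsto_intros)
      have ev: "\<forall>\<^sub>F n in sequentially. x n \<noteq> 0"
        using lim l0 by (rule tendsto_imp_eventually_ne)
      then obtain N where N: "\<And>n. n \<ge> N \<Longrightarrow> x n \<noteq> 0"
        by (auto simp: eventually_sequentially)
      have "1 / x (n + N) \<in> outer" for n
        using x N[of "n + N"] by (auto simp: outer_chart_def)
      then have "1 / l \<in> closure outer"
        unfolding closure_sequential using LIMSEQ_ignore_initial_segment[OF xl, of N]
        by (intro exI[of _ "\<lambda>n. 1 / x (n + N)"]) auto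
      then have fr: "1 / l \<in> frontier outer"
        using l l0 open_outer by (auto simp: frontier_def interior_open outer_chart_def)
      obtain m r where m: "m \<in> L" "strict_mono (r :: nat \<Rightarrow> nat)" "((\<lambda>n. Ghat (x n)) \<circ> r) \<longlonglongrightarrow> m"
        using L(1)[unfolded compact_def, rule_format, of "\<lambda>n. Ghat (x n)"] x by auto
      have "(\<lambda>n. G (1 / x n)) \<longlonglongrightarrow> G (1 / l)"
        using isCont_tendsto_compose[OF isCont_G xl] G_frontier_outer(1)[OF fr] by blast
      then have "((\<lambda>n. G (1 / x n)) \<circ> r) \<longlonglongrightarrow> G (1 / l)"
        by (rule LIMSEQ_subseq_LIMSEQ[OF _ m(2)])
      \<comment> \<open>\<open>G (1 / x)\<close> and \<open>Ghat x\<close> are reciprocal. Passing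
        to the limit in their product, rather than in a quotient, also rules out m = 0.\<close>
      then have "(\<lambda>n. G (1 / x (r n)) * Ghat (x (r n))) \<longlonglongrightarrow> G (1 / l) * m"
        using m(3) by (auto simp: o_def intro: tendsto_mult)
      moreover have "\<forall>\<^sub>F n in sequentially. G (1 / x (r n)) * Ghat (x (r n)) = 1"
      proof -
        have "\<forall>\<^sub>F n in sequentially. x (r n) \<noteq> 0"
          using ev filterlim_subseq[OF m(2)] by (rule eventually_compose_filterlim)
        then show ?thesis
        proof eventually_elim
          case (elim n)
          have "1 / x (r n) \<in> outer"
            using x elim by (auto simp: outer_chart_def)
          then have "G (1 / x (r n)) \<noteq> 0"
            using G_outer zero_notin_outer by metis
          then show ?case
            using inverse_G[OF elim] by (simp add: field_simps)
        qed
      qed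
      then have "(\<lambda>n. G (1 / x (r n)) * Ghat (x (r n))) \<longlonglongrightarrow> 1"
        by (rule tendsto_eventually)
      ultimately have "G (1 / l) * m = 1"
        by (rule LIMSEQ_unique)
      then have "m \<noteq> 0" "G (1 / l) = 1 / m"
        by (auto simp: eq_divide_eq)
      then have "G (1 / l) \<in> outer"
        using m(1) L(2) by (auto simp: outer_chart_def)
      then show False
        using G_frontier_outer(2)[OF fr] frontier_outer_subset outer_subset by blast
    qed
    moreover have "Ghat l \<in> L"
    proof -
      have "isCont Ghat l"
        using Ghat_holomorphic open_outer_chart \<open>l \<in> outer_chart\<close>
        by (metis continuous_on_eq_continuous_at holomorphic_on_imp_continuous_on)
      then have "(\<lambda>n. Ghat (x n)) \<longlonglongrightarrow> Ghat l"
        using lim by (rule isCont_tendsto_compose)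
      then show ?thesis
        using x compact_imp_closed[OF L(1)] by (auto intro: closed_sequentially)
    qed
    ultimately show "l \<in> {w \<in> outer_chart. Ghat w \<in> L}" by blast
  qed
  moreover have "bounded {w \<in> outer_chart. Ghat w \<in> L}"
    unfolding bounded_iff using outer_chart_bounded by blast
  ultimately show ?thesis
    by (simp add: compact_eq_bounded_closed)
qed

text \<open>After splitting off the simple zeros of \<open>f\<close> and \<open>k\<close> at 0 and
  the double zero of \<open>Ghat\<close>, the conjugated map is u^2 times a zero-free function.
  Since it is proper, that function is a unimodular constant.\<close>

lemma Riemann_map_conjugates_Ghat:
  obtains f k c where "f holomorphic_on outer_chart" "k holomorphic_on ball 0 1"
    "\<And>w. w \<in> outer_chart \<Longrightarrow> f w \<in> ball 0 1 \<and> k (f w) = w"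
    "\<And>u. u \<in> ball 0 1 \<Longrightarrow> k u \<in> outer_chart \<and> f (k u) = u" "f 0 = 0"
    "cmod c = 1" "\<And>w. w \<in> outer_chart \<Longrightarrow> f (Ghat w) = c * (f w)\<^sup>2"
proof -
  obtain f k where f: "f holomorphic_on outer_chart" and k: "k holomorphic_on ball 0 1"
    and fk: "\<And>w. w \<in> outer_chart \<Longrightarrow> f w \<in> ball 0 1 \<and> k (f w) = w"
    and kf: "\<And>u. u \<in> ball 0 1 \<Longrightarrow> k u \<in> outer_chart \<and> f (k u) = u" and f0: "f 0 = 0"
    using Riemann_map_outer_chart by blast
  have k0: "k 0 = 0"
    using fk[OF zero_in_outer_chart] f0 by simp
  \<comment> \<open>Removable singularities; the values at 0 are nonzero because injective
    holomorphic maps have nonvanishing derivative.\<close>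
  define F where "F w = (if w = 0 then deriv f 0 else f w / w)" for w
  define \<kappa> where "\<kappa> u = (if u = 0 then deriv k 0 else k u / u)" for u
  have F: "F holomorphic_on outer_chart"
    by (rule pole_theorem_open_0[OF f open_outer_chart, of 0]) (auto simp: F_def f0)
  have \<kappa>: "\<kappa> holomorphic_on ball 0 1"
    by (rule pole_theorem_open_0[OF k open_ball, of 0]) (auto simp: \<kappa>_def k0)
  have fF: "f w = w * F w" for w
    by (simp add: F_def f0)
  have k\<kappa>: "k u = u * \<kappa> u" for u
    by (simp add: \<kappa>_def k0)
  have "inj_on f outer_chart"
    using fk by (metis inj_onI)
  then have "deriv f 0 \<noteq> 0"
    using holomorphic_injective_imp_regular[OF f open_outer_chart _ zero_in_outer_chart] by blast
  then have Fnz: "F w \<noteq> 0" if "w \<in> outer_chart" for w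
    using fk[OF that] fk[OF zero_in_outer_chart] f0 by (auto simp: F_def)
  have "inj_on k (ball 0 1)"
    using kf by (metis inj_onI)
  then have "deriv k 0 \<noteq> 0"
    using holomorphic_injective_imp_regular[OF k open_ball] by simp
  then have \<kappa>nz: "\<kappa> u \<noteq> 0" if "u \<in> ball 0 1" for u
    using kf[OF that] kf[of 0] k0 by (auto simp: \<kappa>_def)
  \<comment> \<open>Collects the factors from \<open>f w = w * F w\<close>, the explicit form of
    \<open>Ghat\<close> and \<open>k u = u * \<kappa> u\<close>, so that exactly u^2 is left
    over.\<close>
  define q where "q u = F (Ghat (k u)) * ((3 / 2 - k u) / (1 - 3 * (k u)\<^sup>2 + 2 * k u ^ 3)) * (\<kappa> u)\<^sup>2" for u
  have hq: "f (Ghat (k u)) = u\<^sup>2 * q u" for u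
  proof -
    define R where "R = (3 / 2 - k u) / (1 - 3 * (k u)\<^sup>2 + 2 * k u ^ 3)"
    have "(k u)\<^sup>2 = u\<^sup>2 * (\<kappa> u)\<^sup>2"
      by (subst k\<kappa>) (rule power_mult_distrib)
    moreover have "Ghat (k u) = (k u)\<^sup>2 * R"
      by (simp add: Ghat_def R_def)
    ultimately have "Ghat (k u) = u\<^sup>2 * (\<kappa> u)\<^sup>2 * R"
      by simp
    moreover have "q u = F (Ghat (k u)) * R * (\<kappa> u)\<^sup>2"
      by (simp add: q_def R_def)
    ultimately show ?thesis
      using fF[of "Ghat (k u)"] by (simp add: mult_ac)
  qed
  have "\<exists>c. cmod c = 1 \<and> (\<forall>u\<in>ball 0 1. q u = c)"
  proof (rule proper_disc_map_unimodular_factor[of q])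
    have "(\<lambda>u. F (Ghat (k u))) holomorphic_on ball 0 1"
    proof -
      have "Ghat \<circ> k holomorphic_on ball 0 1"
        using kf by (intro holomorphic_on_compose_gen[OF k Ghat_holomorphic]) auto
      then have "F \<circ> (Ghat \<circ> k) holomorphic_on ball 0 1"
        using kf Ghat_outer_chart(3) by (intro holomorphic_on_compose_gen[OF _ F]) auto
      then show ?thesis by (simp add: o_def)
    qed
    then show "q holomorphic_on ball 0 1"
      unfolding q_def using kf Ghat_outer_chart(1) by (intro holomorphic_intros k \<kappa>) blast+
    show "q u \<noteq> 0" if "u \<in> ball 0 1" for u
      using Fnz \<kappa>nz[OF that] kf[OF that] Ghat_outer_chart[of "k u"] by (simp add: q_def)
    show "cmod (u\<^sup>2 * q u) < 1" if "u \<in> ball 0 1" for u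
      using fk[OF Ghat_outer_chart(3)] kf[OF that] by (simp flip: hq)
    show "\<exists>s<1. \<forall>u\<in>ball 0 1. cmod (u\<^sup>2 * q u) \<le> r \<longrightarrow> cmod u \<le> s" if r: "r < 1" for r
    proof -
      define L where "L = k ` cball 0 r"
      have sub: "cball 0 r \<subseteq> ball (0::complex) 1" using r by auto
      have "compact L"
        unfolding L_def using holomorphic_on_imp_continuous_on[OF k] sub
        by (intro compact_continuous_image) (auto intro: continuous_on_subset)
      moreover have "L \<subseteq> outer_chart"
        using sub kf by (auto simp: L_def)
      ultimately have "compact {w \<in> outer_chart. Ghat w \<in> L}"
        by (rule compact_Ghat_preimage)
      then have "compact (f ` {w \<in> outer_chart. Ghat w \<in> L})"
        using holomorphic_on_imp_continuous_on[OF f] by (intro compact_continuous_image) (auto intro: continuous_on_subset)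
      \<comment> \<open>Inserting 0 makes the set nonempty, so that the modulus attains a maximum on
        it.\<close>
      moreover define E where "E = insert 0 (f ` {w \<in> outer_chart. Ghat w \<in> L})"
      ultimately have "compact E" by simp
      have E1: "E \<subseteq> ball 0 1"
        using fk by (auto simp: E_def)
      have "\<exists>x\<in>E. \<forall>y\<in>E. cmod y \<le> cmod x"
        using \<open>compact E\<close> by (intro continuous_attains_sup continuous_intros) (auto simp: E_def)
      then obtain x where x: "x \<in> E" "\<And>y. y \<in> E \<Longrightarrow> cmod y \<le> cmod x" by blast
      have "cmod u \<le> cmod x" if u: "u \<in> ball 0 1" "cmod (u\<^sup>2 * q u) \<le> r" for u
      proof -
        have ku: "k u \<in> outer_chart" "f (k u) = u" using kf[OF u(1)] by auto
        have "Ghat (k u) = k (f (Ghat (k u)))"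
          using fk[OF Ghat_outer_chart(3)[OF ku(1)]] by simp
        moreover have "f (Ghat (k u)) \<in> cball 0 r"
          using u(2) by (simp add: hq)
        ultimately have "Ghat (k u) \<in> L"
          unfolding L_def by blast
        then have "f (k u) \<in> f ` {w \<in> outer_chart. Ghat w \<in> L}"
          using ku(1) by blast
        then have "u \<in> E"
          unfolding E_def using ku(2) by simp
        then show ?thesis by (rule x(2))
      qed
      moreover have "cmod x < 1" using x(1) E1 by auto
      ultimately show ?thesis by blast
    qed
  qed blast
  then obtain c where c: "cmod c = 1" "\<And>u. u \<in> ball 0 1 \<Longrightarrow> q u = c"
    by blast
  show thesis
  proof (rule that[OF f k fk kf f0 c(1)])
    fix w assume w: "w \<in> outer_chart"
    then show "f (Ghat w) = c * (f w)\<^sup>2"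
      using hq[of "f w"] fk[OF w] c(2)[of "f w"] by simp
  qed
qed

section \<open>Conjugacy with squaring, and its consequences on the sphere\<close>

lemma coord_image_outer: "coord Infty ` insert Infty (Fin ` outer) \<subseteq> outer_chart"
  using zero_notin_outer by (auto simp: outer_chart_def)

lemma param_outer_chart: "w \<in> outer_chart \<Longrightarrow> param Infty w \<in> insert Infty (Fin ` outer)"
  by (auto simp: outer_chart_def)

lemma outer_conformally_conjugate:
  "conformally_conjugate gmap (insert Infty (Fin ` outer)) (poly_map (monom 1 2)) (Fin ` ball 0 1)"
proof -
  let ?\<Omega> = "insert Infty (Fin ` outer)"
  obtain f k c where f: "f holomorphic_on outer_chart" and k: "k holomorphic_on ball 0 1"
    and fk: "\<And>w. w \<in> outer_chart \<Longrightarrow> f w \<in> ball 0 1 \<and> k (f w) = w"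
    and kf: "\<And>u. u \<in> ball 0 1 \<Longrightarrow> k u \<in> outer_chart \<and> f (k u) = u"
    and c: "cmod c = 1" and conj: "\<And>w. w \<in> outer_chart \<Longrightarrow> f (Ghat w) = c * (f w)\<^sup>2"
    using Riemann_map_conjugates_Ghat by metis
  have c0: "c \<noteq> 0" using c by auto
  \<comment> \<open>The rotation by \<open>c\<close> turns c z^2 into z^2, because c (c f^2) = (c
    f)^2.\<close>
  define \<phi> where "\<phi> x = Fin (c * f (coord Infty x))" for x
  define \<psi> where "\<psi> x = (case x of Fin u \<Rightarrow> param Infty (k (u / c)) | Infty \<Rightarrow> Infty)" for x
  have \<psi>: "\<psi> (Fin u) = param Infty (k (u / c))" for u
    by (simp add: \<psi>_def)
  have div: "u / c \<in> ball 0 1" if "u \<in> ball 0 1" for u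
    using that c by (simp add: norm_divide)
  have open\<Omega>: "open ?\<Omega>"
    using frontier_insert_Infty(1)[OF open_outer large_subset_outer] .
  have hol\<phi>: "sphere_holomorphic_on \<phi> ?\<Omega>"
    unfolding \<phi>_def
  proof (rule sphere_holomorphic_on_from_chart[OF open\<Omega> _ open_outer_chart _ coord_image_outer])
    show "(\<lambda>w. c * f w) holomorphic_on outer_chart"
      by (intro holomorphic_intros f)
  qed (use zero_notin_outer in auto)
  have hol\<psi>: "sphere_holomorphic_on \<psi> (Fin ` ball 0 1)"
  proof (rule sphere_holomorphic_on_into_chart[of _ "\<lambda>u. k (u / c)"])
    have "k \<circ> (\<lambda>u. u / c) holomorphic_on ball 0 1"
      using c0 div by (intro holomorphic_on_compose_gen[OF _ k] holomorphic_intros) auto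
    then show "(\<lambda>u. k (u / c)) holomorphic_on ball 0 1"
      by (simp add: o_def)
  qed (simp_all only: \<psi> open_ball)
  have \<phi>in: "\<phi> x \<in> Fin ` ball 0 1" and \<psi>\<phi>: "\<psi> (\<phi> x) = x" if x: "x \<in> ?\<Omega>" for x
  proof -
    have w: "coord Infty x \<in> outer_chart" using coord_image_outer x by blast
    show "\<phi> x \<in> Fin ` ball 0 1"
      unfolding \<phi>_def using fk[OF w] c by (intro imageI) (simp add: norm_mult)
    have "x \<noteq> Fin 0" using x zero_notin_outer by auto
    then show "\<psi> (\<phi> x) = x"
      unfolding \<phi>_def \<psi> using fk[OF w] c0 by (simp add: param_coord_Infty del: param.simps)
  qed
  have \<psi>in: "\<psi> y \<in> ?\<Omega>" and \<phi>\<psi>: "\<phi> (\<psi> y) = y" if y: "y \<in> Fin ` ball 0 1" for y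
  proof -
    obtain u where u: "y = Fin u" "u \<in> ball 0 1" using y by blast
    show "\<psi> y \<in> ?\<Omega>"
      unfolding u(1) \<psi> using kf[OF div[OF u(2)]] by (intro param_outer_chart) blast
    show "\<phi> (\<psi> y) = y"
      unfolding u(1) \<psi> \<phi>_def coord_param_Infty using kf[OF div[OF u(2)]] c0 by simp
  qed
  have "conformal_iso ?\<Omega> (Fin ` ball 0 1) \<phi> \<psi>"
    unfolding conformal_iso_def
  proof (intro conjI ballI)
    show "\<phi> ` ?\<Omega> = Fin ` ball 0 1"
    proof (intro equalityI subsetI)
      fix y assume "y \<in> Fin ` ball 0 1"
      then have "y = \<phi> (\<psi> y)" "\<psi> y \<in> ?\<Omega>" using \<psi>in \<phi>\<psi> by auto
      then show "y \<in> \<phi> ` ?\<Omega>" by (rule image_eqI)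
    qed (use \<phi>in in blast)
    show "\<psi> ` Fin ` ball 0 1 = ?\<Omega>"
    proof (intro equalityI subsetI)
      fix x assume "x \<in> ?\<Omega>"
      then have "x = \<psi> (\<phi> x)" "\<phi> x \<in> Fin ` ball 0 1" using \<phi>in \<psi>\<phi> by auto
      then show "x \<in> \<psi> ` Fin ` ball 0 1" by (rule image_eqI)
    qed (use \<psi>in in blast)
  qed (use hol\<phi> hol\<psi> \<psi>\<phi> \<phi>\<psi> in blast)+
  moreover have "\<phi> (gmap x) = poly_map (monom 1 2) (\<phi> x)" if x: "x \<in> ?\<Omega>" for x
  proof -
    define w where "w = coord Infty x"
    have w: "w \<in> outer_chart" using coord_image_outer x unfolding w_def by blast
    have "x \<noteq> Fin 0" using x zero_notin_outer by auto
    then have "x = param Infty w"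
      unfolding w_def by (rule param_coord_Infty[symmetric])
    then have "gmap x = param Infty (Ghat w)"
      using gmap_param_Infty[OF Ghat_outer_chart(1)[OF w]] by metis
    then have "\<phi> (gmap x) = Fin (c * f (Ghat w))"
      unfolding \<phi>_def by (simp only: coord_param_Infty)
    also have "\<dots> = poly_map (monom 1 2) (\<phi> x)"
      unfolding \<phi>_def w_def[symmetric] poly_map_def rat_map.simps conj[OF w]
      by (simp add: poly_monom power2_eq_square)
    finally show ?thesis .
  qed
  ultimately show ?thesis
    unfolding conformally_conjugate_def by blast
qed

lemma gmap_outer:
  assumes "x \<in> insert Infty (Fin ` outer)"
  shows "gmap x \<in> insert Infty (Fin ` outer)"
proof (cases x)
  case (Fin z)
  then have "z \<in> outer" using assms by auto
  moreover from this have "z \<noteq> 2 / 3" using pole_notin_outer by metis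
  ultimately show ?thesis
    using G_outer by (simp add: Fin gmap_Fin)
qed (simp add: gmap_Infty)

text \<open>Surjectivity is carried over from squaring, under which every point of the disc has a
  root in the disc.\<close>

lemma gmap_image_outer: "gmap ` insert Infty (Fin ` outer) = insert Infty (Fin ` outer)"
proof
  show "gmap ` insert Infty (Fin ` outer) \<subseteq> insert Infty (Fin ` outer)"
    using gmap_outer by blast
  obtain \<phi> \<psi> where iso: "conformal_iso (insert Infty (Fin ` outer)) (Fin ` ball 0 1) \<phi> \<psi>"
    and conj: "\<And>x. x \<in> insert Infty (Fin ` outer) \<Longrightarrow> \<phi> (gmap x) = poly_map (monom 1 2) (\<phi> x)"
    using outer_conformally_conjugate unfolding conformally_conjugate_def by blast
  show "insert Infty (Fin ` outer) \<subseteq> gmap ` insert Infty (Fin ` outer)"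
  proof
    fix y assume y: "y \<in> insert Infty (Fin ` outer)"
    then obtain v where v: "\<phi> y = Fin v" "v \<in> ball 0 1"
      using iso unfolding conformal_iso_def by blast
    define x where "x = \<psi> (Fin (csqrt v))"
    have "(cmod (csqrt v))\<^sup>2 < 1"
      using v(2) by (simp flip: norm_power)
    then have s: "Fin (csqrt v) \<in> Fin ` ball 0 1"
      by (simp add: abs_square_less_1)
    then have x: "x \<in> insert Infty (Fin ` outer)" "\<phi> x = Fin (csqrt v)"
      using iso unfolding conformal_iso_def x_def by blast+
    have "\<phi> (gmap x) = \<phi> y"
      using conj[OF x(1)] by (simp add: x(2) v(1) poly_map_def poly_monom)
    moreover have "gmap x \<in> insert Infty (Fin ` outer)"
      using x(1) by (rule gmap_outer)
    ultimately have "gmap x = y"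
      using iso y unfolding conformal_iso_def by metis
    then show "y \<in> gmap ` insert Infty (Fin ` outer)"
      using x(1) by blast
  qed
qed

text \<open>They come from the two square roots of f(1/y) / c, which differ since y is finite and
  only infinity goes to the centre of the disc.\<close>

lemma two_preimages_in_outer:
  assumes "y \<in> outer"
  obtains a b where "a \<in> outer" "b \<in> outer" "a \<noteq> b" "G a = y" "G b = y"
proof -
  obtain f k c where fk: "\<And>w. w \<in> outer_chart \<Longrightarrow> f w \<in> ball 0 1 \<and> k (f w) = w"
    and kf: "\<And>u. u \<in> ball 0 1 \<Longrightarrow> k u \<in> outer_chart \<and> f (k u) = u" and f0: "f 0 = 0"
    and c: "cmod c = 1" and conj: "\<And>w. w \<in> outer_chart \<Longrightarrow> f (Ghat w) = c * (f w)\<^sup>2"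
    using Riemann_map_conjugates_Ghat by metis
  have y0: "y \<noteq> 0" using assms zero_notin_outer by auto
  have w: "1 / y \<in> outer_chart" using assms by (simp add: outer_chart_def)
  define s where "s = csqrt (f (1 / y) / c)"
  have c0: "c \<noteq> 0" using c by auto
  have s2: "c * s\<^sup>2 = f (1 / y)" using c0 by (simp add: s_def)
  have fy0: "f (1 / y) \<noteq> 0"
  proof
    assume "f (1 / y) = 0"
    then have "1 / y = k 0" using fk[OF w] by metis
    also have "k 0 = 0" using fk[OF zero_in_outer_chart] f0 by simp
    finally show False using y0 by simp
  qed
  have pre: "1 / k t \<in> outer \<and> G (1 / k t) = y" if t: "c * t\<^sup>2 = f (1 / y)" for t
  proof -
    have "(cmod t)\<^sup>2 = cmod (f (1 / y))"
      using arg_cong[OF t, of cmod] c by (simp add: norm_mult norm_power)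
    then have "(cmod t)\<^sup>2 < 1" using fk[OF w] by simp
    then have tb: "t \<in> ball 0 1" by (simp add: abs_square_less_1)
    have kt: "k t \<in> outer_chart" "f (k t) = t" using kf[OF tb] by auto
    have "t \<noteq> 0" using t fy0 by auto
    then have kt0: "k t \<noteq> 0" using kt(2) f0 by auto
    have "f (Ghat (k t)) = f (1 / y)" using conj[OF kt(1)] kt(2) t by simp
    then have "Ghat (k t) = 1 / y"
      using fk[OF w] fk[OF Ghat_outer_chart(3)[OF kt(1)]] by metis
    then have "1 / G (1 / k t) = 1 / y" using inverse_G[OF kt0] by simp
    then have "G (1 / k t) = y" by (metis div_by_1 divide_divide_eq_right mult_1)
    then show ?thesis using kt(1) kt0 by (simp add: outer_chart_def)
  qed
  have neg: "c * (- s)\<^sup>2 = f (1 / y)" using s2 by simp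
  have "1 / k s \<noteq> 1 / k (- s)"
  proof
    assume "1 / k s = 1 / k (- s)"
    then have "k s = k (- s)" by (metis div_by_1 divide_divide_eq_right mult_1)
    moreover have "(cmod s)\<^sup>2 < 1"
      using arg_cong[OF s2, of cmod] c fk[OF w] by (simp add: norm_mult norm_power)
    then have "s \<in> ball 0 1" "- s \<in> ball 0 1" by (simp_all add: abs_square_less_1)
    ultimately have "s = - s" using kf by metis
    then have "s = 0" by simp
    then show False using s2 fy0 by simp
  qed
  then show thesis
    using that pre[OF s2] pre[OF neg] by blast
qed

section \<open>Three preimages in the boundary\<close>

text \<open>A root of \<open>cofactor\<close>: the conjugate pair has sum -alpha and product -2 - 2
  alpha, and the radicand uses alpha^2 = 1 - alpha/2.\<close>

definition gamma :: complex where
  "gamma = Complex (- alpha / 2) (sqrt (- 9 / 4 - 15 / 8 * alpha))"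

lemma gamma_Im_pos: "0 < Im gamma"
  using alpha_bounds(2) by (simp add: gamma_def)

lemma cofactor_eq_0_iff: "cofactor z = 0 \<longleftrightarrow> z = gamma \<or> z = cnj gamma"
proof -
  have norm: "(cmod gamma)\<^sup>2 = - 2 - 2 * alpha"
    using alpha_bounds(2) alpha_sq unfolding cmod_power2 by (simp add: gamma_def power_divide field_simps)
  have "(z - gamma) * (z - cnj gamma) = z\<^sup>2 - (gamma + cnj gamma) * z + gamma * cnj gamma"
    by (simp add: power2_eq_square algebra_simps)
  also have "gamma + cnj gamma = - of_real alpha"
    by (simp add: gamma_def complex_eq_iff)
  also have "gamma * cnj gamma = of_real (- 2 - 2 * alpha)"
    by (simp flip: norm complex_norm_square)
  finally have "(z - gamma) * (z - cnj gamma) = cofactor z"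
    by (simp add: cofactor_def algebra_simps)
  then show ?thesis
    by (metis eq_iff_diff_eq_0 mult_eq_0_iff)
qed

lemma G_eq_alpha_iff:
  assumes "z \<noteq> 2 / 3"
  shows "G z = of_real alpha \<longleftrightarrow> z = of_real alpha \<or> z = gamma \<or> z = cnj gamma"
proof -
  have d: "3 / 2 * z - 1 \<noteq> 0" using assms denom_eq_0_iff by blast
  have "G z = of_real alpha \<longleftrightarrow> (z - of_real alpha) * cofactor z / (3 / 2 * z - 1) = 0"
    unfolding G_minus_alpha[OF assms, symmetric] by simp
  also have "\<dots> \<longleftrightarrow> z = of_real alpha \<or> cofactor z = 0"
    using d by (simp only: divide_eq_0_iff mult_eq_0_iff right_minus_eq) blast
  finally show ?thesis by (simp add: cofactor_eq_0_iff)
qed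

lemma gamma_ne_pole: "gamma \<noteq> 2 / 3" "cnj gamma \<noteq> 2 / 3"
proof -
  have "Im (2 / 3) = 0" by simp
  then show "gamma \<noteq> 2 / 3" "cnj gamma \<noteq> 2 / 3"
    using gamma_Im_pos by (metis less_irrefl, metis complex_cnj neg_0_equal_iff_equal complex_cnj_cnj cnj.simps(2) less_irrefl)
qed

lemma closure_outer_ne_pole: "z \<in> closure outer \<Longrightarrow> z \<noteq> 2 / 3"
  using closure_outer_loop_inside pole_in_loop_inside by blast

lemma gamma_in_closure_outer: "gamma \<in> closure outer"
proof -
  have "of_real alpha \<in> closure outer"
    using alpha_in_frontier frontier_outer_iff by blast
  then obtain y where y: "\<And>n. y n \<in> outer" "y \<longlonglongrightarrow> of_real alpha"
    by (auto simp: closure_sequential)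
  have "\<forall>n. \<exists>a b. a \<in> outer \<and> b \<in> outer \<and> a \<noteq> b \<and> G a = y n \<and> G b = y n"
    using two_preimages_in_outer[OF y(1)] by metis
  then obtain a b where ab: "\<And>n. a n \<in> outer" "\<And>n. b n \<in> outer" "\<And>n. a n \<noteq> b n"
      "\<And>n. G (a n) = y n" "\<And>n. G (b n) = y n"
    by metis
  obtain M where M: "\<And>n. cmod (y n) \<le> M"
    using convergent_imp_Bseq[OF convergentI[OF y(2)]] by (auto simp: Bseq_def)
  have bd: "bounded (range x)" if "\<And>n. G (x n) = y n" for x
    unfolding bounded_iff
  proof (intro exI ballI)
    fix v assume "v \<in> range x"
    then obtain n where n: "v = x n" by blast
    show "cmod v \<le> max 6 M"
    proof (cases "6 < cmod v")
      case True
      then have "3 / 2 * cmod v \<le> M"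
        using G_expands[OF True] M[of n] that[of n] n by simp
      then show ?thesis using norm_ge_zero[of v] by linarith
    qed simp
  qed
  obtain a' r where r: "strict_mono (r :: nat \<Rightarrow> nat)" "(a \<circ> r) \<longlonglongrightarrow> a'"
    using bounded_imp_convergent_subsequence[OF bd[OF ab(4)]] by blast
  have "bounded (range (b \<circ> r))"
    by (rule bounded_subset[OF bd[OF ab(5)]]) auto
  then obtain b' t where t: "strict_mono (t :: nat \<Rightarrow> nat)" "((b \<circ> r) \<circ> t) \<longlonglongrightarrow> b'"
    using bounded_imp_convergent_subsequence by blast
  define p where "p = r \<circ> t"
  have p: "(\<lambda>n. a (p n)) \<longlonglongrightarrow> a'" "(\<lambda>n. b (p n)) \<longlonglongrightarrow> b'" "(\<lambda>n. y (p n)) \<longlonglongrightarrow> of_real alpha"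
    using LIMSEQ_subseq_LIMSEQ[OF r(2) t(1)] t(2) LIMSEQ_subseq_LIMSEQ[OF y(2) strict_mono_o[OF r(1) t(1)]]
    by (simp_all add: p_def o_def)
  have cl: "a' \<in> closure outer" "b' \<in> closure outer"
    unfolding closure_sequential using p(1,2) ab(1,2)
    by (intro exI[of _ "\<lambda>n. a (p n)"] exI[of _ "\<lambda>n. b (p n)"] conjI allI; blast)+
  have lim: "G x' = of_real alpha"
    if "(\<lambda>n. x (p n)) \<longlonglongrightarrow> x'" "x' \<in> closure outer" "\<And>n. G (x n) = y n" for x x'
  proof -
    have "(\<lambda>n. G (x (p n))) \<longlonglongrightarrow> G x'"
      by (rule isCont_tendsto_compose[OF isCont_G[OF closure_outer_ne_pole[OF that(2)]] that(1)])
    then show ?thesis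
      using p(3) by (simp add: that(3) LIMSEQ_unique)
  qed
  have "a' = of_real alpha \<or> a' = gamma \<or> a' = cnj gamma" "b' = of_real alpha \<or> b' = gamma \<or> b' = cnj gamma"
    using lim[OF p(1) cl(1) ab(4)] lim[OF p(2) cl(2) ab(5)] G_eq_alpha_iff[OF closure_outer_ne_pole] cl by blast+
  moreover have "\<not> (a' = of_real alpha \<and> b' = of_real alpha)"
  proof
    assume eq: "a' = of_real alpha \<and> b' = of_real alpha"
    \<comment> \<open>The divided difference of z^3 - 3z + 2 - y (3/2 z - 1) at its two distinct
      roots. If both tended to alpha, the limit would make alpha a double root for y = alpha; but
      the limit value is -3 alpha, not 0.\<close>
    have "(a n)\<^sup>2 + a n * b n + (b n)\<^sup>2 - 3 - 3 / 2 * y n = 0" for n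
    proof -
      have "a n \<noteq> 2 / 3" "b n \<noteq> 2 / 3"
        using ab(1,2) pole_notin_outer by metis+
      then have e: "a n ^ 3 - 3 * a n + 2 = y n * (3 / 2 * a n - 1)" "b n ^ 3 - 3 * b n + 2 = y n * (3 / 2 * b n - 1)"
        using G_eq_iff ab(4,5) by blast+
      have "(a n - b n) * ((a n)\<^sup>2 + a n * b n + (b n)\<^sup>2 - 3 - 3 / 2 * y n) =
          (a n ^ 3 - 3 * a n + 2 - y n * (3 / 2 * a n - 1)) - (b n ^ 3 - 3 * b n + 2 - y n * (3 / 2 * b n - 1))"
        by (simp add: power2_eq_square power3_eq_cube field_simps)
      also have "\<dots> = 0" using e by simp
      finally show ?thesis using ab(3)[of n] by simp
    qed
    moreover have "(\<lambda>n. (a (p n))\<^sup>2 + a (p n) * b (p n) + (b (p n))\<^sup>2 - 3 - 3 / 2 * y (p n)) \<longlonglongrightarrow>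
        a'\<^sup>2 + a' * b' + b'\<^sup>2 - 3 - 3 / 2 * of_real alpha"
      by (intro tendsto_intros p)
    ultimately have "a'\<^sup>2 + a' * b' + b'\<^sup>2 - 3 - 3 / 2 * of_real alpha = 0"
      by (simp only: LIMSEQ_const_iff)
    then have "complex_of_real (3 * alpha\<^sup>2 - 3 - 3 / 2 * alpha) = 0"
      by (simp add: eq power2_eq_square)
    then have "3 * alpha\<^sup>2 - 3 - 3 / 2 * alpha = 0"
      by (simp only: of_real_eq_0_iff)
    then show False
      using alpha_sq alpha_bounds(2) by simp
  qed
  ultimately have "gamma \<in> closure outer \<or> cnj gamma \<in> closure outer"
    using cl by blast
  then show ?thesis
    using cnj_closure_outer by fastforce
qed

lemma gamma_in_frontier: "gamma \<in> frontier outer" "cnj gamma \<in> frontier outer"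
proof -
  have "gamma \<in> filled" "cnj gamma \<in> filled"
    using G_eq_alpha_iff alpha_in_filled gamma_ne_pole by (metis filled_iff)+
  then show "gamma \<in> frontier outer" "cnj gamma \<in> frontier outer"
    using gamma_in_closure_outer cnj_closure_outer frontier_outer_iff by blast+
qed

lemma alpha_fibre: "{y \<in> Fin ` frontier outer. gmap y = Fin (of_real alpha)} =
    {Fin (of_real alpha), Fin gamma, Fin (cnj gamma)}"
proof -
  have "gmap (Fin z) = Fin (of_real alpha) \<longleftrightarrow> z = of_real alpha \<or> z = gamma \<or> z = cnj gamma"
    if "z \<in> frontier outer" for z
    using G_frontier_outer(1)[OF that] G_eq_alpha_iff[of z] by (simp add: gmap_Fin)
  then show ?thesis
    using gamma_in_frontier alpha_in_frontier by blast
qed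

lemma card_alpha_fibre: "card {y \<in> Fin ` frontier outer. gmap y = Fin (of_real alpha)} = 3"
proof -
  have "Im (of_real alpha) = 0" by simp
  then have "of_real alpha \<noteq> gamma" "of_real alpha \<noteq> cnj gamma" "gamma \<noteq> cnj gamma"
    using gamma_Im_pos by (auto simp: complex_eq_iff)
  then show ?thesis
    unfolding alpha_fibre by simp
qed

section \<open>Boundary points with at most two preimages\<close>

text \<open>Real points m > 2 satisfy G m > m. The largest non-escaping point of [s, 6] would thus
  be exceeded by its own image, which does not escape either.\<close>

lemma real_ray_subset_outer:
  assumes "2 < t"
  shows "of_real t \<in> outer"
proof -
  have nf: "of_real s \<notin> filled" if "2 < s" for s
  proof
    assume s: "complex_of_real s \<in> filled"
    define Z where "Z = {s..6} \<inter> complex_of_real -` filled"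
    have "compact Z"
      unfolding Z_def by (intro compact_Int_closed compact_Icc closed_vimage closed_filled continuous_intros)
    moreover have "s \<in> Z"
      using s filled_bounded[OF s] that by (simp add: Z_def)
    ultimately obtain m where m: "m \<in> Z" "\<And>x. x \<in> Z \<Longrightarrow> x \<le> m"
      using compact_attains_sup[of Z] by blast
    define m' where "m' = (m ^ 3 - 3 * m + 2) / (3 / 2 * m - 1)"
    have m2: "2 < m" using m(1) that by (simp add: Z_def)
    have "0 < (m - 2) * (m * (m + 1 / 2) - 1)"
    proof (rule mult_pos_pos)
      have "2 * 2 \<le> m * (m + 1 / 2)" using m2 by (intro mult_mono) auto
      then show "0 < m * (m + 1 / 2) - 1" by simp
    qed (use m2 in simp)
    then have "m * (3 / 2 * m - 1) < m ^ 3 - 3 * m + 2"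
      by (simp add: power3_eq_cube field_simps)
    then have "m < m'"
      using m2 by (simp add: m'_def pos_less_divide_eq)
    have "G (of_real m) = of_real m'"
      by (simp add: G_def m'_def)
    moreover have "G (of_real m) \<in> filled"
      using m(1) filled_iff[of "of_real m"] by (simp add: Z_def)
    ultimately have f: "of_real m' \<in> filled" by simp
    have "m' \<in> Z"
      using f filled_bounded[OF f] \<open>m < m'\<close> m(1) by (simp add: Z_def)
    then show False
      using m(2) \<open>m < m'\<close> by force
  qed
  have "complex_of_real ` {2<..} \<subseteq> outer"
  proof (rule connected_subset_outer)
    show "connected (complex_of_real ` {2<..})"
      by (intro connected_continuous_image continuous_intros) auto
    show "complex_of_real ` {2<..} \<subseteq> - filled"
      using nf by auto
    show "complex_of_real 7 \<in> complex_of_real ` {2<..}" by (intro imageI) simp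
    show "complex_of_real 7 \<in> outer"
      using large_subset_outer by auto
  qed
  then show ?thesis using assms by auto
qed

text \<open>The complement of \<open>outer\<close> is connected and contains both 2 and 0, so it
  meets the circle; the circle meets \<open>outer\<close> in 2 + r. Being connected, the circle
  meets the frontier.\<close>

lemma frontier_outer_near_2:
  assumes "0 < r" "r < 1"
  obtains x where "x \<in> frontier outer" "dist 2 x = r"
proof -
  have two: "(2::complex) \<in> filled"
  proof -
    have "{2::complex} \<subseteq> filled"
      by (rule invariant_subset_filled) (simp add: G_def)
    then show ?thesis by simp
  qed
  have "sphere 2 r \<inter> - outer \<noteq> {}"
  proof -
    have "- outer \<inter> frontier (ball 2 r) \<noteq> {}"
    proof (rule connected_Int_frontier[OF connected_compl_outer])
      show "- outer \<inter> ball 2 r \<noteq> {}"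
        using two outer_subset assms by (auto intro!: exI[of _ 2])
      show "- outer - ball 2 r \<noteq> {}"
        using zero_notin_outer assms by (auto intro!: exI[of _ 0])
    qed
    then show ?thesis using assms by (auto simp: frontier_ball)
  qed
  moreover have "sphere 2 r \<inter> outer \<noteq> {}"
  proof -
    have "complex_of_real (2 + r) \<in> outer"
      using assms by (intro real_ray_subset_outer) simp
    moreover have "dist 2 (complex_of_real (2 + r)) = r"
      using assms by (simp add: dist_norm)
    ultimately show ?thesis by (metis disjoint_iff mem_sphere)
  qed
  moreover have "connected (sphere (2::complex) r)"
    by (rule connected_sphere) simp
  ultimately have "sphere 2 r \<inter> frontier outer \<noteq> {}"
    by (intro connected_Int_frontier) blast+
  then obtain x where "x \<in> sphere 2 r" "x \<in> frontier outer" by blast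
  then show thesis using that[of x] by simp
qed

text \<open>One preimage lies inside the loop, away from the closure of \<open>outer\<close>, which
  leaves at most two of the three for the frontier.\<close>

definition thin_points :: "complex set" where
  "thin_points = {x \<in> frontier outer. \<exists>z \<in> loop_inside. z \<noteq> 2 / 3 \<and> G z = x}"

lemma infinite_thin_points: "infinite thin_points"
proof
  assume fin: "finite thin_points"
  \<comment> \<open>Solves G z = 2, since z^3 - 3z + 2 - 2 (3/2 z - 1) = (z - 2)(z^2 + 2z -
    2).\<close>
  define b where "b = complex_of_real (sqrt 3 - 1)"
  have s3: "3 / 2 < sqrt 3" "sqrt 3 < 2"
    by (rule real_less_rsqrt, simp add: power2_eq_square, rule real_less_lsqrt, simp_all)
  have b: "b \<in> loop_inside"
    using s3 by (simp add: loop_inside_def trisectrix_def b_def)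
  have "Re b \<noteq> Re (2 / 3)"
  proof
    assume "Re b = Re (2 / 3)"
    then have "sqrt 3 = 5 / 3" by (simp add: b_def)
    then have "(sqrt 3)\<^sup>2 = (5 / 3)\<^sup>2" by (rule arg_cong)
    then show False by (simp add: power_divide)
  qed
  then have bp: "b \<noteq> 2 / 3" by blast
  have "b\<^sup>2 + 2 * b = 2"
  proof -
    have "(sqrt 3 - 1)\<^sup>2 + 2 * (sqrt 3 - 1) = 2"
      by (simp add: power2_eq_square algebra_simps)
    then have "complex_of_real ((sqrt 3 - 1)\<^sup>2 + 2 * (sqrt 3 - 1)) = of_real 2" by (simp only:)
    then show ?thesis by (simp add: b_def)
  qed
  moreover have "b ^ 3 - 3 * b + 2 - 2 * (3 / 2 * b - 1) = (b\<^sup>2 + 2 * b - 2) * (b - 2)"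
    by (simp add: power2_eq_square power3_eq_cube algebra_simps)
  ultimately have "b ^ 3 - 3 * b + 2 - 2 * (3 / 2 * b - 1) = 0"
    by (simp only: diff_self mult_zero_left)
  then have "G b = 2"
    using G_eq_iff[OF bp] by (simp only: right_minus_eq)
  have "open (G ` (loop_inside - {2 / 3}))"
    using open_loop_inside by (intro open_image_G open_Diff) auto
  moreover have "2 \<in> G ` (loop_inside - {2 / 3})"
    using b bp \<open>G b = 2\<close> by (metis DiffI image_eqI singletonD)
  ultimately obtain e where e: "e > 0" "ball 2 e \<subseteq> G ` (loop_inside - {2 / 3})"
    by (meson open_contains_ball)
  \<comment> \<open>Distances to 2 already take a whole interval of values on these points.\<close>
  have "{0<..<min e 1} \<subseteq> dist 2 ` thin_points"
  proof
    fix r assume r: "r \<in> {0<..<min e 1}"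
    then obtain x where x: "x \<in> frontier outer" "dist 2 x = r"
      using frontier_outer_near_2[of r] by auto
    then have "x \<in> G ` (loop_inside - {2 / 3})"
      using e(2) r by auto
    then have "x \<in> thin_points"
      using x(1) by (auto simp: thin_points_def)
    then show "r \<in> dist 2 ` thin_points"
      using x(2) by blast
  qed
  then have "finite {0<..<min e 1}"
    using fin by (meson finite_imageI finite_subset)
  then show False
    using e(1) by (simp add: infinite_Ioo)
qed

lemma card_fibre_thin_point:
  assumes "x \<in> thin_points"
  shows "finite {z \<in> frontier outer. G z = x}" "card {z \<in> frontier outer. G z = x} \<le> 2"
proof -
  obtain b where b: "b \<in> loop_inside" "b \<noteq> 2 / 3" "G b = x"
    using assms by (auto simp: thin_points_def)
  define p where "p = [:2 + x, - 3 - 3 / 2 * x, 0, 1:]"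
  have p: "p \<noteq> 0" "degree p = 3" by (simp_all add: p_def)
  have root: "poly p z = 0" if "z \<noteq> 2 / 3" "G z = x" for z
  proof -
    have "z ^ 3 - 3 * z + 2 = x * (3 / 2 * z - 1)"
      using that G_eq_iff by blast
    moreover have "poly p z = z ^ 3 - 3 * z + 2 - x * (3 / 2 * z - 1)"
      by (simp add: p_def power3_eq_cube algebra_simps)
    ultimately show ?thesis by simp
  qed
  have fin: "finite {z. poly p z = 0}" using p(1) by (rule poly_roots_finite)
  have "b \<notin> frontier outer"
    using b(1) closure_outer_loop_inside by (auto simp: frontier_def)
  moreover have "insert b {z \<in> frontier outer. G z = x} \<subseteq> {z. poly p z = 0}"
    using root b G_frontier_outer(1) by blast
  ultimately have sub: "insert b {z \<in> frontier outer. G z = x} \<subseteq> {z. poly p z = 0}"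
    and nb: "b \<notin> {z \<in> frontier outer. G z = x}" by auto
  have "{z \<in> frontier outer. G z = x} \<subseteq> {z. poly p z = 0}"
    using sub by blast
  then show f: "finite {z \<in> frontier outer. G z = x}"
    using fin by (rule finite_subset)
  have "card (insert b {z \<in> frontier outer. G z = x}) \<le> card {z. poly p z = 0}"
    using fin sub by (rule card_mono)
  then have "Suc (card {z \<in> frontier outer. G z = x}) \<le> card {z. poly p z = 0}"
    using f nb by simp
  also have "\<dots> \<le> 3"
    using card_poly_roots_bound[OF p(1)] p(2) by simp
  finally show "card {z \<in> frontier outer. G z = x} \<le> 2" by simp
qed

section \<open>Polynomial Julia sets\<close>

lemma poly_map_Fin: "poly_map p (Fin z) = Fin (poly p z)"
  by (simp add: poly_map_def)

lemma poly_map_Infty: "0 < degree p \<Longrightarrow> poly_map p Infty = Infty"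
  by (simp add: poly_map_def)

lemma poly_map_eq_Fin: "0 < degree p \<Longrightarrow> poly_map p x = Fin w \<longleftrightarrow> (\<exists>z. x = Fin z \<and> poly p z = w)"
  by (cases x) (auto simp: poly_map_Fin poly_map_Infty)

lemma poly_map_eq_Infty: "0 < degree p \<Longrightarrow> poly_map p x = Infty \<longleftrightarrow> x = Infty"
  by (cases x) (auto simp: poly_map_Fin poly_map_Infty)

text \<open>Used in contrapositive form: all finite preimages of a Julia point are Julia points.
  Normality near \<open>z\<close> is pushed forward by composing each iterate with one more step of
  the map.\<close>

lemma fatou_set_poly_map:
  assumes p: "0 < degree p" and z: "Fin z \<in> fatou_set (poly_map p)"
  shows "Fin (poly p z) \<in> fatou_set (poly_map p)"
proof -
  let ?f = "poly_map p"
  obtain U where U: "open U" "Fin z \<in> U" "normal_family_on (range (\<lambda>n. ?f ^^ n)) U"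
    using z by (auto simp: fatou_set_def)
  obtain e where e: "e > 0" "cball z e \<subseteq> Fin -` U"
    using open_vimage_Fin[OF U(1)] U(2) unfolding open_contains_cball by blast
  have "open (poly p ` ball z e)"
  proof (rule open_mapping_thm[of "poly p" UNIV])
    show "\<not> poly p constant_on UNIV"
    proof
      assume "poly p constant_on UNIV"
      then have "constant (poly p)"
        by (auto simp: constant_on_def constant_def)
      then show False
        using p by (simp add: constant_degree)
    qed
  qed (auto intro: holomorphic_intros)
  then have op: "open (Fin ` poly p ` ball z e)"
    by (rule open_image_Fin)
  \<comment> \<open>An arbitrary section of the polynomial over the image disc. Continuity is
    irrelevant, as the limit function need only be a uniform limit on the image.\<close>
  define u where "u y = (SOME u. u \<in> ball z e \<and> Fin (poly p u) = y)" for y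
  have u: "u y \<in> ball z e" "?f (Fin (u y)) = y" if "y \<in> Fin ` poly p ` ball z e" for y
  proof -
    have "\<exists>u. u \<in> ball z e \<and> Fin (poly p u) = y" using that by auto
    then have "u y \<in> ball z e \<and> Fin (poly p (u y)) = y"
      unfolding u_def by (rule someI_ex)
    then show "u y \<in> ball z e" "?f (Fin (u y)) = y" by (auto simp: poly_map_Fin)
  qed
  have "normal_family_on (range (\<lambda>n. ?f ^^ n)) (Fin ` poly p ` ball z e)"
    unfolding normal_family_on_def
  proof (intro allI impI)
    fix s :: "nat \<Rightarrow> rsphere \<Rightarrow> rsphere"
    assume s: "\<forall>n. s n \<in> range (\<lambda>n. ?f ^^ n)"
    have "\<forall>n. (\<lambda>x. s n (?f x)) \<in> range (\<lambda>n. ?f ^^ n)"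
    proof
      fix n
      obtain m where "s n = ?f ^^ m" using s by blast
      then have "(\<lambda>x. s n (?f x)) = ?f ^^ Suc m"
        by (simp add: funpow_swap1 fun_eq_iff)
      then show "(\<lambda>x. s n (?f x)) \<in> range (\<lambda>n. ?f ^^ n)" by blast
    qed
    then obtain r h where r: "strict_mono (r :: nat \<Rightarrow> nat)"
      and lim: "\<And>K. compact K \<and> K \<subseteq> U \<Longrightarrow> uniform_limit K (\<lambda>n x. s (r n) (?f x)) h sequentially"
      using U(3)[unfolded normal_family_on_def, rule_format, of "\<lambda>n x. s n (?f x)"] by blast
    have lim': "uniform_limit (Fin ` cball z e) (\<lambda>n x. s (r n) (?f x)) h sequentially"
      using e(2) by (intro lim conjI compact_continuous_image continuous_on_Fin compact_cball) auto
    have "uniform_limit (Fin ` poly p ` ball z e) (\<lambda>n. s (r n)) (\<lambda>y. h (Fin (u y))) sequentially"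
      unfolding uniform_limit_iff
    proof (intro allI impI)
      fix d :: real assume "d > 0"
      then have "\<forall>\<^sub>F n in sequentially. \<forall>x\<in>Fin ` cball z e. dist (s (r n) (?f x)) (h x) < d"
        using lim' unfolding uniform_limit_iff by blast
      then show "\<forall>\<^sub>F n in sequentially. \<forall>y\<in>Fin ` poly p ` ball z e. dist (s (r n) y) (h (Fin (u y))) < d"
      proof (rule eventually_mono, intro ballI)
        fix n y assume n: "\<forall>x\<in>Fin ` cball z e. dist (s (r n) (?f x)) (h x) < d"
          and y: "y \<in> Fin ` poly p ` ball z e"
        have "Fin (u y) \<in> Fin ` cball z e"
          using u(1)[OF y] by auto
        then have "dist (s (r n) (?f (Fin (u y)))) (h (Fin (u y))) < d"
          using n by blast
        then show "dist (s (r n) y) (h (Fin (u y))) < d"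
          by (simp only: u(2)[OF y])
      qed
    qed
    then show "\<exists>r h. strict_mono (r :: nat \<Rightarrow> nat) \<and>
      (\<forall>K. compact K \<and> K \<subseteq> Fin ` poly p ` ball z e \<longrightarrow> uniform_limit K (\<lambda>n. s (r n)) h sequentially)"
      using r by (meson uniform_limit_on_subset)
  qed
  moreover have "Fin (poly p z) \<in> Fin ` poly p ` ball z e"
    using e(1) by simp
  ultimately show ?thesis
    using op by (auto simp: fatou_set_def)
qed

lemma card_roots_eq_degree:
  fixes p :: "complex poly"
  assumes "\<And>a. poly p a = 0 \<Longrightarrow> poly (pderiv p) a \<noteq> 0"
  shows "card {z. poly p z = 0} = degree p"
proof -
  have sq: "rsquarefree p"
    using assms by (auto simp: rsquarefree_roots)
  then have "p \<noteq> 0" by (auto simp: rsquarefree_def)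
  have "degree p = degree (smult (lead_coeff p) (\<Prod>z|poly p z = 0. [:-z, 1:]))"
    by (simp only: complex_poly_decompose_rsquarefree[OF sq])
  also have "\<dots> = degree (\<Prod>z|poly p z = 0. [:-z, 1:])"
    using \<open>p \<noteq> 0\<close> by simp
  also have "\<dots> = card {z. poly p z = 0}"
    by (subst degree_prod_eq_sum_degree) auto
  finally show ?thesis by simp
qed

lemma not_conjugate_to_polynomial:
  assumes "degree p \<ge> 2"
  shows "\<not> topologically_conjugate gmap (Fin ` frontier outer) (poly_map p) (julia_set (poly_map p))"
proof
  let ?A = "Fin ` frontier outer" and ?J = "julia_set (poly_map p)"
  assume "topologically_conjugate gmap ?A (poly_map p) ?J"
  then obtain h k where hk: "homeomorphism ?A ?J h k"
    and conj: "\<And>x. x \<in> ?A \<Longrightarrow> h (gmap x) = poly_map p (h x)"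
    unfolding topologically_conjugate_def by blast
  have p: "0 < degree p" using assms by simp
  have kh: "k (h x) = x" "h x \<in> ?J" if "x \<in> ?A" for x
    using hk that unfolding homeomorphism_def by auto
  have hk': "h (k y) = y" "k y \<in> ?A" if "y \<in> ?J" for y
    using hk that unfolding homeomorphism_def by auto
  have injh: "inj_on h ?A" using kh by (metis inj_onI)
  have gA: "gmap (Fin z) = Fin (G z)" "Fin (G z) \<in> ?A" if "z \<in> frontier outer" for z
    using G_frontier_outer[OF that] by (auto simp: gmap_Fin)
  define Q where "Q w = p + [:- w:]" for w
  have polyQ: "poly (Q w) z = 0 \<longleftrightarrow> poly p z = w" for w z by (simp add: Q_def)
  have degQ: "degree (Q w) = degree p" for w
    unfolding Q_def using p by (intro degree_add_eq_left) simp_all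
  define fib where "fib x = {y \<in> ?A. gmap y = x}" for x
  have himg: "h ` fib x \<subseteq> {y. poly_map p y = h x}" for x
    using conj by (auto simp: fib_def)
  have deg3: "3 \<le> degree p"
  proof -
    define a where "a = Fin (of_real alpha)"
    have card: "card (h ` fib a) = 3"
    proof -
      have "inj_on h (fib a)" using injh by (rule inj_on_subset) (auto simp: fib_def)
      then show ?thesis
        using card_alpha_fibre by (simp add: card_image fib_def a_def)
    qed
    show ?thesis
    proof (cases "h a")
      \<comment> \<open>Infinity is its own only preimage under a nonconstant polynomial, so a fibre
        of three points cannot lie over it.\<close>
      case Infty
      then have "h ` fib a \<subseteq> {Infty}"
        using himg[of a] poly_map_eq_Infty[OF p] by auto
      then have "card (h ` fib a) \<le> 1"
        by (metis card.empty card_insert_disjoint card_mono empty_iff finite.emptyI finite_insert One_nat_def)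
      then show ?thesis using card by simp
    next
      case (Fin w)
      have sub: "h ` fib a \<subseteq> Fin ` {z. poly (Q w) z = 0}"
        using himg[of a] poly_map_eq_Fin[OF p] by (auto simp: Fin polyQ)
      have Q0: "Q w \<noteq> 0" using degQ[of w] p by auto
      have fin: "finite {z. poly (Q w) z = 0}" using Q0 by (rule poly_roots_finite)
      have "card (h ` fib a) \<le> card (Fin ` {z. poly (Q w) z = 0})"
        using fin by (intro card_mono sub finite_imageI)
      also have "\<dots> \<le> card {z. poly (Q w) z = 0}"
        using fin by (rule card_image_le)
      also have "\<dots> \<le> degree p"
        using card_poly_roots_bound[OF Q0] degQ by simp
      finally show ?thesis
        using card by simp
    qed
  qed
  \<comment> \<open>Critical values and infinity: off this finite set the roots of
    \<open>Q w\<close> are simple and so as many as the degree.\<close>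
  define crit where "crit = insert Infty (Fin ` poly p ` {c. poly (pderiv p) c = 0})"
  have "pderiv p \<noteq> 0" using p by (simp add: pderiv_eq_0_iff)
  then have fincrit: "finite crit"
    unfolding crit_def by (intro finite.insertI finite_imageI poly_roots_finite)
  have "h (Fin x) \<in> crit" if x: "x \<in> thin_points" for x
  proof (rule ccontr)
    assume nc: "h (Fin x) \<notin> crit"
    have xA: "Fin x \<in> ?A" using x by (auto simp: thin_points_def)
    obtain w where w: "h (Fin x) = Fin w"
      using nc by (cases "h (Fin x)") (auto simp: crit_def)
    have "poly (pderiv (Q w)) c \<noteq> 0" if "poly (Q w) c = 0" for c
      using nc that polyQ by (auto simp: crit_def w Q_def pderiv_add pderiv_pCons image_iff)
    then have card: "card {z. poly (Q w) z = 0} = degree p"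
      using card_roots_eq_degree degQ by metis
    have rootJ: "Fin z \<in> ?J" if "poly (Q w) z = 0" for z
    proof -
      have "Fin (poly p z) \<in> ?J"
        using kh(2)[OF xA] that w polyQ by simp
      then show ?thesis
        using fatou_set_poly_map[OF p] by (auto simp: julia_set_def)
    qed
    have "k (Fin z) \<in> Fin ` {v \<in> frontier outer. G v = x}" if z: "poly (Q w) z = 0" for z
    proof -
      obtain v where v: "k (Fin z) = Fin v" "v \<in> frontier outer"
        using hk'(2)[OF rootJ[OF z]] by blast
      have "h (gmap (Fin v)) = poly_map p (h (k (Fin z)))"
        using conj v by auto
      also have "\<dots> = h (Fin x)"
        using z hk'(1)[OF rootJ[OF z]] by (simp add: poly_map_Fin polyQ w)
      finally have "h (Fin (G v)) = h (Fin x)"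
        using gA(1)[OF v(2)] by simp
      then have "G v = x"
        using injh gA(2)[OF v(2)] xA by (auto dest: inj_onD)
      then show ?thesis using v by auto
    qed
    then have sub: "(\<lambda>z. k (Fin z)) ` {z. poly (Q w) z = 0} \<subseteq> Fin ` {v \<in> frontier outer. G v = x}"
      by blast
    have "inj_on (\<lambda>z. k (Fin z)) {z. poly (Q w) z = 0}"
      using hk'(1) rootJ by (intro inj_onI) (metis mem_Collect_eq rsphere.inject)
    then have "degree p = card ((\<lambda>z. k (Fin z)) ` {z. poly (Q w) z = 0})"
      using card by (simp add: card_image)
    also have "\<dots> \<le> card (Fin ` {v \<in> frontier outer. G v = x})"
      using card_fibre_thin_point(1)[OF x] by (intro card_mono sub finite_imageI)
    also have "\<dots> \<le> 2"
      using card_fibre_thin_point[OF x] card_image_le order_trans by blast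
    finally show False using deg3 by simp
  qed
  then have "(\<lambda>x. h (Fin x)) ` thin_points \<subseteq> crit" by blast
  moreover have "inj_on (\<lambda>x. h (Fin x)) thin_points"
    using injh by (intro inj_onI) (auto simp: thin_points_def dest: inj_onD)
  ultimately have "finite thin_points"
    using fincrit by (meson finite_imageD finite_subset)
  then show False
    using infinite_thin_points by blast
qed

section \<open>Critical points\<close>

lemma has_field_derivative_G:
  assumes "a \<noteq> 2 / 3"
  shows "(G has_field_derivative 3 * a\<^sup>2 * (a - 1) / (3 / 2 * a - 1)\<^sup>2) (at a)"
proof -
  have d: "3 / 2 * a - 1 \<noteq> 0" using assms denom_eq_0_iff by blast
  have "((\<lambda>z. (z ^ 3 - 3 * z + 2) / (3 / 2 * z - 1)) has_field_derivative
      ((3 * a\<^sup>2 - 3) * (3 / 2 * a - 1) - (a ^ 3 - 3 * a + 2) * (3 / 2)) / ((3 / 2 * a - 1) * (3 / 2 * a - 1))) (at a)"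
    using d by (intro DERIV_divide) (auto intro!: derivative_eq_intros)
  moreover have "(3 * a\<^sup>2 - 3) * (3 / 2 * a - 1) - (a ^ 3 - 3 * a + 2) * (3 / 2) = 3 * a\<^sup>2 * (a - 1)"
    by (simp add: power2_eq_square power3_eq_cube field_simps)
  ultimately show ?thesis
    by (simp only: G_def[abs_def] power2_eq_square[of "3 / 2 * a - 1"])
qed

lemma deriv_local_rep_gmap:
  assumes "a \<noteq> 2 / 3"
  shows "deriv (local_rep gmap (Fin a)) 0 = 3 * a\<^sup>2 * (a - 1) / (3 / 2 * a - 1)\<^sup>2"
proof -
  have "((\<lambda>w. a + w) \<longlongrightarrow> a + 0) (nhds 0)"
    by (intro tendsto_intros filterlim_ident)
  then have "\<forall>\<^sub>F w in nhds 0. a + w \<noteq> 2 / 3"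
    using assms by (intro tendsto_imp_eventually_ne) auto
  then have ev: "\<forall>\<^sub>F w in nhds 0. local_rep gmap (Fin a) w = G (a + w) - G a"
    by eventually_elim (use assms in \<open>simp add: local_rep_def gmap_Fin\<close>)
  define D where "D = 3 * a\<^sup>2 * (a - 1) / (3 / 2 * a - 1)\<^sup>2"
  have "(G has_field_derivative D) (at (0 + a))"
    using has_field_derivative_G[OF assms] by (simp only: D_def add_0)
  then have "((\<lambda>w. G (a + w)) has_field_derivative D) (at 0)"
    by (simp only: DERIV_shift add.commute[of a])
  then have "((\<lambda>w. G (a + w) - G a) has_field_derivative D - 0) (at 0)"
    by (intro DERIV_diff DERIV_const)
  then show ?thesis
    using deriv_cong_ev[OF ev refl] by (simp only: DERIV_imp_deriv D_def diff_0_right)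
qed

text \<open>The pole is simple, with numerator value 8/27; in the coordinate at infinity the map is
  3/2 w / N w.\<close>

lemma deriv_local_rep_gmap_pole: "deriv (local_rep gmap (Fin (2 / 3))) 0 \<noteq> 0"
proof -
  define N where "N w = (2 / 3 + w) ^ 3 - 3 * (2 / 3 + w) + 2" for w :: complex
  have N0: "N 0 = 8 / 27" by (simp add: N_def power3_eq_cube)
  have "isCont N 0" unfolding N_def by (intro continuous_intros)
  then have "(N \<longlongrightarrow> N 0) (nhds 0)"
    by (simp add: continuous_at tendsto_at_iff_tendsto_nhds)
  then have "\<forall>\<^sub>F w in nhds 0. N w \<noteq> 0"
    by (rule tendsto_imp_eventually_ne) (simp add: N0)
  then have ev: "\<forall>\<^sub>F w in nhds 0. local_rep gmap (Fin (2 / 3)) w = 3 / 2 * w / N w"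
  proof eventually_elim
    case (elim w)
    have "gmap (Fin (2 / 3)) = Infty" by (simp add: gmap_Fin)
    then show ?case
      unfolding local_rep_def param.simps(1)
      by (simp only: gmap_near_pole[OF N_def elim] coord_param_Infty)
  qed
  have "\<exists>D. (N has_field_derivative D) (at 0)"
    unfolding N_def by (rule exI) (auto intro!: derivative_eq_intros)
  then obtain D where "(N has_field_derivative D) (at 0)" by blast
  then have "((\<lambda>w. 3 / 2 * w / N w) has_field_derivative (3 / 2 * N 0 - 3 / 2 * 0 * D) / (N 0 * N 0)) (at 0)"
    by (intro DERIV_divide) (auto intro!: derivative_eq_intros simp: N0)
  then have "deriv (\<lambda>w. 3 / 2 * w / N w) 0 = (3 / 2 * N 0 - 3 / 2 * 0 * D) / (N 0 * N 0)"
    by (rule DERIV_imp_deriv)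
  with deriv_cong_ev[OF ev refl] have "deriv (local_rep gmap (Fin (2 / 3))) 0 = (3 / 2 * N 0 - 3 / 2 * 0 * D) / (N 0 * N 0)"
    by (rule trans)
  also have "\<dots> \<noteq> 0" by (simp add: N0)
  finally show ?thesis .
qed

lemma simple_critical_point_Infty: "simple_critical_point gmap Infty"
proof -
  define Q where "Q w = 1 - 3 * w\<^sup>2 + 2 * w ^ 3" for w :: complex
  \<comment> \<open>The derivative of \<open>Ghat\<close> divided by \<open>w\<close>; the second
    derivative at 0 is therefore \<open>R 0\<close>, which is 3.\<close>
  define R where "R w = ((3 - 3 * w) * Q w - (3 / 2 * w - w\<^sup>2) * (6 * w\<^sup>2 - 6 * w)) / (Q w * Q w)" for w
  have Q0: "Q 0 = 1" by (simp add: Q_def)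
  have "isCont Q 0" unfolding Q_def by (intro continuous_intros)
  then have "(Q \<longlongrightarrow> Q 0) (nhds 0)"
    by (simp add: continuous_at tendsto_at_iff_tendsto_nhds)
  then have evQ: "\<forall>\<^sub>F w in nhds 0. Q w \<noteq> 0"
    by (rule tendsto_imp_eventually_ne) (simp add: Q0)
  then have ev: "\<forall>\<^sub>F w in nhds 0. local_rep gmap Infty w = Ghat w"
  proof eventually_elim
    case (elim w)
    then show ?case
      unfolding local_rep_def gmap_Infty
      by (simp only: gmap_param_Infty[OF elim[unfolded Q_def]] coord_param_Infty)
  qed
  have derivGhat: "deriv Ghat w = w * R w" if "Q w \<noteq> 0" for w
  proof -
    have "((\<lambda>w. (3 / 2 * w\<^sup>2 - w ^ 3) / Q w) has_field_derivative
        ((3 * w - 3 * w\<^sup>2) * Q w - (3 / 2 * w\<^sup>2 - w ^ 3) * (6 * w\<^sup>2 - 6 * w)) / (Q w * Q w)) (at w)"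
      using that by (intro DERIV_divide) (auto intro!: derivative_eq_intros simp: Q_def)
    moreover have "Ghat = (\<lambda>w. (3 / 2 * w\<^sup>2 - w ^ 3) / Q w)"
      by (simp add: fun_eq_iff Ghat_def Q_def power2_eq_square power3_eq_cube algebra_simps)
    ultimately have "deriv Ghat w = ((3 * w - 3 * w\<^sup>2) * Q w - (3 / 2 * w\<^sup>2 - w ^ 3) * (6 * w\<^sup>2 - 6 * w)) / (Q w * Q w)"
      by (simp add: DERIV_imp_deriv)
    also have "(3 * w - 3 * w\<^sup>2) * Q w - (3 / 2 * w\<^sup>2 - w ^ 3) * (6 * w\<^sup>2 - 6 * w) =
        w * ((3 - 3 * w) * Q w - (3 / 2 * w - w\<^sup>2) * (6 * w\<^sup>2 - 6 * w))"
      by (simp add: power2_eq_square power3_eq_cube algebra_simps)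
    finally show ?thesis by (simp add: R_def)
  qed
  have 1: "deriv (local_rep gmap Infty) 0 = 0"
    using deriv_cong_ev[OF ev refl] derivGhat[of 0] by (simp add: Q0)
  have "(deriv ^^ 2) (local_rep gmap Infty) 0 = (deriv ^^ 2) Ghat 0"
    by (rule higher_deriv_cong_ev[OF ev refl])
  then have "deriv (deriv (local_rep gmap Infty)) 0 = deriv (deriv Ghat) 0"
    by (simp add: numeral_2_eq_2)
  also have "\<dots> = deriv (\<lambda>w. w * R w) 0"
    by (rule deriv_cong_ev) (use evQ in \<open>auto elim!: eventually_mono simp: derivGhat\<close>)
  also have "\<dots> = 3"
  proof -
    have "Q analytic_on {0}"
      unfolding Q_def by (intro analytic_intros)
    then have "R analytic_on {0}"
      unfolding R_def by (intro analytic_intros) (simp_all add: Q0)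
    then obtain D where "(R has_field_derivative D) (at 0)"
      using analytic_on_imp_differentiable_at field_differentiable_def by blast
    then have "((\<lambda>w. w * R w) has_field_derivative 1 * R 0 + D * 0) (at 0)"
      by (intro DERIV_mult DERIV_ident)
    then show ?thesis
      by (simp add: DERIV_imp_deriv R_def Q0)
  qed
  finally have 2: "deriv (deriv (local_rep gmap Infty)) 0 = 3" .
  show ?thesis
    using 1 2 by (simp add: simple_critical_point_def critical_set_def)
qed

lemma critical_set_gmap: "critical_set gmap \<subseteq> {Fin 0, Fin 1, Infty}"
proof
  fix x assume x: "x \<in> critical_set gmap"
  show "x \<in> {Fin 0, Fin 1, Infty}"
  proof (cases x)
    case (Fin a)
    have d0: "deriv (local_rep gmap (Fin a)) 0 = 0"
      using x Fin by (simp add: critical_set_def)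
    then have a: "a \<noteq> 2 / 3"
      using deriv_local_rep_gmap_pole by metis
    then have "3 / 2 * a - 1 \<noteq> 0" using denom_eq_0_iff by blast
    then have "a = 0 \<or> a = 1"
      using d0 unfolding deriv_local_rep_gmap[OF a]
      by (simp only: divide_eq_0_iff mult_eq_0_iff power_eq_0_iff right_minus_eq) auto
    then show ?thesis using Fin by auto
  qed simp
qed

text \<open>Critical orbits: 1 -> 0 -> -2 -> 0, and infinity is fixed.\<close>

lemma postcritical_set_gmap: "postcritical_set gmap \<subseteq> {Fin 0, Fin (-2), Infty}"
proof -
  let ?P = "{Fin 0, Fin (-2), Infty}"
  have ne: "(0::complex) \<noteq> 2 / 3" "(1::complex) \<noteq> 2 / 3" "(-2::complex) \<noteq> 2 / 3" by auto
  have vals: "gmap (Fin 0) = Fin (-2)" "gmap (Fin 1) = Fin 0" "gmap (Fin (-2)) = Fin 0"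
    using ne by (simp_all add: gmap_Fin G_def)
  have it: "(gmap ^^ n) x \<in> ?P" if "x \<in> ?P" for x n
    by (induction n) (use that in \<open>auto simp: vals gmap_Infty\<close>)
  have "(gmap ^^ n) x \<in> ?P" if "0 < n" "x \<in> critical_set gmap" for n x
  proof -
    obtain m where m: "n = Suc m" using \<open>0 < n\<close> gr0_conv_Suc by blast
    have "gmap x \<in> ?P"
      using that(2) critical_set_gmap vals gmap_Infty by auto
    then have "(gmap ^^ m) (gmap x) \<in> ?P" by (rule it)
    then show ?thesis by (simp add: m funpow_swap1)
  qed
  then have "(\<Union>n\<in>{0<..}. (gmap ^^ n) ` critical_set gmap) \<subseteq> ?P" by blast
  moreover have "closed ?P" by (intro finite_imp_closed) simp
  ultimately show ?thesis
    unfolding postcritical_set_def by (rule closure_minimal)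
qed

lemma critically_finite_gmap: "critically_finite gmap"
  unfolding critically_finite_def using postcritical_set_gmap by (rule finite_subset) simp

lemma hyperbolic_gmap: "hyperbolic gmap"
  using postcritical_set_gmap zero_in_fatou minus_2_in_fatou basin_subset_fatou Infty_in_basin
  unfolding hyperbolic_def julia_set_def by blast

lemma rational_map_of_degree_gmap: "rational_map_of_degree gmap 3"
proof -
  let ?p = "[:2, 1:] * [:-1, 1:]\<^sup>2 :: complex poly" and ?q = "[:-1, 3 / 2:] :: complex poly"
  \<comment> \<open>Division with remainder; the remainder 8/27 is a nonzero constant, hence a
    unit.\<close>
  have "?p = ?q * [:- 46 / 27, 4 / 9, 2 / 3:] + [:8 / 27:]"
    unfolding numer_eq by simp
  then have eq: "[:8 / 27:] = ?p - ?q * [:- 46 / 27, 4 / 9, 2 / 3:]" by simp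
  have "coprime ?p ?q"
  proof (rule coprimeI)
    fix d assume "d dvd ?p" "d dvd ?q"
    then have "d dvd [:8 / 27:]"
      unfolding eq by (rule dvd_diff[OF _ dvd_mult2])
    moreover have "[:8 / 27 :: complex:] dvd 1"
      by (rule dvdI[of _ _ "[:27 / 8:]"]) (simp add: one_pCons)
    ultimately show "is_unit d"
      by (rule dvd_trans)
  qed
  moreover have "?q \<noteq> 0" by simp
  moreover have "3 = max (degree ?p) (degree ?q)"
    unfolding degree_numer by simp
  ultimately show ?thesis
    unfolding rational_map_of_degree_def gmap_def by blast
qed

theorem mainTheorem4:
  fixes g :: "rsphere \<Rightarrow> rsphere" and \<Omega> :: "rsphere set"
  assumes g: "g = rat_map ([:2, 1:] * [:-1, 1:]\<^sup>2) [:-1, 3/2:]"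
    and \<Omega>: "\<Omega> = connected_component_set (- julia_set g) Infty"
  shows "rational_map_of_degree g 3 \<and> critically_finite g \<and> hyperbolic g \<and>
    g Infty = Infty \<and> simple_critical_point g Infty \<and>
    \<Omega> \<in> components (- julia_set g) \<and> Infty \<in> \<Omega> \<and>
    g ` \<Omega> = \<Omega> \<and>
    conformally_conjugate g \<Omega> (poly_map (monom 1 2)) (Fin ` ball 0 1) \<and>
    g ` frontier \<Omega> \<subseteq> frontier \<Omega> \<and>
    (\<exists>x\<in>frontier \<Omega>. card {y \<in> frontier \<Omega>. g y = x} = 3) \<and>
    \<not> (\<exists>p :: complex poly. degree p \<ge> 2 \<and>
         topologically_conjugate g (frontier \<Omega>) (poly_map p) (julia_set (poly_map p)))"
proof -
  have gg: "g = gmap"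
    by (simp only: g gmap_def)
  have eq: "\<Omega> = insert Infty (Fin ` outer)"
    using \<Omega> fatou_component_eq by (simp only: gg)
  have fr: "frontier \<Omega> = Fin ` frontier outer"
    unfolding eq using open_outer large_subset_outer by (rule frontier_insert_Infty)
  have Inf: "Infty \<in> - julia_set gmap"
    using basin_subset_fatou Infty_in_basin by (auto simp: julia_set_def)
  have comp: "\<Omega> \<in> components (- julia_set gmap)"
    unfolding components_def \<Omega> gg using Inf by blast
  have front: "gmap ` frontier \<Omega> \<subseteq> frontier \<Omega>"
    unfolding fr using G_frontier_outer by (auto simp: gmap_Fin)
  have three: "\<exists>x\<in>frontier \<Omega>. card {y \<in> frontier \<Omega>. gmap y = x} = 3"
    unfolding fr using alpha_in_frontier card_alpha_fibre by (intro bexI[of _ "Fin (of_real alpha)"]) auto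
  show ?thesis
    unfolding gg
    using rational_map_of_degree_gmap critically_finite_gmap hyperbolic_gmap gmap_Infty
      simple_critical_point_Infty comp gmap_image_outer outer_conformally_conjugate front three
      not_conjugate_to_polynomial
    by (intro conjI) (simp_all add: eq fr[unfolded eq])
qed

end
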